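(* Let $X_0,X_1,\dots,X_n$ be vector fields on a bounded domain $\Omega\subset\mathbb{R}^p$, with $X_1,\dots,X_n$ having $C^{r-1,\alpha}(\Omega)$ coefficients and $X_0$ having $C^{r-2,\alpha}(\Omega)$ coefficients ($r\ge2$ integer, $\alpha\in(0,1]$), satisfying Hörmander's condition of step $r$ in $\Omega$ and free up to weight $r$ in $\Omega$. Let $\Theta_y(\cdot)$ be the map given by regularized canonical coordinates centered at $y$ (defined in the context). Then, locally, the change of coordinates in $\mathbb{R}^p$ given by $u=\Theta_y(x)$ has a Jacobian determinant given by $$dx=c(y)\bigl(1+O(\|u\|)\bigr)\,du,$$ where $c(y)$ is a $C^\alpha$ function, bounded and bounded away from zero. More explicitly: for every $\Omega'\Subset\Omega$, for $y\in\Omega'$ and $u$ in a neighborhood of $0$, the Jacobian determinant of the inverse map $u\mapsto x=\Theta_y^{-1}(u)$ equals $c(y)+\omega(y,u)$, i.e. $dx=[c(y)+\omega(y,u)]\,du$, with $|\omega(y,u)|\le c\|u\|$ for some constant $c$, where $c(y)$ is a $C^\alpha$ function of $y$, bounded and bounded away from zero.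
   Context: Weights and commutators: $X_0$ has weight $p_0=2$, $X_i$ has weight $p_i=1$ for $i\ge1$. For $I=(i_1,\dots,i_k)$, $i_j\in\{0,\dots,n\}$, $|I|=\sum_j p_{i_j}$ and $X_{[I]}=[X_{i_1},[X_{i_2},\dots[X_{i_{k-1}},X_{i_k}]\dots]]$, $X_{[(i)]}=X_i$. Hörmander's condition of step $r$ in $\Omega$: $\{(X_{[I]})_x\}_{|I|\le r}$ spans $\mathbb{R}^p$ for every $x\in\Omega$. In noncommuting indeterminates $\xi_0,\dots,\xi_n$ write $\xi_{[I]}=[\xi_{i_1},[\dots,\xi_{i_k}]\dots]=\sum_JA_{IJ}\xi_J$. The fields are free up to weight $r$ in $\Omega$ if at each $x\in\Omega$: $\sum_{|I|\le r}a_I(X_{[I]})_x=0$ (real constants $a_I$) implies $\sum_{|I|\le r} a_IA_{IJ}=0$ for all $J$. A set $B$ of $p$ multiindices of weight $\le r$ is fixed so that $\{(X_{[I]})_x\}_{I\in B}$ is a basis of $\mathbb{R}^p$ at every $x\in\Omega$. Smooth approximating fields: if $X_i=\sum_j b_{ij}(x)\partial_{x_j}$, then for $y\in\Omega$, $S_i^{y}=\sum_j p_{ij}(x)\partial_{x_j}$, where $p_{ij}$ is the Taylor polynomial of $b_{ij}$ centered at $y$ of order $r-p_i$. These are smooth on $\mathbb{R}^p$ and $(S^y_{[I]})_y=(X_{[I]})_y$ for $|I|\le r$. The map $\Theta$: $\exp(Z)(y)$ is the time-1 value of the solution of $\phi'=Z_\phi$, $\phi(0)=y$. For fixed $y$,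 $u=(u_I)_{I\in B}\mapsto\exp(\sum_{I\in B}u_IS^y_{[I]})(y)$ is a smooth diffeomorphism from a neighborhood of $0\in\mathbb{R}^p$ onto a neighborhood of $y$, and $u=\Theta_y(x)$ denotes its inverse. $\|u\|=\sum_{J\in B}|u_J|^{1/|J|}$. $C^\alpha$ means Hölder continuous of exponent $\alpha$. "Bounded away from zero" means $|c(y)|\ge c_0>0$. *)

theory Defs
  imports "HOL-Analysis.Analysis"
begin

section \<open>Regularity classes and Taylor polynomials\<close>

text \<open>
  Only meaningful at points of open sets on which the function is sufficiently often
  differentiable; elsewhere the library's \<open>frechet_derivative\<close> is unspecified.
\<close>
fun partials :: "'p::finite list \<Rightarrow> (real^'p \<Rightarrow> real) \<Rightarrow> real^'p \<Rightarrow> real" where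
  "partials [] f = f"
| "partials (j # js) f = (\<lambda>x. frechet_derivative (partials js f) (at x) (axis j 1))"

definition C_k_on :: "nat \<Rightarrow> (real^'p::finite) set \<Rightarrow> (real^'p \<Rightarrow> real) \<Rightarrow> bool" where
  "C_k_on k U f \<longleftrightarrow>
     (\<forall>js. length js < k \<longrightarrow> partials js f differentiable_on U) \<and>
     (\<forall>js. length js = k \<longrightarrow> continuous_on U (partials js f))"

definition hoelder_on :: "real \<Rightarrow> 'a::metric_space set \<Rightarrow> ('a \<Rightarrow> real) \<Rightarrow> bool" where
  "hoelder_on \<alpha> U f \<longleftrightarrow> (\<exists>K. \<forall>x\<in>U. \<forall>y\<in>U. \<bar>f x - f y\<bar> \<le> K * dist x y powr \<alpha>)"

definition C_k_hoelder_on ::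
    "nat \<Rightarrow> real \<Rightarrow> (real^'p::finite) set \<Rightarrow> (real^'p \<Rightarrow> real) \<Rightarrow> bool" where
  "C_k_hoelder_on k \<alpha> U f \<longleftrightarrow>
     C_k_on k U f \<and> (\<forall>js. length js = k \<longrightarrow> hoelder_on \<alpha> U (partials js f))"

text \<open>
  The Taylor polynomial of order \<open>k\<close> centered at \<open>y\<close>, summed over ordered sequences of
  coordinate directions: a multiindex \<open>\<beta>\<close> comes from \<open>|\<beta>|!/\<beta>!\<close> sequences, so dividing by
  \<open>|\<beta>|!\<close> gives the usual coefficient \<open>1/\<beta>!\<close>.
\<close>
definition taylor_poly ::
    "nat \<Rightarrow> (real^'p::finite \<Rightarrow> real) \<Rightarrow> real^'p \<Rightarrow> real^'p \<Rightarrow> real" where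
  "taylor_poly k f y x =
     (\<Sum>js | length js \<le> k. partials js f y / fact (length js) * (\<Prod>j\<leftarrow>js. (x - y) $ j))"

section \<open>Weights, multiindices and commutators\<close>

definition wt :: "nat \<Rightarrow> nat" where
  "wt i = (if i = 0 then 2 else 1)"

definition weight :: "nat list \<Rightarrow> nat" where
  "weight I = (\<Sum>i\<leftarrow>I. wt i)"

definition multiindices :: "nat \<Rightarrow> nat \<Rightarrow> nat list set" where
  "multiindices n r = {I. I \<noteq> [] \<and> set I \<subseteq> {0..n} \<and> weight I \<le> r}"

lemma length_le_weight: "length I \<le> weight I"
  by (induction I) (auto simp: weight_def wt_def)

lemma finite_multiindices: "finite (multiindices n r)"
proof (rule finite_subset)
  show "multiindices n r \<subseteq> {I. set I \<subseteq> {0..n} \<and> length I \<le> r}"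
    using length_le_weight by (auto simp: multiindices_def intro: order_trans)
  show "finite {I. set I \<subseteq> {0..n} \<and> length I \<le> r}"
    by (rule finite_lists_length_le) simp
qed

text \<open>
  A vector field \<open>\<Sum>\<^sub>j b\<^sub>j(x) \<partial>\<^sub>j\<close> is identified with its coefficient function \<open>b\<close>; the
  bracket below is the one of \<open>[X, Y] = XY - YX\<close> as differential operators.
\<close>
definition lie_bracket ::
    "(real^'p::finite \<Rightarrow> real^'p) \<Rightarrow> (real^'p \<Rightarrow> real^'p) \<Rightarrow> real^'p \<Rightarrow> real^'p" where
  "lie_bracket X Y x = frechet_derivative Y (at x) (X x) - frechet_derivative X (at x) (Y x)"

text \<open>\<open>X\<^bsub>[I]\<^esub>\<close>; the empty list is not a multiindex and its value is a dummy.\<close>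
fun field_comm ::
    "(nat \<Rightarrow> real^'p::finite \<Rightarrow> real^'p) \<Rightarrow> nat list \<Rightarrow> real^'p \<Rightarrow> real^'p" where
  "field_comm X [] = (\<lambda>x. 0)"
| "field_comm X [i] = X i"
| "field_comm X (i # j # I) = lie_bracket (X i) (field_comm X (j # I))"

text \<open>
  Polynomials in noncommuting indeterminates \<open>\<xi>\<^sub>0, \<xi>\<^sub>1, \<dots>\<close> are represented by their
  coefficient functions on words, with concatenation of words as product.
\<close>
type_synonym ncpoly = "nat list \<Rightarrow> real"

definition nc_var :: "nat \<Rightarrow> ncpoly" where
  "nc_var i J = (if J = [i] then 1 else 0)"

definition nc_mult :: "ncpoly \<Rightarrow> ncpoly \<Rightarrow> ncpoly" where
  "nc_mult f g J = (\<Sum>k\<le>length J. f (take k J) * g (drop k J))"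

definition nc_bracket :: "ncpoly \<Rightarrow> ncpoly \<Rightarrow> ncpoly" where
  "nc_bracket f g J = nc_mult f g J - nc_mult g f J"

text \<open>\<open>nc_comm I J\<close> is the coefficient \<open>A\<^bsub>IJ\<^esub>\<close> in \<open>\<xi>\<^bsub>[I]\<^esub> = \<Sum>\<^sub>J A\<^bsub>IJ\<^esub> \<xi>\<^sub>J\<close>.\<close>
fun nc_comm :: "nat list \<Rightarrow> ncpoly" where
  "nc_comm [] = (\<lambda>J. 0)"
| "nc_comm [i] = nc_var i"
| "nc_comm (i # j # I) = nc_bracket (nc_var i) (nc_comm (j # I))"

definition hoermander_condition ::
    "nat \<Rightarrow> nat \<Rightarrow> (real^'p::finite) set \<Rightarrow> (nat \<Rightarrow> real^'p \<Rightarrow> real^'p) \<Rightarrow> bool" where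
  "hoermander_condition n r \<Omega> X \<longleftrightarrow>
     (\<forall>x\<in>\<Omega>. span ((\<lambda>I. field_comm X I x) ` multiindices n r) = UNIV)"

definition free_up_to_weight ::
    "nat \<Rightarrow> nat \<Rightarrow> (real^'p::finite) set \<Rightarrow> (nat \<Rightarrow> real^'p \<Rightarrow> real^'p) \<Rightarrow> bool" where
  "free_up_to_weight n r \<Omega> X \<longleftrightarrow>
     (\<forall>x\<in>\<Omega>. \<forall>a :: nat list \<Rightarrow> real.
        (\<Sum>I\<in>multiindices n r. a I *\<^sub>R field_comm X I x) = 0 \<longrightarrow>
        (\<forall>J. (\<Sum>I\<in>multiindices n r. a I * nc_comm I J) = 0))"

text \<open>
  The set of \<open>p\<close> multiindices is given by an injective enumeration over the coordinate index
  type, so that \<open>(u\<^sub>I)\<^bsub>I \<in> B\<^esub>\<close> becomes a vector in \<open>real^'p\<close>.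
\<close>
definition commutator_basis ::
    "nat \<Rightarrow> nat \<Rightarrow> (real^'p::finite) set \<Rightarrow> (nat \<Rightarrow> real^'p \<Rightarrow> real^'p) \<Rightarrow> ('p \<Rightarrow> nat list) \<Rightarrow> bool"
  where
  "commutator_basis n r \<Omega> X B \<longleftrightarrow>
     inj B \<and> range B \<subseteq> multiindices n r \<and>
     (\<forall>x\<in>\<Omega>. inj (\<lambda>k. field_comm X (B k) x) \<and>
             independent (range (\<lambda>k. field_comm X (B k) x)) \<and>
             span (range (\<lambda>k. field_comm X (B k) x)) = UNIV)"

section \<open>Regularized canonical coordinates\<close>

text \<open>The smooth approximating fields \<open>S\<^sub>i\<^sup>y\<close>.\<close>
definition approx_field ::
    "nat \<Rightarrow> (nat \<Rightarrow> real^'p::finite \<Rightarrow> real^'p) \<Rightarrow> real^'p \<Rightarrow> nat \<Rightarrow> real^'p \<Rightarrow> real^'p" where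
  "approx_field r X y i = (\<lambda>x. \<chi> j. taylor_poly (r - wt i) (\<lambda>z. X i z $ j) y x)"

text \<open>
  The time-1 value of the integral curve starting at \<open>y\<close>. The description is meaningful if such
  a curve exists on the whole of \<open>[0, 1]\<close> and \<open>Z\<close> is locally Lipschitz.
\<close>
definition exp_field :: "(real^'p::finite \<Rightarrow> real^'p) \<Rightarrow> real^'p \<Rightarrow> real^'p" where
  "exp_field Z y = (THE x. \<exists>\<phi>. \<phi> 0 = y \<and> \<phi> 1 = x \<and>
     (\<forall>t\<in>{0..1}. (\<phi> has_vector_derivative Z (\<phi> t)) (at t within {0..1})))"

text \<open>The map \<open>u \<mapsto> exp(\<Sum>\<^bsub>I \<in> B\<^esub> u\<^sub>I S\<^bsub>[I]\<^esub>\<^sup>y)(y)\<close>, locally inverse to \<open>\<Theta>\<^sub>y\<close>.\<close>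
definition Theta_inv ::
    "nat \<Rightarrow> (nat \<Rightarrow> real^'p::finite \<Rightarrow> real^'p) \<Rightarrow> ('p \<Rightarrow> nat list) \<Rightarrow> real^'p \<Rightarrow> real^'p \<Rightarrow> real^'p"
  where
  "Theta_inv r X B y u =
     exp_field (\<lambda>x. \<Sum>k\<in>UNIV. (u $ k) *\<^sub>R field_comm (approx_field r X y) (B k) x) y"

text \<open>\<open>\<Theta>\<^sub>y\<close>, as the inverse of the previous map on a neighborhood \<open>U\<close> of the origin.\<close>
definition Theta ::
    "nat \<Rightarrow> (nat \<Rightarrow> real^'p::finite \<Rightarrow> real^'p) \<Rightarrow> ('p \<Rightarrow> nat list) \<Rightarrow> (real^'p) set \<Rightarrow>
     real^'p \<Rightarrow> real^'p \<Rightarrow> real^'p" where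
  "Theta r X B U y = inv_into U (Theta_inv r X B y)"

definition hom_norm :: "('p::finite \<Rightarrow> nat list) \<Rightarrow> real^'p \<Rightarrow> real" where
  "hom_norm B u = (\<Sum>k\<in>UNIV. \<bar>u $ k\<bar> powr (1 / real (weight (B k))))"

definition C1_diffeomorphism ::
    "(real^'p::finite) set \<Rightarrow> (real^'p) set \<Rightarrow> (real^'p \<Rightarrow> real^'p) \<Rightarrow> (real^'p \<Rightarrow> real^'p) \<Rightarrow> bool"
  where
  "C1_diffeomorphism U V f g \<longleftrightarrow>
     open U \<and> open V \<and> homeomorphism U V f g \<and>
     (\<forall>j. C_k_on 1 U (\<lambda>u. f u $ j)) \<and> (\<forall>j. C_k_on 1 V (\<lambda>x. g x $ j))"

end

theory Submission
  imports Defs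
begin

text \<open>
  Put \<open>c(y) = det [X\<^bsub>[I]\<^esub>(y)]\<^bsub>I \<in> B\<^esub>\<close>. The coefficients of \<open>X\<^bsub>[I]\<^esub>\<close> are of class \<open>C\<^sup>\<alpha>\<close> locally, because
  \<open>X\<^bsub>[I]\<^esub>\<close> involves derivatives of \<open>X\<^sub>i\<close> of order at most \<open>|I| - p\<^sub>i\<close>, and \<open>c\<close> does not vanish because \<open>B\<close> gives a basis.
  Since a Taylor polynomial has the jet of the function at its center, the brackets \<open>S\<^sup>y\<^bsub>[I]\<^esub>\<close> and
  \<open>X\<^bsub>[I]\<^esub>\<close> agree at \<open>y\<close>, so \<open>c(y)\<close> is the Jacobian of \<open>u \<mapsto> exp(\<Sum> u\<^sub>I S\<^sup>y\<^bsub>[I]\<^esub>)(y)\<close> at \<open>u = 0\<close>. The fields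
  \<open>S\<^sup>y\<^bsub>[I]\<^esub>\<close> are polynomials with coefficients continuous in \<open>y\<close>, hence bounded with their
  derivatives uniformly for \<open>y\<close> in a compact set. For small \<open>u\<close> the integral equations of the flow and
  of its first variation are therefore contractions on the whole interval \<open>[0, 1]\<close>, which gives a
  derivative of the exponential that is Lipschitz in \<open>u\<close> uniformly in \<open>y\<close>: this yields both the
  diffeomorphism on a common ball and the Jacobian estimate, as \<open>|u| \<le> \<parallel>u\<parallel>\<close> for \<open>|u| \<le> 1\<close>.
\<close>

section \<open>Ordinary differential equations on the unit interval\<close>

text \<open>The coefficients of \<open>approx_field\<close> depend on the center y through
  derivatives of the original fields up to the top order, and these are merely Hoelder continuous,
  so (y, u) cannot be treated as one smooth variable. Therefore y is frozen, and uniformity comes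
  from two numbers: an upper bound M for the commutators of the approximating fields and their
  derivatives on unit balls, and a lower bound m for the linear map sending u to the combination of
  the fields at y. Both exist by compactness of the closure of \<open>\<Omega>'\<close>, and every
  later constant is explicit in them. The unit time interval is harmless: the field is linear in u,
  so a small u plays the role of a short time. The derivative of the exponential has Lipschitz
  constant 12 M^2 in u, inversion asks for a radius \<rho> with 12 M^2 \<rho> \<le> m/2, and the
  Jacobian estimate follows because det is Lipschitz on bounded sets of matrices. The function c
  lives on all of \<Omega>, where its Hoelder continuity is only local; a separate compactness
  argument makes it uniform on \<open>\<Omega>'\<close>.\<close>

lemma continuous_on_compose_lipschitz:
  fixes g :: "real \<Rightarrow> 'a::real_normed_vector \<Rightarrow> 'b::real_normed_vector"
  assumes lip: "\<And>t x y. t \<in> S \<Longrightarrow> norm (g t x - g t y) \<le> L * norm (x - y)"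
    and cont: "\<And>x. continuous_on S (\<lambda>t. g t x)"
    and f: "continuous_on S f"
  shows "continuous_on S (\<lambda>t. g t (f t))"
proof -
  have "((\<lambda>s. g s (f s)) \<longlongrightarrow> g t (f t)) (at t within S)" if t: "t \<in> S" for t
  proof -
    have "((\<lambda>s. f s - f t) \<longlongrightarrow> 0) (at t within S)"
      using f t unfolding continuous_on_def by (simp add: LIM_zero)
    then have "((\<lambda>s. L * norm (f s - f t)) \<longlongrightarrow> 0) (at t within S)"
      by (auto intro: tendsto_eq_intros tendsto_norm_zero)
    then have "((\<lambda>s. g s (f s) - g s (f t)) \<longlongrightarrow> 0) (at t within S)"
      by (rule Lim_null_comparison[rotated])
        (use lip in \<open>auto simp: eventually_at_filter\<close>)
    moreover have "((\<lambda>s. g s (f t)) \<longlongrightarrow> g t (f t)) (at t within S)"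
      using cont t by (auto simp: continuous_on_def)
    ultimately have "((\<lambda>s. (g s (f s) - g s (f t)) + g s (f t)) \<longlongrightarrow> 0 + g t (f t)) (at t within S)"
      by (rule tendsto_add)
    then show ?thesis by simp
  qed
  then show ?thesis by (simp add: continuous_on_def)
qed

text \<open>With Lipschitz constant 1/2 on an interval of length 1 the integral operator halves sup
  distances, so one application of the Banach fixed point theorem covers the whole interval and no
  gluing of short solutions occurs.\<close>

lemma picard_unit_interval:
  fixes g :: "real \<Rightarrow> 'a::banach \<Rightarrow> 'a"
  assumes lip: "\<And>t x y. t \<in> {0..1} \<Longrightarrow> norm (g t x - g t y) \<le> 1/2 * norm (x - y)"
    and cont: "\<And>x. continuous_on {0..1} (\<lambda>t. g t x)"
  obtains \<phi> where "\<phi> 0 = x0"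
    "\<And>t. t \<in> {0..1} \<Longrightarrow> (\<phi> has_vector_derivative g t (\<phi> t)) (at t within {0..1})"
proof -
  define F where "F x t = x0 + integral {0..t} (\<lambda>s. g s (apply_bcontfun x s))"
    for x :: "real \<Rightarrow>\<^sub>C 'a" and t :: real
  have cg: "continuous_on {0..1} (\<lambda>s. g s (apply_bcontfun x s))" for x :: "real \<Rightarrow>\<^sub>C 'a"
    by (rule continuous_on_compose_lipschitz[OF lip cont]) auto
  have dF: "(F x has_vector_derivative g t (apply_bcontfun x t)) (at t within {0..1})"
    if "t \<in> {0..1}" for x t
    unfolding F_def using integral_has_vector_derivative[OF cg that]
    by (auto intro!: derivative_eq_intros)
  have cF: "continuous_on (cbox 0 1) (F x)" for x
    unfolding cbox_interval using dF by (rule continuous_on_vector_derivative)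
  \<comment> \<open>Bounded continuous functions live on the whole real line; \<open>clamp\<close>
    extends \<open>F x\<close> by its end values, so that \<open>T\<close> acts on a complete space
    while only the values on [0, 1] matter.\<close>
  have "\<exists>h. \<forall>t. apply_bcontfun h t = F x (clamp 0 1 t)" for x
    by (rule continuous_on_cbox_bcontfunE[OF cF[of x]]) auto
  then obtain T where T: "\<And>x t. apply_bcontfun (T x) t = F x (clamp 0 1 t)"
    by metis
  have "dist (T x) (T z) \<le> 1/2 * dist x z" for x z
  proof (rule dist_bound)
    fix t :: real
    define c where "c = (clamp 0 1 t :: real)"
    have c: "c \<in> {0..1}" unfolding c_def using clamp_in_interval[of "0::real" 1 t] by auto
    have "norm ((F x c - F z c) - (F x 0 - F z 0)) \<le> norm (c - 0) * (1/2 * dist x z)"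
      if "0 < c"
    proof -
      have 1: "((\<lambda>t. F x t - F z t) has_derivative
          (\<lambda>h. h *\<^sub>R (g t (apply_bcontfun x t) - g t (apply_bcontfun z t)))) (at t within {0..c})"
        if "t \<in> {0..c}" for t
      proof -
        have "((\<lambda>t. F x t - F z t) has_vector_derivative
          (g t (apply_bcontfun x t) - g t (apply_bcontfun z t))) (at t within {0..1})"
          using that c by (intro derivative_intros dF) auto
        then show ?thesis
          using c by (auto simp: has_vector_derivative_def elim: has_derivative_subset)
      qed
      have "onorm (\<lambda>h. h *\<^sub>R (g t (apply_bcontfun x t) - g t (apply_bcontfun z t))) \<le> 1/2 * dist x z"
        if "t \<in> {0..c}" for t
      proof (rule onorm_le)
        fix h :: real
        have "norm (g t (apply_bcontfun x t) - g t (apply_bcontfun z t)) \<le> 1/2 * dist x z"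
          using lip[of t "apply_bcontfun x t" "apply_bcontfun z t"] that c dist_bounded[of x t z]
          by (simp add: dist_norm)
        from mult_left_mono[OF this, of "norm h"]
        show "norm (h *\<^sub>R (g t (apply_bcontfun x t) - g t (apply_bcontfun z t)))
            \<le> 1/2 * dist x z * norm h"
          by (simp add: mult.commute)
      qed
      from differentiable_bound[OF convex_real_interval(5) 1 this, of c 0] c
      show ?thesis by (simp add: algebra_simps)
    qed
    moreover have "F x 0 = F z 0" by (simp add: F_def)
    moreover have "\<bar>c\<bar> * (1/2 * dist x z) \<le> 1/2 * dist x z"
      using c by (simp add: mult_left_le_one_le)
    ultimately show "dist (apply_bcontfun (T x) t) (apply_bcontfun (T z) t) \<le> 1/2 * dist x z"
      using c unfolding T c_def[symmetric] dist_norm[of "F x c"]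
      by (cases "c = 0") auto
  qed
  then obtain x where x: "T x = x"
    using banach_fix_type[of "1/2" T] by auto
  have xt: "apply_bcontfun x t = F x t" if "t \<in> {0..1}" for t
    using T[of x t] that by (simp add: x clamp_cancel_cbox)
  show thesis
  proof (rule that)
    show "apply_bcontfun x 0 = x0" using xt[of 0] by (simp add: F_def)
    show "(apply_bcontfun x has_vector_derivative g t (apply_bcontfun x t)) (at t within {0..1})"
      if "t \<in> {0..1}" for t
      using dF[OF that, of x] by (rule has_vector_derivative_transform[OF that xt, rotated])
  qed
qed

text \<open>
  The factor \<open>1/2\<close> on an interval of length \<open>1\<close> can be absorbed at the maximum of \<open>norm (e t)\<close>, so no
  exponential bound is needed.
\<close>

lemma integral_inequality_unit_interval:
  fixes e :: "real \<Rightarrow> 'a::real_normed_vector"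
  assumes der: "\<And>t. t \<in> {0..1} \<Longrightarrow> (e has_vector_derivative e' t) (at t within {0..1})"
    and e0: "e 0 = 0"
    and bd: "\<And>t. t \<in> {0..1} \<Longrightarrow> norm (e' t) \<le> 1/2 * norm (e t) + b"
    and t: "t \<in> {0..1}"
  shows "norm (e t) \<le> 2 * b"
proof -
  have "continuous_on {0..1} (\<lambda>t. norm (e t))"
    using continuous_on_vector_derivative[OF der] by (intro continuous_on_norm)
  from continuous_attains_sup[OF _ _ this] obtain s
    where s: "s \<in> {0..1}" "\<And>t. t \<in> {0..1} \<Longrightarrow> norm (e t) \<le> norm (e s)"
    by auto
  have "norm (e s - e 0) \<le> (1/2 * norm (e s) + b) * norm (s - 0)"
  proof (rule differentiable_bound[of "{0..1}" e "\<lambda>t h. h *\<^sub>R e' t"])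
    show "onorm (\<lambda>h. h *\<^sub>R e' t) \<le> 1/2 * norm (e s) + b" if "t \<in> {0..1}" for t
    proof (rule onorm_le)
      fix h :: real
      have "norm (e' t) \<le> 1/2 * norm (e s) + b"
        using bd[OF that] s(2)[OF that] by simp
      from mult_left_mono[OF this, of "norm h"]
      show "norm (h *\<^sub>R e' t) \<le> (1/2 * norm (e s) + b) * norm h"
        by (simp add: mult.commute)
    qed
  qed (use s der in \<open>auto simp: has_vector_derivative_def\<close>)
  also have "\<dots> \<le> (1/2 * norm (e s) + b) * 1"
  proof (rule mult_left_mono)
    have "0 \<le> norm (e' s)" by simp
    also have "\<dots> \<le> 1/2 * norm (e s) + b" using bd s by blast
    finally show "0 \<le> 1/2 * norm (e s) + b" .
  qed (use s in auto)
  finally have "norm (e s) \<le> 2 * b" using e0 by simp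
  then show ?thesis using s(2)[OF t] by simp
qed

text \<open>Both curves stay in a common ball by compactness of [0, 1], where one Lipschitz constant
  L is available. There the derivative of the squared distance is at most 2 L times the squared
  distance, so after multiplication by exp(-2 L t) it cannot grow from its initial value 0. No
  smallness of L is assumed: the competitors in \<open>exp_field\<close> may leave the unit ball
  about y.\<close>

lemma ode_unique_unit_interval:
  fixes Z :: "'a::euclidean_space \<Rightarrow> 'a"
  assumes Z: "\<And>R. \<exists>L. \<forall>x\<in>cball 0 R. \<forall>z\<in>cball 0 R. norm (Z x - Z z) \<le> L * norm (x - z)"
    and f: "\<And>t. t \<in> {0..1} \<Longrightarrow> (f has_vector_derivative Z (f t)) (at t within {0..1})"
    and g: "\<And>t. t \<in> {0..1} \<Longrightarrow> (g has_vector_derivative Z (g t)) (at t within {0..1})"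
    and 0: "f 0 = g 0"
  shows "f 1 = g 1"
proof -
  have cf: "continuous_on {0..1} f" "continuous_on {0..1} g"
    using continuous_on_vector_derivative[OF f] continuous_on_vector_derivative[OF g] by auto
  then have "bounded (f ` {0..1} \<union> g ` {0..1})"
    by (auto intro!: compact_imp_bounded compact_continuous_image)
  then obtain R where R: "\<And>x. x \<in> f ` {0..1} \<union> g ` {0..1} \<Longrightarrow> norm x \<le> R"
    unfolding bounded_iff by blast
  obtain L where L: "\<And>x z. x \<in> cball 0 R \<Longrightarrow> z \<in> cball 0 R \<Longrightarrow> norm (Z x - Z z) \<le> L * norm (x - z)"
    using Z by blast
  define d where "d t = (f t - g t) \<bullet> (f t - g t) * exp (- 2 * L * t)" for t
  have "d 1 \<le> d 0"
  proof (rule DERIV_nonpos_imp_decreasing_open[where f = d and a = 0 and b = 1])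
    show "continuous_on {0..1} d"
      unfolding d_def by (intro continuous_intros cf)
    fix t :: real assume t: "0 < t" "t < 1"
    have at: "at t within {0..1} = at t"
      using t by (rule at_within_Icc_at)
    have der: "(f has_vector_derivative Z (f t)) (at t)" "(g has_vector_derivative Z (g t)) (at t)"
      using f[of t] g[of t] t at by auto
    let ?v = "f t - g t" and ?w = "Z (f t) - Z (g t)"
    have 1: "((\<lambda>t. (f t - g t) \<bullet> (f t - g t)) has_real_derivative 2 * (?v \<bullet> ?w)) (at t)"
    proof -
      have v: "((\<lambda>t. f t - g t) has_derivative (\<lambda>h. h *\<^sub>R ?w)) (at t)"
        using has_vector_derivative_diff[OF der] by (simp add: has_vector_derivative_def)
      have "(\<lambda>h. ?v \<bullet> (h *\<^sub>R ?w) + (h *\<^sub>R ?w) \<bullet> ?v) = (*) (2 * (?v \<bullet> ?w))"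
        by (simp add: fun_eq_iff inner_commute)
      with has_derivative_inner[OF v v] show ?thesis
        by (simp only: has_field_derivative_def)
    qed
    have 2: "((\<lambda>t. exp (- 2 * L * t)) has_real_derivative (- 2 * L) * exp (- 2 * L * t)) (at t)"
      by (auto intro!: derivative_eq_intros)
    have 3: "(d has_real_derivative 2 * (?v \<bullet> ?w) * exp (- 2 * L * t)
        + (- 2 * L) * exp (- 2 * L * t) * (?v \<bullet> ?v)) (at t)"
      unfolding d_def by (rule DERIV_mult[OF 1 2])
    have "?v \<bullet> ?w \<le> norm ?v * norm ?w" by (rule norm_cauchy_schwarz)
    also have "\<dots> \<le> norm ?v * (L * norm ?v)"
      using t by (intro mult_left_mono L) (auto intro!: R)
    also have "\<dots> = L * (?v \<bullet> ?v)" by (simp add: dot_square_norm power2_eq_square)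
    finally have "(2 * (?v \<bullet> ?w) - 2 * L * (?v \<bullet> ?v)) * exp (- 2 * L * t) \<le> 0"
      by (simp add: mult_nonpos_nonneg)
    then have "2 * (?v \<bullet> ?w) * exp (- 2 * L * t)
        + (- 2 * L) * exp (- 2 * L * t) * (?v \<bullet> ?v) \<le> 0"
      by (simp only: left_diff_distrib mult_minus_left) (simp add: mult.assoc mult.left_commute)
    with 3 show "\<exists>y. (d has_real_derivative y) (at t) \<and> y \<le> 0"
      by blast
  qed simp
  then have "(f 1 - g 1) \<bullet> (f 1 - g 1) \<le> 0"
    using 0 by (simp add: d_def mult_le_0_iff)
  then show ?thesis by (simp add: dot_square_norm)
qed

section \<open>Flows of controlled fields and their first variation\<close>

lemma norm_add3_le:
  fixes d :: "'a::real_normed_vector"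
  shows "\<lbrakk>d = a + b + c; norm a \<le> a'; norm b \<le> b'; norm c \<le> c'\<rbrakk> \<Longrightarrow> norm d \<le> a' + b' + c'"
  by (auto intro!: norm_triangle_le add_mono)

lemma norm_add4_le:
  fixes e :: "'a::real_normed_vector"
  shows "\<lbrakk>e = a + b + c + d; norm a \<le> a'; norm b \<le> b'; norm c \<le> c'; norm d \<le> d'\<rbrakk>
    \<Longrightarrow> norm e \<le> a' + b' + c' + d'"
  by (auto intro!: norm_triangle_le add_mono)

text \<open>
  \<open>A x u\<close> stands for \<open>\<Sum> u\<^sub>I S\<^bsub>[I]\<^esub>(x)\<close> and \<open>A' x h u\<close> for its derivative in \<open>x\<close> along \<open>h\<close>. All constants
  below depend on \<open>M\<close> only, which makes the conclusions uniform in the center \<open>y\<close>.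
\<close>

locale controlled_field =
  fixes y :: "'a::euclidean_space" and A :: "'a \<Rightarrow> 'b::euclidean_space \<Rightarrow> 'a"
    and A' :: "'a \<Rightarrow> 'a \<Rightarrow> 'b \<Rightarrow> 'a" and M :: real
  assumes M_pos: "0 < M"
    and linear_A: "linear (A x)"
    and linear_A': "linear (A' x h)"
    and derivative_A: "((\<lambda>x. A x u) has_derivative (\<lambda>h. A' x h u)) (at x)"
    and bound_A: "x \<in> cball y 1 \<Longrightarrow> norm (A x u) \<le> M * norm u"
    and bound_A': "x \<in> cball y 1 \<Longrightarrow> norm (A' x h u) \<le> M * norm h * norm u"
    and lipschitz_A': "\<lbrakk>x \<in> cball y 1; z \<in> cball y 1\<rbrakk> \<Longrightarrow>
      norm (A' x h u - A' z h u) \<le> M * norm (x - z) * norm h * norm u"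
begin

lemma linear_A'_space: "linear (\<lambda>h. A' x h u)"
  using derivative_A by (rule has_derivative_linear)

lemma lipschitz_A:
  assumes "x \<in> cball y 1" "z \<in> cball y 1"
  shows "norm (A x u - A z u) \<le> M * norm (x - z) * norm u"
proof -
  have "norm (A x u - A z u) \<le> (M * norm u) * norm (x - z)"
  proof (rule differentiable_bound[OF convex_cball[of y 1]])
    show "((\<lambda>x. A x u) has_derivative (\<lambda>h. A' x h u)) (at x within cball y 1)" for x
      using derivative_A by (rule has_derivative_at_withinI)
    show "onorm (\<lambda>h. A' x h u) \<le> M * norm u" if "x \<in> cball y 1" for x
      by (rule onorm_le) (use bound_A'[OF that] in \<open>simp add: mult.assoc mult.left_commute mult.commute\<close>)
  qed (use assms in auto)
  then show ?thesis by (simp add: mult.assoc mult.commute mult.left_commute)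
qed

text \<open>Linearization at x along the segment to z: by convexity the segment stays in the ball,
  and there \<open>A'\<close> differs from its value at x by at most M times the distance. The
  Lipschitz bound for \<open>A'\<close> thus takes the place of a bound on second
  derivatives.\<close>

lemma remainder_A:
  assumes x: "x \<in> cball y 1" and z: "z \<in> cball y 1"
  shows "norm (A z u - A x u - A' x (z - x) u) \<le> M * (norm (z - x))\<^sup>2 * norm u"
proof -
  define S where "S = closed_segment x z"
  have S: "S \<subseteq> cball y 1"
    unfolding S_def using x z by (simp add: closed_segment_subset)
  have "norm (A z u - A x u - A' x (z - x) u) \<le> norm (z - x) * (M * norm (z - x) * norm u)"
  proof (rule differentiable_bound_linearization[where S = S and f' = "\<lambda>x h. A' x h u"])
    show "x + t *\<^sub>R (z - x) \<in> S" if "t \<in> {0..1}" for t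
      using that unfolding S_def closed_segment_def
      by (intro CollectI exI[of _ t]) (auto simp: algebra_simps)
    show "((\<lambda>x. A x u) has_derivative (\<lambda>h. A' x h u)) (at x within S)" for x
      using derivative_A by (rule has_derivative_at_withinI)
    show "onorm ((\<lambda>h. A' w h u) - (\<lambda>h. A' x h u)) \<le> M * norm (z - x) * norm u" if "w \<in> S" for w
    proof (rule onorm_le)
      fix h
      have "norm (A' w h u - A' x h u) \<le> M * norm (w - x) * norm h * norm u"
        using lipschitz_A' x S that by blast
      also have "\<dots> \<le> M * norm (z - x) * norm h * norm u"
        using segment_bound1[OF that[unfolded S_def]] M_pos by (intro mult_mono) auto
      finally show "norm (((\<lambda>h. A' w h u) - (\<lambda>h. A' x h u)) h) \<le> M * norm (z - x) * norm u * norm h"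
        by (simp add: mult.assoc mult.commute mult.left_commute)
    qed
  qed (simp add: S_def)
  then show ?thesis by (simp add: power2_eq_square mult.assoc mult.commute mult.left_commute)
qed

text \<open>The condition M |u| \<le> 1/2 serves twice: it makes the right-hand sides contract with
  factor 1/2, and it turns the a priori bound 2 M |u| on the displacement into 1, so that the flow
  never leaves the ball on which the bounds hold.\<close>

definition rad :: real where "rad = 1 / (2 * M)"

lemma rad_pos: "0 < rad" and M_rad: "M * rad = 1/2"
  using M_pos by (simp_all add: rad_def)

lemma M_norm_le: "u \<in> cball 0 rad \<Longrightarrow> M * norm u \<le> 1/2"
  using M_rad M_pos by (metis mem_cball_0 mult_left_mono order_less_imp_le)

text \<open>The bounds on A hold only in the unit ball about y, whereas Picard iteration wants a
  global Lipschitz constant. Precomposing with the nearest point projection, which is 1-Lipschitz,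
  provides one; the resulting curve moves by at most 2 M |u| \<le> 1, so the projection was inactive
  along it and the curve solves the original equation.\<close>

lemma flow_exists:
  assumes u: "u \<in> cball 0 rad"
  shows "\<exists>\<phi>. \<phi> 0 = y \<and> (\<forall>t\<in>{0..1}. (\<phi> has_vector_derivative A (\<phi> t) u) (at t within {0..1})
      \<and> norm (\<phi> t - y) \<le> 2 * (M * norm u))"
proof -
  define P where "P = closest_point (cball y 1)"
  have P: "P x \<in> cball y 1" for x
    unfolding P_def by (rule closest_point_in_set) auto
  have P_id: "P x = x" if "x \<in> cball y 1" for x
    unfolding P_def using that by (rule closest_point_self)
  have "norm (A (P x) u - A (P z) u) \<le> 1/2 * norm (x - z)" for x z
  proof -
    have "norm (A (P x) u - A (P z) u) \<le> M * norm (P x - P z) * norm u"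
      using P P by (rule lipschitz_A)
    also have "\<dots> = M * norm u * norm (P x - P z)" by simp
    also have "\<dots> \<le> 1/2 * norm (x - z)"
      using closest_point_lipschitz[of "cball y 1" x z] M_norm_le[OF u]
      by (intro mult_mono) (auto simp: P_def dist_norm)
    finally show ?thesis .
  qed
  from picard_unit_interval[of "\<lambda>t x. A (P x) u" y, OF this continuous_on_const]
  obtain \<phi> where \<phi>: "\<phi> 0 = y"
    "\<And>t. t \<in> {0..1} \<Longrightarrow> (\<phi> has_vector_derivative A (P (\<phi> t)) u) (at t within {0..1})"
    by metis
  have close: "norm (\<phi> t - y) \<le> 2 * (M * norm u)" if "t \<in> {0..1}" for t
  proof (rule integral_inequality_unit_interval[where e = "\<lambda>t. \<phi> t - y", OF _ _ _ that])
    show "((\<lambda>t. \<phi> t - y) has_vector_derivative A (P (\<phi> t)) u) (at t within {0..1})"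
      if "t \<in> {0..1}" for t
      using \<phi>(2)[OF that] by (auto intro!: derivative_eq_intros)
    show "norm (A (P (\<phi> t)) u) \<le> 1/2 * norm (\<phi> t - y) + M * norm u" for t
      using bound_A[OF P[of "\<phi> t"], of u] norm_ge_zero[of "\<phi> t - y"] by linarith
  qed (simp add: \<phi>)
  have "\<phi> t \<in> cball y 1" if "t \<in> {0..1}" for t
    using close[OF that] M_norm_le[OF u] by (simp add: dist_norm norm_minus_commute)
  with \<phi> close P_id show ?thesis by (intro exI[of _ \<phi>]) auto
qed

definition flow :: "'b \<Rightarrow> real \<Rightarrow> 'a" where
  "flow u = (SOME \<phi>. \<phi> 0 = y \<and>
    (\<forall>t\<in>{0..1}. (\<phi> has_vector_derivative A (\<phi> t) u) (at t within {0..1})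
      \<and> norm (\<phi> t - y) \<le> 2 * (M * norm u)))"

lemma
  assumes "u \<in> cball 0 rad"
  shows flow_0: "flow u 0 = y"
    and flow_derivative: "t \<in> {0..1} \<Longrightarrow>
      (flow u has_vector_derivative A (flow u t) u) (at t within {0..1})"
    and flow_close: "t \<in> {0..1} \<Longrightarrow> norm (flow u t - y) \<le> 2 * (M * norm u)"
  using someI_ex[OF flow_exists[OF assms]] unfolding flow_def[symmetric] by auto

lemma flow_in_cball: "\<lbrakk>u \<in> cball 0 rad; t \<in> {0..1}\<rbrakk> \<Longrightarrow> flow u t \<in> cball y 1"
  using flow_close[of u t] M_norm_le[of u] by (simp add: dist_norm norm_minus_commute)

text \<open>By linearity in the parameter, the two velocities differ by a change of position,
  absorbed by the factor 1/2, and by the field with parameter u - v, of size at most M |u -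
  v|.\<close>

lemma flow_lipschitz:
  assumes u: "u \<in> cball 0 rad" and v: "v \<in> cball 0 rad" and t: "t \<in> {0..1}"
  shows "norm (flow u t - flow v t) \<le> 2 * (M * norm (u - v))"
proof (rule integral_inequality_unit_interval[where e = "\<lambda>t. flow u t - flow v t", OF _ _ _ t])
  show "((\<lambda>t. flow u t - flow v t) has_vector_derivative A (flow u t) u - A (flow v t) v)
      (at t within {0..1})" if "t \<in> {0..1}" for t
    using that u v by (intro derivative_intros flow_derivative)
  show "norm (A (flow u t) u - A (flow v t) v) \<le> 1/2 * norm (flow u t - flow v t) + M * norm (u - v)"
    if t: "t \<in> {0..1}" for t
  proof -
    have "A (flow u t) u - A (flow v t) v = (A (flow u t) u - A (flow v t) u) + A (flow v t) (u - v)"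
      by (simp add: linear_diff[OF linear_A])
    also have "norm \<dots> \<le> norm (A (flow u t) u - A (flow v t) u) + norm (A (flow v t) (u - v))"
      by (rule norm_triangle_ineq)
    also have "\<dots> \<le> M * norm (flow u t - flow v t) * norm u + M * norm (u - v)"
      using flow_in_cball u v t by (intro add_mono lipschitz_A bound_A) auto
    also have "M * norm (flow u t - flow v t) * norm u = M * norm u * norm (flow u t - flow v t)"
      by simp
    also have "\<dots> \<le> 1/2 * norm (flow u t - flow v t)"
      using M_norm_le[OF u] by (rule mult_right_mono) simp
    finally show ?thesis by simp
  qed
qed (use flow_0 u v in simp)

lemma norm_A'_flow_le:
  assumes u: "u \<in> cball 0 rad" and t: "t \<in> {0..1}"
  shows "norm (A' (flow u t) z u) \<le> 1/2 * norm z"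
proof -
  have "norm (A' (flow u t) z u) \<le> M * norm z * norm u"
    using flow_in_cball[OF u t] by (rule bound_A')
  also have "\<dots> = M * norm u * norm z" by simp
  also have "\<dots> \<le> 1/2 * norm z" using M_norm_le[OF u] by (rule mult_right_mono) simp
  finally show ?thesis .
qed

text \<open>The equation is affine in the unknown, with linear part of norm at most M |u| \<le> 1/2
  at every time. Its coefficients vary with t through the flow, which is why
  \<open>picard_unit_interval\<close> admits a time-dependent right-hand side.\<close>

lemma variation_exists:
  assumes u: "u \<in> cball 0 rad"
  shows "\<exists>\<psi>. \<psi> 0 = 0 \<and> (\<forall>t\<in>{0..1}.
     (\<psi> has_vector_derivative A' (flow u t) (\<psi> t) u + A (flow u t) h) (at t within {0..1}))"
proof -
  have cont_flow: "continuous_on {0..1} (flow u)"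
    using flow_derivative[OF u] by (rule continuous_on_vector_derivative)
  have "continuous_on {0..1} (\<lambda>t. A (flow u t) h)"
    by (rule continuous_on_compose2[of UNIV "\<lambda>x. A x h", OF has_derivative_continuous_on cont_flow])
      (use derivative_A in auto)
  moreover have "continuous_on {0..1} (\<lambda>t. A' (flow u t) z u)" for z
  proof (rule continuous_on_compose2[OF _ cont_flow, of "cball y 1" "\<lambda>x. A' x z u"])
    show "continuous_on (cball y 1) (\<lambda>x. A' x z u)"
    proof (rule lipschitz_on_continuous_on)
      show "(M * norm z * norm u)-lipschitz_on (cball y 1) (\<lambda>x. A' x z u)"
        using lipschitz_A' M_pos
        by (intro lipschitz_onI) (auto simp: dist_norm mult.assoc mult.left_commute mult.commute)
    qed
  qed (use flow_in_cball[OF u] in auto)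
  ultimately have cont: "continuous_on {0..1} (\<lambda>t. A' (flow u t) z u + A (flow u t) h)" for z
    by (intro continuous_intros)
  have lip: "norm ((A' (flow u t) z u + A (flow u t) h) - (A' (flow u t) w u + A (flow u t) h))
      \<le> 1/2 * norm (z - w)" if t: "t \<in> {0..1}" for t z w
    using norm_A'_flow_le[OF u t, of "z - w"] by (simp add: linear_diff[OF linear_A'_space])
  show ?thesis
    by (rule picard_unit_interval[of "\<lambda>t z. A' (flow u t) z u + A (flow u t) h" 0, OF lip cont]) auto
qed

definition variation :: "'b \<Rightarrow> 'b \<Rightarrow> real \<Rightarrow> 'a" where
  "variation u h = (SOME \<psi>. \<psi> 0 = 0 \<and> (\<forall>t\<in>{0..1}.
     (\<psi> has_vector_derivative A' (flow u t) (\<psi> t) u + A (flow u t) h) (at t within {0..1})))"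

lemma
  assumes "u \<in> cball 0 rad"
  shows variation_0: "variation u h 0 = 0"
    and variation_derivative: "t \<in> {0..1} \<Longrightarrow> (variation u h has_vector_derivative
      A' (flow u t) (variation u h t) u + A (flow u t) h) (at t within {0..1})"
  using someI_ex[OF variation_exists[OF assms, of h]] unfolding variation_def[symmetric] by auto

lemma variation_bound:
  assumes u: "u \<in> cball 0 rad" and t: "t \<in> {0..1}"
  shows "norm (variation u h t) \<le> 2 * (M * norm h)"
proof (rule integral_inequality_unit_interval[OF variation_derivative[OF u] variation_0[OF u] _ t])
  fix t :: real assume t: "t \<in> {0..1}"
  have "norm (A (flow u t) h) \<le> M * norm h"
    using flow_in_cball[OF u t] by (rule bound_A)
  with norm_A'_flow_le[OF u t, of "variation u h t"]
  show "norm (A' (flow u t) (variation u h t) u + A (flow u t) h)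
      \<le> 1/2 * norm (variation u h t) + M * norm h"
    by (intro norm_triangle_le add_mono)
qed

text \<open>\<open>variation\<close> is chosen separately for each h, so additivity is a uniqueness
  statement: the defect solves the homogeneous equation with initial value 0, and the integral
  inequality with b = 0 makes it vanish.\<close>

lemma variation_add:
  assumes u: "u \<in> cball 0 rad" and t: "t \<in> {0..1}"
  shows "variation u (h + k) t = variation u h t + variation u k t"
proof -
  let ?e = "\<lambda>t. variation u (h + k) t - variation u h t - variation u k t"
  have "norm (?e t) \<le> 2 * 0"
  proof (rule integral_inequality_unit_interval[where e = ?e, OF _ _ _ t])
    fix t :: real assume t: "t \<in> {0..1}"
    show "(?e has_vector_derivative
        (A' (flow u t) (variation u (h + k) t) u + A (flow u t) (h + k))
        - (A' (flow u t) (variation u h t) u + A (flow u t) h)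
        - (A' (flow u t) (variation u k t) u + A (flow u t) k)) (at t within {0..1})" (is "(_ has_vector_derivative ?d) _")
      by (intro derivative_intros variation_derivative u t)
    have "?d = A' (flow u t) (?e t) u"
      by (simp add: linear_diff[OF linear_A'_space] linear_add[OF linear_A])
    then show "norm ?d \<le> 1/2 * norm (?e t) + 0"
      using norm_A'_flow_le[OF u t, of "?e t"] by simp
  qed (simp add: variation_0[OF u])
  then show ?thesis by (simp add: algebra_simps)
qed

lemma variation_scaleR:
  assumes u: "u \<in> cball 0 rad" and t: "t \<in> {0..1}"
  shows "variation u (c *\<^sub>R h) t = c *\<^sub>R variation u h t"
proof -
  let ?e = "\<lambda>t. variation u (c *\<^sub>R h) t - c *\<^sub>R variation u h t"
  have "norm (?e t) \<le> 2 * 0"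
  proof (rule integral_inequality_unit_interval[where e = ?e, OF _ _ _ t])
    fix t :: real assume t: "t \<in> {0..1}"
    show "(?e has_vector_derivative
        (A' (flow u t) (variation u (c *\<^sub>R h) t) u + A (flow u t) (c *\<^sub>R h))
        - c *\<^sub>R (A' (flow u t) (variation u h t) u + A (flow u t) h)) (at t within {0..1})" (is "(_ has_vector_derivative ?d) _")
      by (intro has_vector_derivative_diff variation_derivative u t
        bounded_linear.has_vector_derivative[OF bounded_linear_scaleR_right])
    have "?d = A' (flow u t) (?e t) u"
      by (simp add: linear_diff[OF linear_A'_space] linear_scale[OF linear_A'_space]
        linear_scale[OF linear_A] scaleR_add_right)
    then show "norm ?d \<le> 1/2 * norm (?e t) + 0"
      using norm_A'_flow_le[OF u t, of "?e t"] by simp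
  qed (simp add: variation_0[OF u])
  then show ?thesis by simp
qed

text \<open>The defect solves the variation equation with two sources, the Taylor remainder of A at
  the moved point and the change of the field with parameter h = v - u under that move. As the flow
  moves by at most 2 M |h|, each source is at most 2 M^2 |h|^2; their sum 4 M^2 |h|^2 is doubled by
  the integral inequality.\<close>

lemma flow_remainder:
  assumes u: "u \<in> cball 0 rad" and v: "v \<in> cball 0 rad" and t: "t \<in> {0..1}"
  shows "norm (flow v t - flow u t - variation u (v - u) t) \<le> 8 * M\<^sup>2 * (norm (v - u))\<^sup>2"
proof -
  let ?h = "v - u"
  let ?e = "\<lambda>t. flow v t - flow u t - variation u ?h t"
  have "norm (?e t) \<le> 2 * (4 * M\<^sup>2 * (norm ?h)\<^sup>2)"
  proof (rule integral_inequality_unit_interval[where e = ?e, OF _ _ _ t])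
    fix t :: real assume t: "t \<in> {0..1}"
    let ?U = "flow u t" and ?V = "flow v t" and ?P = "variation u ?h t"
    show "(?e has_vector_derivative A ?V v - A ?U u - (A' ?U ?P u + A ?U ?h)) (at t within {0..1})"
      (is "(_ has_vector_derivative ?d) _")
      by (intro derivative_intros variation_derivative flow_derivative u v t)
    have UV: "?U \<in> cball y 1" "?V \<in> cball y 1" using flow_in_cball u v t by auto
    have *: "norm (?V - ?U) \<le> 2 * M * norm ?h" using flow_lipschitz[OF v u t] by simp
    have "?d = (A ?V u - A ?U u - A' ?U (?V - ?U) u) + A' ?U (?e t) u + (A ?V ?h - A ?U ?h)"
      by (simp add: linear_diff[OF linear_A'_space] linear_diff[OF linear_A])
    moreover have "norm (A ?V u - A ?U u - A' ?U (?V - ?U) u) \<le> 2 * M\<^sup>2 * (norm ?h)\<^sup>2"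
    proof -
      have "norm (A ?V u - A ?U u - A' ?U (?V - ?U) u) \<le> M * (norm (?V - ?U))\<^sup>2 * norm u"
        by (rule remainder_A[OF UV])
      also have "\<dots> = (norm (?V - ?U))\<^sup>2 * (M * norm u)" by simp
      also have "\<dots> \<le> (2 * M * norm ?h)\<^sup>2 * (1/2)"
        using * M_norm_le[OF u] M_pos by (intro mult_mono power_mono) auto
      also have "\<dots> = 2 * M\<^sup>2 * (norm ?h)\<^sup>2" by (simp add: power2_eq_square)
      finally show ?thesis .
    qed
    moreover have "norm (A' ?U (?e t) u) \<le> 1/2 * norm (?e t)"
      by (rule norm_A'_flow_le[OF u t])
    moreover have "norm (A ?V ?h - A ?U ?h) \<le> 2 * M\<^sup>2 * (norm ?h)\<^sup>2"
    proof -
      have "norm (A ?V ?h - A ?U ?h) \<le> M * norm (?V - ?U) * norm ?h"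
        by (rule lipschitz_A[OF UV(2,1)])
      also have "\<dots> \<le> M * (2 * M * norm ?h) * norm ?h"
        using * M_pos by (intro mult_mono) auto
      also have "\<dots> = 2 * M\<^sup>2 * (norm ?h)\<^sup>2" by (simp add: power2_eq_square)
      finally show ?thesis .
    qed
    ultimately have "norm ?d \<le> 2 * M\<^sup>2 * (norm ?h)\<^sup>2 + 1/2 * norm (?e t) + 2 * M\<^sup>2 * (norm ?h)\<^sup>2"
      by (rule norm_add3_le)
    then show "norm ?d \<le> 1/2 * norm (?e t) + 4 * M\<^sup>2 * (norm ?h)\<^sup>2"
      by simp
  qed (simp add: variation_0[OF u] flow_0[OF u] flow_0[OF v])
  then show ?thesis by simp
qed

text \<open>Besides the absorbed term, the difference of the two variation equations has three
  sources: the change of \<open>A'\<close> with the base point, its change with the parameter, and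
  the change of the inhomogeneity. Each is at most 2 M^2 |u - v| |h|, and doubling the sum gives 12
  M^2, the constant that later governs both the radius of invertibility and the size of the Jacobian
  error.\<close>

lemma variation_lipschitz:
  assumes u: "u \<in> cball 0 rad" and v: "v \<in> cball 0 rad" and t: "t \<in> {0..1}"
  shows "norm (variation u h t - variation v h t) \<le> 12 * M\<^sup>2 * norm (u - v) * norm h"
proof -
  let ?e = "\<lambda>t. variation u h t - variation v h t"
  have "norm (?e t) \<le> 2 * (6 * M\<^sup>2 * norm (u - v) * norm h)"
  proof (rule integral_inequality_unit_interval[where e = ?e, OF _ _ _ t])
    fix t :: real assume t: "t \<in> {0..1}"
    let ?U = "flow u t" and ?V = "flow v t" and ?P = "variation u h t" and ?Q = "variation v h t"
    show "(?e has_vector_derivative (A' ?U ?P u + A ?U h) - (A' ?V ?Q v + A ?V h)) (at t within {0..1})"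
      (is "(_ has_vector_derivative ?d) _")
      by (intro derivative_intros variation_derivative u v t)
    have UV: "?U \<in> cball y 1" "?V \<in> cball y 1" using flow_in_cball u v t by auto
    have *: "norm (?U - ?V) \<le> 2 * M * norm (u - v)" using flow_lipschitz[OF u v t] by simp
    have Q: "norm ?Q \<le> 2 * M * norm h" using variation_bound[OF v t, of h] by simp
    have "?d = A' ?U (?e t) u + (A' ?U ?Q u - A' ?V ?Q u) + A' ?V ?Q (u - v) + (A ?U h - A ?V h)"
      by (simp add: linear_diff[OF linear_A'_space] linear_diff[OF linear_A'])
    moreover have "norm (A' ?U (?e t) u) \<le> 1/2 * norm (?e t)"
      by (rule norm_A'_flow_le[OF u t])
    moreover have "norm (A' ?U ?Q u - A' ?V ?Q u) \<le> 2 * M\<^sup>2 * norm (u - v) * norm h"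
    proof -
      have "norm (A' ?U ?Q u - A' ?V ?Q u) \<le> M * norm (?U - ?V) * norm ?Q * norm u"
        by (rule lipschitz_A'[OF UV])
      also have "\<dots> = (M * norm u) * (norm (?U - ?V) * norm ?Q)" by simp
      also have "\<dots> \<le> (1/2) * ((2 * M * norm (u - v)) * (2 * M * norm h))"
        using * Q M_norm_le[OF u] M_pos by (intro mult_mono) auto
      also have "\<dots> = 2 * M\<^sup>2 * norm (u - v) * norm h" by (simp add: power2_eq_square)
      finally show ?thesis .
    qed
    moreover have "norm (A' ?V ?Q (u - v)) \<le> 2 * M\<^sup>2 * norm (u - v) * norm h"
    proof -
      have "norm (A' ?V ?Q (u - v)) \<le> M * norm ?Q * norm (u - v)"
        by (rule bound_A'[OF UV(2)])
      also have "\<dots> \<le> M * (2 * M * norm h) * norm (u - v)"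
        using Q M_pos by (intro mult_mono) auto
      also have "\<dots> = 2 * M\<^sup>2 * norm (u - v) * norm h" by (simp add: power2_eq_square)
      finally show ?thesis .
    qed
    moreover have "norm (A ?U h - A ?V h) \<le> 2 * M\<^sup>2 * norm (u - v) * norm h"
    proof -
      have "norm (A ?U h - A ?V h) \<le> M * norm (?U - ?V) * norm h"
        by (rule lipschitz_A[OF UV])
      also have "\<dots> \<le> M * (2 * M * norm (u - v)) * norm h"
        using * M_pos by (intro mult_mono) auto
      also have "\<dots> = 2 * M\<^sup>2 * norm (u - v) * norm h" by (simp add: power2_eq_square)
      finally show ?thesis .
    qed
    ultimately have "norm ?d \<le> 1/2 * norm (?e t) + 2 * M\<^sup>2 * norm (u - v) * norm h
        + 2 * M\<^sup>2 * norm (u - v) * norm h + 2 * M\<^sup>2 * norm (u - v) * norm h"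
      by (rule norm_add4_le)
    then show "norm ?d \<le> 1/2 * norm (?e t) + 6 * M\<^sup>2 * norm (u - v) * norm h"
      by (simp add: mult.assoc mult.commute mult.left_commute)
  qed (simp add: variation_0[OF u] variation_0[OF v])
  then show ?thesis by simp
qed

text \<open>For u = 0 the flow rests at y and the term with \<open>A'\<close> vanishes by linearity
  in the parameter, so the equation has constant velocity. At t = 1 this identifies the derivative
  of the exponential at the origin with \<open>A y\<close>.\<close>

lemma variation_at_0: "t \<in> {0..1} \<Longrightarrow> variation 0 h t = t *\<^sub>R A y h"
proof -
  assume t: "t \<in> {0..1}"
  have 0: "(0::'b) \<in> cball 0 rad" using rad_pos by simp
  let ?e = "\<lambda>t. variation 0 h t - t *\<^sub>R A y h"
  have "norm (?e t) \<le> 2 * 0"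
  proof (rule integral_inequality_unit_interval[where e = ?e, OF _ _ _ t])
    fix t :: real assume t: "t \<in> {0..1}"
    have "flow 0 t = y" using flow_close[OF 0 t] by simp
    moreover have "A' (flow 0 t) (variation 0 h t) 0 = 0" by (rule linear_0[OF linear_A'])
    ultimately have "(variation 0 h has_vector_derivative A y h) (at t within {0..1})"
      using variation_derivative[OF 0 t, of h] by simp
    then show "(?e has_vector_derivative 0) (at t within {0..1})"
      by (auto intro!: derivative_eq_intros)
  qed (simp_all add: variation_0[OF 0])
  then show ?thesis by simp
qed

lemma endpoint_has_derivative:
  assumes u: "u \<in> ball 0 rad"
  shows "((\<lambda>u. flow u 1) has_derivative (\<lambda>h. variation u h 1)) (at u)"
proof -
  have u': "u \<in> cball 0 rad" using u by auto
  have "bounded_linear (\<lambda>h. variation u h 1)"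
    unfolding linear_conv_bounded_linear[symmetric]
    by (intro linearI variation_add[OF u'] variation_scaleR[OF u']) auto
  moreover have "((\<lambda>v. (flow v 1 - (flow u 1 + variation u (v - u) 1)) /\<^sub>R norm (v - u)) \<longlongrightarrow> 0) (at u)"
  proof (rule Lim_null_comparison)
    have "eventually (\<lambda>v. v \<in> ball 0 rad) (at u)"
      using u by (intro eventually_at_in_open') auto
    then show "\<forall>\<^sub>F v in at u. norm ((flow v 1 - (flow u 1 + variation u (v - u) 1)) /\<^sub>R norm (v - u))
        \<le> 8 * M\<^sup>2 * norm (v - u)"
    proof eventually_elim
      case (elim v)
      then show ?case
        using flow_remainder[OF u', of v 1]
        by (cases "v = u") (auto simp: divide_simps power2_eq_square diff_diff_eq)
    qed
    have "((\<lambda>v. 8 * M\<^sup>2 * norm (v - u)) \<longlongrightarrow> 8 * M\<^sup>2 * norm (u - u)) (at u)"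
      by (intro tendsto_intros)
    then show "((\<lambda>v. 8 * M\<^sup>2 * norm (v - u)) \<longlongrightarrow> 0) (at u)" by simp
  qed
  ultimately show ?thesis
    by (simp add: has_derivative_at2 inverse_eq_divide)
qed

end

section \<open>Quantitative inversion and the exponential map\<close>

lemma C_k_on_1I:
  fixes f :: "real^'p::finite \<Rightarrow> real"
  assumes "open U" and der: "\<And>x. x \<in> U \<Longrightarrow> (f has_derivative f' x) (at x)"
    and cont: "\<And>j. continuous_on U (\<lambda>x. f' x (axis j 1))"
  shows "C_k_on 1 U f"
proof -
  have fd: "frechet_derivative f (at x) = f' x" if "x \<in> U" for x
    using frechet_derivative_at[OF der[OF that]] by simp
  have "continuous_on U (partials [j] f)" for j
    using cont[of j] by (rule continuous_on_eq) (simp add: fd)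
  moreover have "partials [] f differentiable_on U"
    using der by (auto simp: differentiable_on_def differentiable_def
        intro: has_derivative_at_withinI)
  ultimately show ?thesis
    unfolding C_k_on_def by (auto simp: length_Suc_conv)
qed

text \<open>Since C \<rho> \<le> m/2, every \<open>D u\<close> on the ball is within m/2 of
  \<open>D 0\<close>, so it keeps half of its lower bound. The radius is dictated by m and C alone,
  which is what allows the same ball for all centers; the inverse function theorem by itself would
  give no control of the radius.\<close>

lemma C1_diffeomorphism_ball:
  fixes E :: "real^'p::finite \<Rightarrow> real^'p"
  assumes der: "\<And>u. u \<in> ball 0 \<rho> \<Longrightarrow> (E has_derivative D u) (at u)"
    and lip: "\<And>u v h. \<lbrakk>u \<in> ball 0 \<rho>; v \<in> ball 0 \<rho>\<rbrakk> \<Longrightarrow>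
      norm (D u h - D v h) \<le> C * norm (u - v) * norm h"
    and lower: "\<And>h. m * norm h \<le> norm (D 0 h)"
    and params: "0 < m" "0 \<le> C" "0 < \<rho>" "C * \<rho> \<le> m / 2"
  shows "C1_diffeomorphism (ball 0 \<rho>) (E ` ball 0 \<rho>) E (inv_into (ball 0 \<rho>) E)"
proof -
  let ?U = "ball (0::real^'p) \<rho>" and ?V = "E ` ball 0 \<rho>"
  define G where "G = inv_into ?U E"
  have 0: "(0::real^'p) \<in> ?U" using params by simp
  have lin: "linear (D u)" if "u \<in> ?U" for u
    using der[OF that] by (rule has_derivative_linear)
  have near: "norm (D u h - D 0 h) \<le> m/2 * norm h" if "u \<in> ?U" for u h
  proof -
    have "norm (D u h - D 0 h) \<le> C * norm (u - 0) * norm h"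
      by (rule lip[OF that 0])
    also have "\<dots> \<le> C * \<rho> * norm h"
      using that params by (intro mult_right_mono mult_left_mono) auto
    also have "\<dots> \<le> m/2 * norm h" using params by (intro mult_right_mono) auto
    finally show ?thesis .
  qed
  \<comment> \<open>The mean value inequality is applied to \<open>E\<close> minus its linear part
    at 0, whose derivative is at most m/2; the linear part expands by at least m. This yields
    injectivity and the Lipschitz bound of the inverse at once.\<close>
  have expand: "m/2 * norm (u - v) \<le> norm (E u - E v)" if "u \<in> ?U" "v \<in> ?U" for u v
  proof -
    have "norm ((E u - D 0 u) - (E v - D 0 v)) \<le> m/2 * norm (u - v)"
    proof (rule differentiable_bound[OF convex_ball[of 0 \<rho>]])
      show "((\<lambda>u. E u - D 0 u) has_derivative (\<lambda>h. D u h - D 0 h)) (at u within ?U)"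
        if "u \<in> ?U" for u
        using that lin[OF 0] has_derivative_at_withinI[OF der[OF that]]
        by (intro has_derivative_diff linear_imp_has_derivative) auto
      show "onorm (\<lambda>h. D u h - D 0 h) \<le> m/2" if "u \<in> ?U" for u
        using near[OF that] by (intro onorm_le) auto
    qed (use that in auto)
    moreover have "(E u - D 0 u) - (E v - D 0 v) = (E u - E v) - D 0 (u - v)"
      by (simp add: linear_diff[OF lin[OF 0]])
    moreover have "norm (D 0 (u - v)) - norm (E u - E v) \<le> norm ((E u - E v) - D 0 (u - v))"
      by (metis norm_minus_commute norm_triangle_ineq2)
    ultimately show ?thesis using lower[of "u - v"] by simp
  qed
  have Dlower: "m/2 * norm h \<le> norm (D u h)" if "u \<in> ?U" for u h
  proof -
    have "norm (D 0 h) - norm (D u h) \<le> norm (D u h - D 0 h)"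
      by (metis norm_minus_commute norm_triangle_ineq2)
    then show ?thesis using near[OF that, of h] lower[of h] by simp
  qed
  have inj: "inj_on E ?U"
  proof (rule inj_onI)
    fix u v assume "u \<in> ?U" "v \<in> ?U" "E u = E v"
    then have "m/2 * norm (u - v) \<le> 0" using expand[of u v] by simp
    then show "u = v" using params by (simp add: mult_le_0_iff)
  qed
  have contE: "continuous_on ?U E"
    by (rule has_derivative_continuous_on[OF has_derivative_at_withinI[OF der]])
  \<comment> \<open>Invariance of domain gives the open image directly from continuity and
    injectivity, without solving \<open>E u = x\<close> by iteration.\<close>
  have openV: "open ?V"
    by (rule invariance_of_domain[OF contE open_ball inj])
  have GE: "G (E u) = u" if "u \<in> ?U" for u
    unfolding G_def using inj that by (rule inv_into_f_f)
  have EG: "E (G x) = x" if "x \<in> ?V" for x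
    unfolding G_def using that by (rule f_inv_into_f)
  have GU: "G x \<in> ?U" if "x \<in> ?V" for x
    unfolding G_def using that by (rule inv_into_into)
  have G_lip: "m/2 * norm (G x - G z) \<le> norm (x - z)" if "x \<in> ?V" "z \<in> ?V" for x z
    using expand[of "G x" "G z"] that GU EG by simp
  have contG: "continuous_on ?V G"
  proof (rule lipschitz_on_continuous_on)
    show "(2/m)-lipschitz_on ?V G"
    proof (rule lipschitz_onI)
      show "dist (G x) (G z) \<le> 2/m * dist x z" if "x \<in> ?V" "z \<in> ?V" for x z
        using G_lip[OF that] params by (simp add: dist_norm pos_le_divide_eq mult.commute)
    qed (use params in simp)
  qed
  define H where "H x = inv (D (G x))" for x
  have DH: "D (G x) (H x h) = h" if "x \<in> ?V" for x h
  proof -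
    have "inj (D (G x))"
      unfolding linear_injective_0[OF lin[OF GU[OF that]]]
    proof (intro allI impI)
      fix h assume "D (G x) h = 0"
      then show "h = 0" using Dlower[OF GU[OF that], of h] params by (simp add: mult_le_0_iff)
    qed
    then have "surj (D (G x))"
      by (rule linear_inj_imp_surj[OF lin[OF GU[OF that]]])
    then show ?thesis unfolding H_def by (rule surj_f_inv_f)
  qed
  have derG: "(G has_derivative H x) (at x)" if "x \<in> ?V" for x
    by (rule has_derivative_inverse_strong_x[OF open_ball GU[OF that] contE GE der[OF GU[OF that]] _ EG[OF that]])
      (use DH[OF that] in \<open>simp_all add: fun_eq_iff\<close>)
  have contH: "continuous_on ?V (\<lambda>x. H x h)" for h
  proof (rule lipschitz_on_continuous_on)
    have H_le: "m/2 * norm (H x h) \<le> norm h" if "x \<in> ?V" for x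
      using Dlower[OF GU[OF that], of "H x h"] DH[OF that] by simp
    show "((2/m) * (C * (2/m) * (2/m) * norm h))-lipschitz_on ?V (\<lambda>x. H x h)"
    proof (rule lipschitz_onI)
      fix x z assume x: "x \<in> ?V" and z: "z \<in> ?V"
      \<comment> \<open>The resolvent identity: both \<open>D (G x) (H x h)\<close> and
        \<open>D (G z) (H z h)\<close> equal h. Continuity of the inverse derivatives thus reduces
        to the Lipschitz bound on \<open>D\<close> and the lower bound m/2.\<close>
      have "D (G x) (H x h - H z h) = D (G z) (H z h) - D (G x) (H z h)"
        by (simp add: linear_diff[OF lin[OF GU[OF x]]] DH[OF x] DH[OF z])
      then have "m/2 * norm (H x h - H z h) \<le> norm (D (G z) (H z h) - D (G x) (H z h))"
        using Dlower[OF GU[OF x], of "H x h - H z h"] by simp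
      also have "\<dots> \<le> C * norm (G z - G x) * norm (H z h)"
        by (rule lip[OF GU[OF z] GU[OF x]])
      also have "\<dots> \<le> C * ((2/m) * norm (z - x)) * ((2/m) * norm h)"
      proof (intro mult_mono)
        show "norm (G z - G x) \<le> (2/m) * norm (z - x)"
          using G_lip[OF z x] params by (simp add: pos_le_divide_eq mult.commute)
        show "norm (H z h) \<le> (2/m) * norm h"
          using H_le[OF z] params by (simp add: pos_le_divide_eq mult.commute)
      qed (use params in simp_all)
      finally have "(2/m) * (m/2 * norm (H x h - H z h))
          \<le> (2/m) * (C * ((2/m) * norm (z - x)) * ((2/m) * norm h))"
        by (rule mult_left_mono) (use params in simp)
      moreover have "(2/m) * (m/2 * norm (H x h - H z h)) = dist (H x h) (H z h)"
        using params by (simp add: dist_norm)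
      moreover have "(2/m) * (C * ((2/m) * norm (z - x)) * ((2/m) * norm h))
          = (2/m) * (C * (2/m) * (2/m) * norm h) * dist x z"
        by (simp add: dist_norm norm_minus_commute)
      ultimately show "dist (H x h) (H z h) \<le> (2/m) * (C * (2/m) * (2/m) * norm h) * dist x z"
        by (simp only:)
    qed (use params in auto)
  qed
  have contD: "continuous_on ?U (\<lambda>u. D u h)" for h
  proof (rule lipschitz_on_continuous_on)
    show "(C * norm h)-lipschitz_on ?U (\<lambda>u. D u h)"
      using lip params by (intro lipschitz_onI) (auto simp: dist_norm mult.assoc mult.commute mult.left_commute)
  qed
  have "C_k_on 1 ?U (\<lambda>u. E u $ j)" for j
  proof (rule C_k_on_1I[where f' = "\<lambda>u h. D u h $ j"])
    show "((\<lambda>u. E u $ j) has_derivative (\<lambda>h. D u h $ j)) (at u)" if "u \<in> ?U" for u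
      using der[OF that] by (rule bounded_linear.has_derivative[OF bounded_linear_vec_nth])
    show "continuous_on ?U (\<lambda>u. D u (axis i 1) $ j)" for i
      by (intro continuous_intros contD)
  qed simp
  moreover have "C_k_on 1 ?V (\<lambda>x. G x $ j)" for j
  proof (rule C_k_on_1I[where f' = "\<lambda>x h. H x h $ j"])
    show "((\<lambda>x. G x $ j) has_derivative (\<lambda>h. H x h $ j)) (at x)" if "x \<in> ?V" for x
      using derG[OF that] by (rule bounded_linear.has_derivative[OF bounded_linear_vec_nth])
    show "continuous_on ?V (\<lambda>x. H x (axis i 1) $ j)" for i
      by (intro continuous_intros contH)
  qed (rule openV)
  moreover have "homeomorphism ?U ?V E G"
    by (rule homeomorphismI[OF contE contG]) (use GE EG GU in auto)
  ultimately show ?thesis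
    unfolding C1_diffeomorphism_def G_def[symmetric] using openV by blast
qed

section \<open>Lipschitz dependence of products and determinants on their entries\<close>

lemma prod_diff_le:
  fixes f g :: "'i \<Rightarrow> real"
  assumes b: "1 \<le> b" and f: "\<And>i. i \<in> S \<Longrightarrow> \<bar>f i\<bar> \<le> b" and g: "\<And>i. i \<in> S \<Longrightarrow> \<bar>g i\<bar> \<le> b"
    and d: "\<And>i. i \<in> S \<Longrightarrow> \<bar>f i - g i\<bar> \<le> d"
  shows "\<bar>prod f S - prod g S\<bar> \<le> real (card S) * b ^ card S * d"
proof (cases "S = {} \<or> infinite S")
  case False
  then have fin: "finite S" and "S \<noteq> {}" by auto
  then have d0: "0 \<le> d" using d abs_ge_zero order_trans by blast
  \<comment> \<open>Division by b brings all factors into [-1, 1], where a difference of products is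
    at most the sum of the differences of the factors; undoing the scaling costs the power of
    b.\<close>
  have "\<bar>(\<Prod>i\<in>S. f i / b) - (\<Prod>i\<in>S. g i / b)\<bar> \<le> (\<Sum>i\<in>S. \<bar>f i / b - g i / b\<bar>)"
    using norm_prod_diff[of S "\<lambda>i. f i / b" "\<lambda>i. g i / b"] f g b by simp
  also have "\<dots> \<le> (\<Sum>i\<in>S. d)"
  proof (rule sum_mono)
    fix i assume i: "i \<in> S"
    have "\<bar>f i / b - g i / b\<bar> = \<bar>f i - g i\<bar> / b" using b by (simp flip: diff_divide_distrib)
    also have "\<dots> \<le> d / 1" using b d[OF i] d0 by (intro frac_le) auto
    finally show "\<bar>f i / b - g i / b\<bar> \<le> d" by simp
  qed
  finally have "\<bar>prod f S - prod g S\<bar> / b ^ card S \<le> real (card S) * d"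
    using b by (simp add: prod_dividef flip: diff_divide_distrib)
  then show ?thesis using b by (simp add: divide_simps mult.assoc mult.commute mult.left_commute)
qed auto

text \<open>In the Leibniz formula each permutation contributes one difference of products. The
  constant depends on b and the dimension only, while d is quantified after it, so that d may be
  taken proportional to |u|. The maximum of 1 and b serves the requirement of
  \<open>prod_diff_le\<close> that the bound be at least 1.\<close>

lemma det_lipschitz:
  "\<exists>L\<ge>0. \<forall>(P :: real^'n^'n) Q d. (\<forall>i j. \<bar>P $ i $ j\<bar> \<le> b \<and> \<bar>Q $ i $ j\<bar> \<le> b \<and> \<bar>P $ i $ j - Q $ i $ j\<bar> \<le> d)
    \<longrightarrow> \<bar>det P - det Q\<bar> \<le> L * d"
proof -
  define N where "N = real (card {p. p permutes (UNIV::'n set)})"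
  let ?c = "max 1 b"
  define L where "L = N * (real CARD('n) * ?c ^ CARD('n))"
  have L0: "0 \<le> L" unfolding L_def N_def by simp
  have bound: "\<bar>det P - det Q\<bar> \<le> L * d"
    if PQ: "\<forall>i j. \<bar>P $ i $ j\<bar> \<le> b \<and> \<bar>Q $ i $ j\<bar> \<le> b \<and> \<bar>P $ i $ j - Q $ i $ j\<bar> \<le> d"
    for P Q :: "real^'n^'n" and d
  proof -
    have "det P - det Q = (\<Sum>p | p permutes (UNIV::'n set). of_int (sign p) *
        ((\<Prod>i\<in>UNIV. P $ i $ p i) - (\<Prod>i\<in>UNIV. Q $ i $ p i)))"
      unfolding det_def by (simp add: sum_subtractf right_diff_distrib)
    also have "\<bar>\<dots>\<bar> \<le> (\<Sum>p | p permutes (UNIV::'n set). real CARD('n) * ?c ^ CARD('n) * d)"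
    proof (rule order_trans[OF sum_abs sum_mono])
      fix p :: "'n \<Rightarrow> 'n"
      have "\<bar>(\<Prod>i\<in>UNIV. P $ i $ p i) - (\<Prod>i\<in>UNIV. Q $ i $ p i)\<bar> \<le> real CARD('n) * ?c ^ CARD('n) * d"
        by (rule prod_diff_le) (use PQ in \<open>auto simp: le_max_iff_disj\<close>)
      then show "\<bar>of_int (sign p) * ((\<Prod>i\<in>UNIV. P $ i $ p i) - (\<Prod>i\<in>UNIV. Q $ i $ p i))\<bar>
          \<le> real CARD('n) * ?c ^ CARD('n) * d"
        by (simp add: abs_mult sign_def)
    qed
    also have "\<dots> = L * d" by (simp add: L_def N_def)
    finally show ?thesis .
  qed
  show ?thesis
    by (rule exI[of _ L]) (use L0 bound in blast)
qed

text \<open>The definite description ranges over all curves on [0, 1], wherever they run, so it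
  needs a Lipschitz constant on every ball and not only near y. Polynomial fields have one, of
  arbitrary size.\<close>

lemma exp_field_eqI:
  fixes Z :: "real^'p::finite \<Rightarrow> real^'p"
  assumes Z: "\<And>R. \<exists>L. \<forall>x\<in>cball 0 R. \<forall>z\<in>cball 0 R. norm (Z x - Z z) \<le> L * norm (x - z)"
    and \<phi>: "\<phi> 0 = y" "\<And>t. t \<in> {0..1} \<Longrightarrow> (\<phi> has_vector_derivative Z (\<phi> t)) (at t within {0..1})"
  shows "exp_field Z y = \<phi> 1"
  unfolding exp_field_def
proof (rule the_equality)
  show "\<exists>\<phi>'. \<phi>' 0 = y \<and> \<phi>' 1 = \<phi> 1 \<and>
      (\<forall>t\<in>{0..1}. (\<phi>' has_vector_derivative Z (\<phi>' t)) (at t within {0..1}))"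
    using \<phi> by blast
next
  fix x assume "\<exists>\<phi>. \<phi> 0 = y \<and> \<phi> 1 = x \<and>
      (\<forall>t\<in>{0..1}. (\<phi> has_vector_derivative Z (\<phi> t)) (at t within {0..1}))"
  then obtain \<phi>' where \<phi>': "\<phi>' 0 = y" "\<phi>' 1 = x"
    "\<And>t. t \<in> {0..1} \<Longrightarrow> (\<phi>' has_vector_derivative Z (\<phi>' t)) (at t within {0..1})"
    by blast
  have "\<phi>' 1 = \<phi> 1"
    by (rule ode_unique_unit_interval[OF Z \<phi>'(3) \<phi>(2)]) (simp_all add: \<phi> \<phi>')
  then show "x = \<phi> 1" by (simp add: \<phi>'(2))
qed

text \<open>The bounds on \<rho> have separate origins: 1/(2 M) is the radius \<open>rad\<close> on
  which the flow exists up to time 1, and 24 M^2 \<rho> \<le> m is the inversion condition C \<rho>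
  \<le> m/2 for C = 12 M^2.\<close>

lemma exp_field_controlled:
  fixes A :: "real^'p::finite \<Rightarrow> real^'p \<Rightarrow> real^'p"
  assumes cf: "controlled_field y A A' M"
    and Z: "\<And>u R. \<exists>L. \<forall>x\<in>cball 0 R. \<forall>z\<in>cball 0 R. norm (A x u - A z u) \<le> L * norm (x - z)"
    and lower: "\<And>h. m * norm h \<le> norm (A y h)" and m: "0 < m"
    and \<rho>: "0 < \<rho>" "\<rho> \<le> 1 / (2 * M)" "24 * M\<^sup>2 * \<rho> \<le> m"
  defines "E \<equiv> \<lambda>u. exp_field (\<lambda>x. A x u) y"
  shows "E 0 = y" (is ?P)
    and "C1_diffeomorphism (ball 0 \<rho>) (E ` ball 0 \<rho>) E (inv_into (ball 0 \<rho>) E)" (is ?Q)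
    and "u \<in> ball 0 \<rho> \<Longrightarrow> \<bar>jacobian E (at u) $ i $ k - A y (axis k 1) $ i\<bar> \<le> 12 * M\<^sup>2 * norm u"
      (is "_ \<Longrightarrow> ?R")
proof -
  interpret controlled_field y A A' M by (rule cf)
  have rad: "\<rho> \<le> rad" using \<rho> by (simp add: rad_def)
  have E: "E u = flow u 1" if "u \<in> ball 0 rad" for u
  proof -
    have u: "u \<in> cball 0 rad" using that by auto
    show ?thesis unfolding E_def by (rule exp_field_eqI[OF Z flow_0[OF u] flow_derivative[OF u]])
  qed
  have 0: "(0::real^'p) \<in> ball 0 rad" using rad_pos by simp
  have zero: "(0::real^'p) \<in> cball 0 rad" using rad_pos by simp
  show ?P using E[OF 0] flow_close[OF zero, of 1] by simp
  have der: "(E has_derivative (\<lambda>h. variation u h 1)) (at u)" if "u \<in> ball 0 \<rho>" for u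
  proof -
    have u: "u \<in> ball 0 rad" using that rad by auto
    show ?thesis
      by (rule has_derivative_transform_within_open[OF endpoint_has_derivative[OF u] open_ball u])
        (simp add: E)
  qed
  have lip: "norm (variation u h 1 - variation v h 1) \<le> 12 * M\<^sup>2 * norm (u - v) * norm h"
    if "u \<in> ball 0 \<rho>" "v \<in> ball 0 \<rho>" for u v h
    using that rad by (intro variation_lipschitz) auto
  have var0: "variation 0 h 1 = A y h" for h
    using variation_at_0[of 1 h] by simp
  show ?Q
  proof (rule C1_diffeomorphism_ball[where m = m, OF der lip])
    show "m * norm h \<le> norm (variation 0 h 1)" for h
      unfolding var0 by (rule lower)
  qed (use \<rho> m in simp_all)
  show ?R if u: "u \<in> ball 0 \<rho>"
  proof -
    have "jacobian E (at u) $ i $ k = variation u (axis k 1) 1 $ i"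
      using frechet_derivative_at[OF der[OF u], symmetric] by (simp add: jacobian_def matrix_def)
    then have "jacobian E (at u) $ i $ k - A y (axis k 1) $ i
        = (variation u (axis k 1) 1 - variation 0 (axis k 1) 1) $ i"
      by (simp add: var0)
    also have "\<bar>\<dots>\<bar> \<le> norm (variation u (axis k 1) 1 - variation 0 (axis k 1) 1)"
      by (rule component_le_norm_cart)
    also have "\<dots> \<le> 12 * M\<^sup>2 * norm (u - 0) * norm (axis k 1 :: real^'p)"
      using u \<rho> by (intro lip) auto
    finally show ?thesis by simp
  qed
qed

section \<open>Partial derivatives and Hoelder continuity\<close>

definition pd :: "'p::finite \<Rightarrow> (real^'p \<Rightarrow> real) \<Rightarrow> real^'p \<Rightarrow> real" where
  "pd l f x = frechet_derivative f (at x) (axis l 1)"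

lemma partials_Cons_pd: "partials (j # js) f = pd j (partials js f)"
  by (simp add: pd_def fun_eq_iff)

text \<open>The last entry of the list is the innermost derivative. Peeling it off replaces f by
  \<open>pd l f\<close>, which suits inductions over the order of regularity with the function
  generalized; the defining equation peels the outermost derivative instead.\<close>

lemma partials_snoc: "partials (js @ [l]) f = partials js (pd l f)"
  by (induction js) (simp_all add: pd_def[abs_def])

lemma pd_eqI: "(f has_derivative f') (at x) \<Longrightarrow> pd l f x = f' (axis l 1)"
  unfolding pd_def by (metis frechet_derivative_at)

lemma vec_eq_sum_axis: "(h :: real^'p::finite) = (\<Sum>l\<in>UNIV. (h $ l) *\<^sub>R axis l 1)"
  by (simp add: vec_eq_iff axis_def if_distrib cong: if_cong)

lemma has_derivative_pd:
  assumes "f differentiable (at x)"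
  shows "(f has_derivative (\<lambda>h. \<Sum>l\<in>UNIV. h $ l * pd l f x)) (at x)"
proof -
  from assms obtain f' where f': "(f has_derivative f') (at x)"
    by (auto simp: differentiable_def)
  have "f' h = (\<Sum>l\<in>UNIV. h $ l * f' (axis l 1))" for h
  proof -
    have "f' h = f' (\<Sum>l\<in>UNIV. (h $ l) *\<^sub>R axis l 1)" by (simp flip: vec_eq_sum_axis)
    then show ?thesis
      using has_derivative_linear[OF f'] by (simp add: linear_sum linear_scale)
  qed
  then have "f' = (\<lambda>h. \<Sum>l\<in>UNIV. h $ l * pd l f x)"
    unfolding pd_eqI[OF f'] by (rule ext)
  with f' show ?thesis by (simp only:)
qed

lemma differentiable_on_open_at:
  "\<lbrakk>open U; f differentiable_on U; x \<in> U\<rbrakk> \<Longrightarrow> f differentiable (at x)"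
  by (simp add: differentiable_on_eq_differentiable_at)

lemma has_derivative_cong_open:
  assumes "open U" "x \<in> U" "\<And>x. x \<in> U \<Longrightarrow> f x = g x"
  shows "(f has_derivative f') (at x) \<longleftrightarrow> (g has_derivative f') (at x)"
  using assms by (metis has_derivative_transform_within_open)

lemma pd_cong:
  assumes "open U" "x \<in> U" "\<And>x. x \<in> U \<Longrightarrow> f x = g x"
  shows "pd l f x = pd l g x"
  unfolding pd_def frechet_derivative_def using has_derivative_cong_open[OF assms] by simp

lemma pd_along_axis:
  assumes "f differentiable (at (p + s *\<^sub>R axis i 1))"
  shows "((\<lambda>s. f (p + s *\<^sub>R axis i 1)) has_real_derivative pd i f (p + s *\<^sub>R axis i 1)) (at s)"
proof -
  have "((\<lambda>s. p + s *\<^sub>R axis i (1::real)) has_derivative (\<lambda>h. h *\<^sub>R axis i 1)) (at s)"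
    by (auto intro!: derivative_eq_intros)
  from has_derivative_compose[OF this has_derivative_pd[OF assms]]
  have "((\<lambda>s. f (p + s *\<^sub>R axis i 1)) has_derivative
     (\<lambda>h. \<Sum>l\<in>UNIV. (h *\<^sub>R axis i (1::real)) $ l * pd l f (p + s *\<^sub>R axis i 1))) (at s)" .
  moreover have "(\<Sum>l\<in>UNIV. (h *\<^sub>R axis i (1::real)) $ l * pd l f (p + s *\<^sub>R axis i 1))
      = pd i f (p + s *\<^sub>R axis i 1) * h" for h
  proof -
    have "(\<Sum>l\<in>UNIV. (h *\<^sub>R axis i (1::real)) $ l * pd l f (p + s *\<^sub>R axis i 1))
      = (\<Sum>l\<in>UNIV. if l = i then h * pd l f (p + s *\<^sub>R axis i 1) else 0)"
      by (rule sum.cong) (auto simp: axis_def)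
    then show ?thesis by simp
  qed
  ultimately show ?thesis by (simp add: has_field_derivative_def mult_commute_abs)
qed

text \<open>Two applications of the mean value theorem: first in direction i to the difference of f
  across the step in direction j, then in direction j to \<open>pd i f\<close>. The intermediate
  point is at distance at most 2 h from x.\<close>

lemma second_difference_mvt:
  assumes ball: "ball x e \<subseteq> U" and U: "open U"
    and f: "f differentiable_on U" "pd i f differentiable_on U"
    and h: "0 < h" "2 * h < e"
  shows "\<exists>z. dist x z \<le> 2 * h \<and> f (x + h *\<^sub>R axis i 1 + h *\<^sub>R axis j 1) - f (x + h *\<^sub>R axis i 1)
    - f (x + h *\<^sub>R axis j 1) + f x = h * h * pd j (pd i f) z"
proof -
  have dist: "dist x (x + s *\<^sub>R axis i 1 + t *\<^sub>R axis j 1) \<le> 2 * h"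
    if "0 \<le> s" "s \<le> h" "0 \<le> t" "t \<le> h" for s t
  proof -
    have "dist x (x + s *\<^sub>R axis i 1 + t *\<^sub>R axis j 1) = norm (s *\<^sub>R axis i (1::real) + t *\<^sub>R axis j 1)"
    proof -
      have "x - (x + s *\<^sub>R axis i 1 + t *\<^sub>R axis j 1) = - (s *\<^sub>R axis i 1 + t *\<^sub>R axis j 1)" by simp
      then show ?thesis by (simp only: dist_norm norm_minus_cancel)
    qed
    also have "\<dots> \<le> norm (s *\<^sub>R axis i (1::real)) + norm (t *\<^sub>R axis j (1::real))"
      by (rule norm_triangle_ineq)
    also have "\<dots> \<le> 2 * h" using that by simp
    finally show ?thesis .
  qed
  have inU: "x + s *\<^sub>R axis i 1 + t *\<^sub>R axis j 1 \<in> U"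
    if "0 \<le> s" "s \<le> h" "0 \<le> t" "t \<le> h" for s t
    using dist[OF that] h ball by (auto simp: subset_iff)
  define \<phi> where "\<phi> s = f (x + s *\<^sub>R axis i 1 + h *\<^sub>R axis j 1) - f (x + s *\<^sub>R axis i 1)" for s
  define \<phi>' where "\<phi>' s = pd i f (x + s *\<^sub>R axis i 1 + h *\<^sub>R axis j 1) - pd i f (x + s *\<^sub>R axis i 1)" for s
  have "(\<phi> has_real_derivative \<phi>' s) (at s)" if s: "0 \<le> s" "s \<le> h" for s
  proof -
    have "f differentiable (at ((x + h *\<^sub>R axis j 1) + s *\<^sub>R axis i 1))"
      using inU[OF s, of h] h f U by (simp add: differentiable_on_open_at ac_simps)
    from pd_along_axis[OF this]
    have 1: "((\<lambda>s. f (x + s *\<^sub>R axis i 1 + h *\<^sub>R axis j 1)) has_real_derivative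
        pd i f (x + s *\<^sub>R axis i 1 + h *\<^sub>R axis j 1)) (at s)"
      by (simp add: ac_simps)
    have "f differentiable (at (x + s *\<^sub>R axis i 1))"
      using inU[OF s, of 0] h f U by (simp add: differentiable_on_open_at)
    from 1 pd_along_axis[OF this] show ?thesis
      unfolding \<phi>_def \<phi>'_def by (rule DERIV_diff)
  qed
  from MVT2[OF h(1) this] obtain s where s: "0 < s" "s < h" "\<phi> h - \<phi> 0 = (h - 0) * \<phi>' s" by blast
  define \<eta> where "\<eta> t = pd i f (x + s *\<^sub>R axis i 1 + t *\<^sub>R axis j 1)" for t
  define \<eta>' where "\<eta>' t = pd j (pd i f) (x + s *\<^sub>R axis i 1 + t *\<^sub>R axis j 1)" for t
  have "(\<eta> has_real_derivative \<eta>' t) (at t)" if t: "0 \<le> t" "t \<le> h" for t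
    unfolding \<eta>_def \<eta>'_def
    using inU[OF _ _ t, of s] s f U by (intro pd_along_axis) (simp add: differentiable_on_open_at)
  from MVT2[OF h(1) this] obtain t where t: "0 < t" "t < h" "\<eta> h - \<eta> 0 = (h - 0) * \<eta>' t" by blast
  have "\<phi>' s = \<eta> h - \<eta> 0" by (simp add: \<phi>'_def \<eta>_def)
  with s t have "\<phi> h - \<phi> 0 = h * h * \<eta>' t" by simp
  then show ?thesis
    using dist[of s t] s t
    by (intro exI[of _ "x + s *\<^sub>R axis i 1 + t *\<^sub>R axis j 1"]) (simp add: \<phi>_def \<eta>'_def)
qed

text \<open>The second difference is symmetric in i and j, so the two mixed derivatives take a
  common value at two points within 2 h of x; continuity at x does the rest.\<close>

lemma pd_commute:
  assumes U: "open U" and x: "x \<in> U" and f: "f differentiable_on U"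
    and d: "\<And>l. pd l f differentiable_on U"
    and c: "\<And>k l. continuous_on U (pd k (pd l f))"
  shows "pd i (pd j f) x = pd j (pd i f) x"
proof -
  let ?a = "pd i (pd j f) x" and ?b = "pd j (pd i f) x"
  have "\<bar>?a - ?b\<bar> \<le> 0 + \<epsilon>" if "0 < \<epsilon>" for \<epsilon>
  proof -
    have near: "\<exists>\<delta>>0. \<forall>z. dist x z < \<delta> \<longrightarrow> \<bar>pd k (pd l f) z - pd k (pd l f) x\<bar> < \<epsilon>/2" for k l
    proof -
      have "continuous (at x) (pd k (pd l f))"
        using c x U by (simp add: continuous_on_eq_continuous_at)
      then show ?thesis
        using that unfolding continuous_at_eps_delta by (force simp: dist_commute dist_real_def dest: spec[of _ "\<epsilon>/2"])
    qed
    obtain \<delta>1 where \<delta>1: "\<delta>1 > 0" "\<And>z. dist x z < \<delta>1 \<Longrightarrow> \<bar>pd i (pd j f) z - ?a\<bar> < \<epsilon>/2"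
      using near by blast
    obtain \<delta>2 where \<delta>2: "\<delta>2 > 0" "\<And>z. dist x z < \<delta>2 \<Longrightarrow> \<bar>pd j (pd i f) z - ?b\<bar> < \<epsilon>/2"
      using near by blast
    obtain e where e: "e > 0" "ball x e \<subseteq> U" using U x open_contains_ball by blast
    \<comment> \<open>The factor 1/4 leaves 2 h strictly below all three radii, as the intermediate
      points may be as far as 2 h from x.\<close>
    define h where "h = min e (min \<delta>1 \<delta>2) / 4"
    have h: "0 < h" "2 * h < e" "2 * h < \<delta>1" "2 * h < \<delta>2"
      using e \<delta>1 \<delta>2 by (auto simp: h_def)
    obtain z where z: "dist x z \<le> 2 * h" "f (x + h *\<^sub>R axis i 1 + h *\<^sub>R axis j 1) - f (x + h *\<^sub>R axis i 1)
        - f (x + h *\<^sub>R axis j 1) + f x = h * h * pd j (pd i f) z"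
      using second_difference_mvt[OF e(2) U f d h(1,2)] by blast
    obtain w where w: "dist x w \<le> 2 * h" "f (x + h *\<^sub>R axis j 1 + h *\<^sub>R axis i 1) - f (x + h *\<^sub>R axis j 1)
        - f (x + h *\<^sub>R axis i 1) + f x = h * h * pd i (pd j f) w"
      using second_difference_mvt[OF e(2) U f d h(1,2)] by blast
    have "f (x + h *\<^sub>R axis i 1 + h *\<^sub>R axis j 1) = f (x + h *\<^sub>R axis j 1 + h *\<^sub>R axis i 1)"
      by (simp add: add.commute add.left_commute)
    then have "h * h * pd j (pd i f) z = h * h * pd i (pd j f) w"
      using z(2) w(2) by linarith
    then have "pd j (pd i f) z = pd i (pd j f) w" using h by simp
    moreover have "\<bar>pd i (pd j f) w - ?a\<bar> < \<epsilon>/2" using \<delta>1(2) w h by fastforce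
    moreover have "\<bar>pd j (pd i f) z - ?b\<bar> < \<epsilon>/2" using \<delta>2(2) z h by fastforce
    ultimately show ?thesis by linarith
  qed
  then have "\<bar>?a - ?b\<bar> \<le> 0" by (rule field_le_epsilon)
  then show ?thesis by simp
qed

section \<open>Local Hoelder continuity and its closure properties\<close>

definition locally_hoelder :: "real \<Rightarrow> 'a::metric_space set \<Rightarrow> ('a \<Rightarrow> real) \<Rightarrow> bool" where
  "locally_hoelder \<alpha> U f \<longleftrightarrow> (\<forall>x\<in>U. \<exists>e>0. ball x e \<subseteq> U \<and> hoelder_on \<alpha> (ball x e) f)"

lemma hoelder_onE:
  assumes "hoelder_on \<alpha> S f"
  obtains K where "0 \<le> K" "\<And>x y. \<lbrakk>x \<in> S; y \<in> S\<rbrakk> \<Longrightarrow> \<bar>f x - f y\<bar> \<le> K * dist x y powr \<alpha>"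
proof -
  from assms obtain K where K: "\<And>x y. \<lbrakk>x \<in> S; y \<in> S\<rbrakk> \<Longrightarrow> \<bar>f x - f y\<bar> \<le> K * dist x y powr \<alpha>"
    unfolding hoelder_on_def by blast
  show thesis
  proof (rule that[of "max 0 K"])
    fix x y assume "x \<in> S" "y \<in> S"
    then have "\<bar>f x - f y\<bar> \<le> K * dist x y powr \<alpha>" by (rule K)
    also have "\<dots> \<le> max 0 K * dist x y powr \<alpha>" by (rule mult_right_mono) auto
    finally show "\<bar>f x - f y\<bar> \<le> max 0 K * dist x y powr \<alpha>" .
  qed simp
qed

lemma hoelder_on_subset: "\<lbrakk>hoelder_on \<alpha> S f; T \<subseteq> S\<rbrakk> \<Longrightarrow> hoelder_on \<alpha> T f"
  unfolding hoelder_on_def by blast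

text \<open>On a ball every point is comparable with the center, so Hoelder continuity alone bounds
  the function. This supplies the bounds on the factors in the product rule for Hoelder
  functions.\<close>

lemma hoelder_on_bounded_ball:
  assumes "hoelder_on \<alpha> (ball x e) f" "0 < \<alpha>"
  obtains N where "0 \<le> N" "\<And>z. z \<in> ball x e \<Longrightarrow> \<bar>f z\<bar> \<le> N"
proof -
  obtain K where K: "0 \<le> K" "\<And>z y. \<lbrakk>z \<in> ball x e; y \<in> ball x e\<rbrakk> \<Longrightarrow> \<bar>f z - f y\<bar> \<le> K * dist z y powr \<alpha>"
    using assms(1) by (rule hoelder_onE) (rule that)
  have "\<bar>f z\<bar> \<le> \<bar>f x\<bar> + K * e powr \<alpha>" if z: "z \<in> ball x e" for z
  proof -
    have "x \<in> ball x e" using z by (metis centre_in_ball empty_iff ball_empty not_le)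
    then have "\<bar>f z - f x\<bar> \<le> K * dist z x powr \<alpha>" using z by (intro K)
    also have "\<dots> \<le> K * e powr \<alpha>"
      using z K assms(2) by (intro mult_left_mono powr_mono2) (auto simp: dist_commute)
    finally show ?thesis by linarith
  qed
  then show thesis using K(1) by (intro that[of "\<bar>f x\<bar> + K * e powr \<alpha>"]) auto
qed

lemma hoelder_on_add:
  assumes "hoelder_on \<alpha> S f" "hoelder_on \<alpha> S g"
  shows "hoelder_on \<alpha> S (\<lambda>x. f x + g x)"
proof -
  obtain K where K: "\<And>z y. \<lbrakk>z \<in> S; y \<in> S\<rbrakk> \<Longrightarrow> \<bar>f z - f y\<bar> \<le> K * dist z y powr \<alpha>"
    using assms(1) by (rule hoelder_onE) (rule that)
  obtain L where L: "\<And>z y. \<lbrakk>z \<in> S; y \<in> S\<rbrakk> \<Longrightarrow> \<bar>g z - g y\<bar> \<le> L * dist z y powr \<alpha>"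
    using assms(2) by (rule hoelder_onE) (rule that)
  have "\<bar>(f z + g z) - (f y + g y)\<bar> \<le> (K + L) * dist z y powr \<alpha>" if "z \<in> S" "y \<in> S" for z y
    using K[OF that] L[OF that] by (simp add: distrib_right)
  then show ?thesis unfolding hoelder_on_def by blast
qed

lemma hoelder_on_mult_ball:
  assumes f: "hoelder_on \<alpha> (ball x e) f" and g: "hoelder_on \<alpha> (ball x e) g" and "0 < \<alpha>"
  shows "hoelder_on \<alpha> (ball x e) (\<lambda>x. f x * g x)"
proof -
  let ?S = "ball x e"
  obtain K where K: "0 \<le> K" "\<And>z y. \<lbrakk>z \<in> ?S; y \<in> ?S\<rbrakk> \<Longrightarrow> \<bar>f z - f y\<bar> \<le> K * dist z y powr \<alpha>"
    using f by (rule hoelder_onE) (rule that)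
  obtain L where L: "0 \<le> L" "\<And>z y. \<lbrakk>z \<in> ?S; y \<in> ?S\<rbrakk> \<Longrightarrow> \<bar>g z - g y\<bar> \<le> L * dist z y powr \<alpha>"
    using g by (rule hoelder_onE) (rule that)
  obtain N where N: "0 \<le> N" "\<And>z. z \<in> ?S \<Longrightarrow> \<bar>f z\<bar> \<le> N"
    by (rule hoelder_on_bounded_ball[OF f assms(3)]) (rule that)
  obtain P where P: "0 \<le> P" "\<And>z. z \<in> ?S \<Longrightarrow> \<bar>g z\<bar> \<le> P"
    by (rule hoelder_on_bounded_ball[OF g assms(3)]) (rule that)
  have "\<bar>f z * g z - f y * g y\<bar> \<le> (N * L + P * K) * dist z y powr \<alpha>" if z: "z \<in> ?S" "y \<in> ?S" for z y
  proof -
    have "\<bar>f z * g z - f y * g y\<bar> = \<bar>f z * (g z - g y) + g y * (f z - f y)\<bar>"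
      by (simp add: algebra_simps)
    also have "\<dots> \<le> \<bar>f z\<bar> * \<bar>g z - g y\<bar> + \<bar>g y\<bar> * \<bar>f z - f y\<bar>"
      by (rule order_trans[OF abs_triangle_ineq]) (simp add: abs_mult)
    also have "\<dots> \<le> N * (L * dist z y powr \<alpha>) + P * (K * dist z y powr \<alpha>)"
      using K L N P z by (intro add_mono mult_mono) auto
    finally show ?thesis by (simp add: algebra_simps)
  qed
  then show ?thesis unfolding hoelder_on_def by blast
qed

lemma locally_hoelder_combine:
  assumes f: "locally_hoelder \<alpha> U f" and g: "locally_hoelder \<alpha> U g"
    and op: "\<And>x e. \<lbrakk>hoelder_on \<alpha> (ball x e) f; hoelder_on \<alpha> (ball x e) g\<rbrakk> \<Longrightarrow> hoelder_on \<alpha> (ball x e) F"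
  shows "locally_hoelder \<alpha> U F"
  unfolding locally_hoelder_def
proof
  fix x assume x: "x \<in> U"
  obtain d where d: "d > 0" "ball x d \<subseteq> U" "hoelder_on \<alpha> (ball x d) f"
    using f x unfolding locally_hoelder_def by blast
  obtain e where e: "e > 0" "hoelder_on \<alpha> (ball x e) g"
    using g x unfolding locally_hoelder_def by blast
  have "hoelder_on \<alpha> (ball x (min d e)) F"
    using d e by (intro op) (auto elim: hoelder_on_subset)
  then show "\<exists>e>0. ball x e \<subseteq> U \<and> hoelder_on \<alpha> (ball x e) F"
    using d e by (intro exI[of _ "min d e"]) auto
qed

text \<open>\<open>locally_hoelder\<close> asks for balls contained in U, hence it sees no value of
  the function outside U and agreement on U is enough.\<close>

lemma locally_hoelder_cong:
  assumes "locally_hoelder \<alpha> U f" "\<And>x. x \<in> U \<Longrightarrow> f x = g x"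
  shows "locally_hoelder \<alpha> U g"
  unfolding locally_hoelder_def
proof
  fix x assume "x \<in> U"
  then obtain e where e: "e > 0" "ball x e \<subseteq> U" "hoelder_on \<alpha> (ball x e) f"
    using assms(1) unfolding locally_hoelder_def by blast
  have "f z = g z" if "z \<in> ball x e" for z using assms(2) e that by blast
  then have "hoelder_on \<alpha> (ball x e) g" using e(3) unfolding hoelder_on_def by simp
  with e show "\<exists>e>0. ball x e \<subseteq> U \<and> hoelder_on \<alpha> (ball x e) g" by blast
qed

lemma hoelder_on_imp_locally_hoelder:
  "\<lbrakk>open U; hoelder_on \<alpha> U f\<rbrakk> \<Longrightarrow> locally_hoelder \<alpha> U f"
  unfolding locally_hoelder_def open_contains_ball by (blast intro: hoelder_on_subset)

lemma locally_hoelder_imp_continuous_on: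
  assumes "locally_hoelder \<alpha> U f" "0 < \<alpha>"
  shows "continuous_on U f"
proof -
  have "(f \<longlongrightarrow> f x) (at x within U)" if x: "x \<in> U" for x
  proof -
    obtain e where e: "e > 0" "hoelder_on \<alpha> (ball x e) f"
      using assms(1) x unfolding locally_hoelder_def by blast
    obtain K where K: "\<And>z y. \<lbrakk>z \<in> ball x e; y \<in> ball x e\<rbrakk> \<Longrightarrow> \<bar>f z - f y\<bar> \<le> K * dist z y powr \<alpha>"
      using e(2) by (rule hoelder_onE) (rule that)
    have "((\<lambda>z. dist z x) \<longlongrightarrow> dist x x) (at x within U)" by (intro tendsto_intros)
    then have "((\<lambda>z. dist z x) \<longlongrightarrow> 0) (at x within U)" by simp
    then have "((\<lambda>z. dist z x powr \<alpha>) \<longlongrightarrow> 0) (at x within U)"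
      by (rule tendsto_zero_powrI[OF _ tendsto_const]) (use assms(2) in auto)
    then have lim: "((\<lambda>z. K * dist z x powr \<alpha>) \<longlongrightarrow> 0) (at x within U)"
      by (rule tendsto_mult_right_zero)
    have "\<forall>\<^sub>F z in at x within U. norm (f z - f x) \<le> K * dist z x powr \<alpha>"
      unfolding eventually_at using e(1)
      by (intro exI[of _ e]) (auto intro!: K simp: dist_commute)
    then have "((\<lambda>z. f z - f x) \<longlongrightarrow> 0) (at x within U)"
      using lim by (rule Lim_null_comparison)
    then show ?thesis by (simp add: LIM_zero_iff)
  qed
  then show ?thesis by (simp add: continuous_on_def)
qed

lemma lipschitz_pd_bound:
  fixes f :: "real^'p::finite \<Rightarrow> real"
  assumes S: "convex S" and f: "\<And>x. x \<in> S \<Longrightarrow> f differentiable (at x)"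
    and N: "\<And>x l. x \<in> S \<Longrightarrow> \<bar>pd l f x\<bar> \<le> N" and ab: "a \<in> S" "b \<in> S"
  shows "\<bar>f a - f b\<bar> \<le> real CARD('p) * N * norm (a - b)"
proof -
  have "norm (f a - f b) \<le> (real CARD('p) * N) * norm (a - b)"
  proof (rule differentiable_bound[OF S _ _ ab])
    show "(f has_derivative (\<lambda>h. \<Sum>l\<in>UNIV. h $ l * pd l f z)) (at z within S)" if "z \<in> S" for z
      by (rule has_derivative_at_withinI[OF has_derivative_pd[OF f[OF that]]])
    show "onorm (\<lambda>h. \<Sum>l\<in>UNIV. h $ l * pd l f z) \<le> real CARD('p) * N" if "z \<in> S" for z
    proof (rule onorm_le)
      fix h :: "real^'p"
      have "\<bar>\<Sum>l\<in>UNIV. h $ l * pd l f z\<bar> \<le> (\<Sum>l\<in>(UNIV :: 'p set). norm h * N)"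
      proof (rule order_trans[OF sum_abs sum_mono])
        show "\<bar>h $ l * pd l f z\<bar> \<le> norm h * N" for l
          unfolding abs_mult using N[OF that] by (intro mult_mono component_le_norm_cart) auto
      qed
      then show "norm (\<Sum>l\<in>UNIV. h $ l * pd l f z) \<le> real CARD('p) * N * norm h"
        by (simp add: mult_ac)
    qed
  qed
  then show ?thesis by simp
qed

text \<open>First derivatives are bounded on a small closed ball, so f is Lipschitz there, and
  Lipschitz functions are Hoelder for every exponent at most 1 on sets of diameter at most
  1.\<close>

lemma C1_imp_locally_hoelder:
  fixes f :: "real^'p::finite \<Rightarrow> real"
  assumes U: "open U" and f: "f differentiable_on U" and c: "\<And>l. continuous_on U (pd l f)"
    and \<alpha>: "0 < \<alpha>" "\<alpha> \<le> 1"
  shows "locally_hoelder \<alpha> U f"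
  unfolding locally_hoelder_def
proof
  fix x assume "x \<in> U"
  then obtain e0 where e0: "e0 > 0" "cball x e0 \<subseteq> U" using U open_contains_cball by blast
  \<comment> \<open>Radius at most 1/2 keeps mutual distances at most 1, where a distance is
    dominated by its power of exponent \<alpha>.\<close>
  define e where "e = min e0 (1/2)"
  have e: "e > 0" "e \<le> 1/2" "cball x e \<subseteq> U" using e0 by (auto simp: e_def)
  have "\<exists>N. \<forall>z\<in>cball x e. \<bar>pd l f z\<bar> \<le> N" for l
  proof -
    have "compact (pd l f ` cball x e)"
      by (rule compact_continuous_image[OF continuous_on_subset[OF c e(3)] compact_cball])
    then have "bounded (pd l f ` cball x e)" by (rule compact_imp_bounded)
    then show ?thesis unfolding bounded_iff by simp
  qed
  then obtain N where N: "\<And>l z. z \<in> cball x e \<Longrightarrow> \<bar>pd l f z\<bar> \<le> N l" by metis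
  define N' where "N' = Max (range N)"
  have N': "\<bar>pd l f z\<bar> \<le> N'" if "z \<in> cball x e" for l z
    using N[OF that, of l] unfolding N'_def by (rule order_trans) simp
  define L where "L = real CARD('p) * N'"
  have "\<bar>f a - f b\<bar> \<le> L * dist a b powr \<alpha>" if ab: "a \<in> ball x e" "b \<in> ball x e" for a b
  proof -
    have "\<bar>f a - f b\<bar> \<le> L * norm (a - b)"
      unfolding L_def
    proof (rule lipschitz_pd_bound[OF convex_cball[of x e] _ N'])
      show "f differentiable (at z)" if "z \<in> cball x e" for z
        using that e(3) by (intro differentiable_on_open_at[OF U f]) blast
    qed (use ab in auto)
    also have "\<dots> \<le> L * dist a b powr \<alpha>"
    proof (rule mult_left_mono)
      have "\<bar>pd l f x\<bar> \<le> N'" for l using e(1) by (intro N') simp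
      then have "0 \<le> N'" using abs_ge_zero order_trans by blast
      then show "0 \<le> L" unfolding L_def by simp
      have "dist a b \<le> dist a x + dist x b" by (rule dist_triangle)
      then have "dist a b \<le> 1" using ab e by (simp add: dist_commute)
      then have "dist a b powr 1 \<le> dist a b powr \<alpha>" using \<alpha> by (intro powr_mono') auto
      then show "norm (a - b) \<le> dist a b powr \<alpha>" by (simp add: dist_norm)
    qed
    finally show ?thesis by simp
  qed
  then have "hoelder_on \<alpha> (ball x e) f" unfolding hoelder_on_def by blast
  with e show "\<exists>e>0. ball x e \<subseteq> U \<and> hoelder_on \<alpha> (ball x e) f"
    by (intro exI[of _ e]) (auto simp: subset_iff)
qed

section \<open>Jets and Taylor polynomials\<close>

text \<open>
  The local version of the Hoelder condition is needed: on \<open>\<Omega>\<close> itself the derivatives of lower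
  order need be neither bounded nor Hoelder continuous, so the global classes are not closed under products.
\<close>

fun regular :: "real \<Rightarrow> (real^'p::finite) set \<Rightarrow> nat \<Rightarrow> (real^'p \<Rightarrow> real) \<Rightarrow> bool" where
  "regular \<alpha> U 0 f = locally_hoelder \<alpha> U f"
| "regular \<alpha> U (Suc k) f = (f differentiable_on U \<and> (\<forall>l. regular \<alpha> U k (pd l f)))"

text \<open>The class of f of order k + 1 is inherited by each \<open>pd l f\<close> with order k,
  by reading a list of derivatives from its inner end.\<close>

lemma C_k_hoelder_on_imp_regular:
  assumes "open U" "C_k_hoelder_on k \<alpha> U f"
  shows "regular \<alpha> U k f"
  using assms(2)
proof (induction k arbitrary: f)
  case 0
  then show ?case
    using assms(1) by (simp add: C_k_hoelder_on_def hoelder_on_imp_locally_hoelder)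
next
  case (Suc k)
  have "C_k_hoelder_on k \<alpha> U (pd l f)" for l
    unfolding C_k_hoelder_on_def C_k_on_def
  proof (intro conjI allI impI)
    fix js :: "'a list"
    show "partials js (pd l f) differentiable_on U" if "length js < k"
      using Suc.prems that unfolding C_k_hoelder_on_def C_k_on_def
      by (simp flip: partials_snoc)
    show "continuous_on U (partials js (pd l f))" "hoelder_on \<alpha> U (partials js (pd l f))"
      if "length js = k"
      using Suc.prems that unfolding C_k_hoelder_on_def C_k_on_def
      by (simp_all flip: partials_snoc)
  qed
  moreover have "f differentiable_on U"
    using Suc.prems unfolding C_k_hoelder_on_def C_k_on_def by (auto dest!: spec[of _ "[]"])
  ultimately show ?case by (simp add: Suc.IH)
qed

section \<open>Product rule and algebra of regular functions\<close>

lemma pd_add: "\<lbrakk>f differentiable (at x); g differentiable (at x)\<rbrakk>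
    \<Longrightarrow> pd l (\<lambda>x. f x + g x) x = pd l f x + pd l g x"
  by (rule pd_eqI[THEN trans], rule has_derivative_add[OF has_derivative_pd has_derivative_pd])
    (simp_all add: axis_def if_distrib[of "\<lambda>a. a * _"] cong: if_cong)

lemma pd_mult: "\<lbrakk>f differentiable (at x); g differentiable (at x)\<rbrakk>
    \<Longrightarrow> pd l (\<lambda>x. f x * g x) x = f x * pd l g x + pd l f x * g x"
  by (rule pd_eqI[THEN trans], rule has_derivative_mult[OF has_derivative_pd has_derivative_pd])
    (simp_all add: axis_def if_distrib[of "\<lambda>a. a * _"] cong: if_cong)

lemma pd_const: "pd l (\<lambda>x. c) = (\<lambda>x. 0)"
  by (rule ext, rule pd_eqI[THEN trans], rule has_derivative_const) simp

context
  fixes \<alpha> :: real and U :: "(real^'p::finite) set"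
  assumes \<alpha>: "0 < \<alpha>" "\<alpha> \<le> 1" and U: "open U"
begin

lemma differentiable_on_cong_open:
  fixes f g :: "real^'p \<Rightarrow> real"
  assumes "f differentiable_on U" "\<And>x. x \<in> U \<Longrightarrow> f x = g x"
  shows "g differentiable_on U"
  unfolding differentiable_on_def differentiable_def
proof
  fix x assume x: "x \<in> U"
  from assms(1) x obtain f' where "(f has_derivative f') (at x within U)"
    unfolding differentiable_on_def differentiable_def by blast
  then have "(g has_derivative f') (at x within U)"
    by (rule has_derivative_transform[OF x, rotated]) (simp add: assms(2))
  then show "\<exists>D. (g has_derivative D) (at x within U)" by blast
qed

text \<open>Derivatives at a point of the open set U are determined by the values on U. The lemma is
  needed because rules such as \<open>pd_mult\<close> are identities only on U, where the functions
  are known to be differentiable.\<close>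

lemma regular_cong:
  assumes "regular \<alpha> U k f" "\<And>x. x \<in> U \<Longrightarrow> f x = g x"
  shows "regular \<alpha> U k g"
  using assms
proof (induction k arbitrary: f g)
  case 0
  then show ?case by (auto intro: locally_hoelder_cong)
next
  case (Suc k)
  have "pd l f x = pd l g x" if "x \<in> U" for l x
    by (rule pd_cong[OF U that]) (rule Suc.prems(2))
  moreover have "regular \<alpha> U k (pd l f)" for l
    using Suc.prems(1) by simp
  ultimately have "regular \<alpha> U k (pd l g)" for l
    by (rule Suc.IH[rotated])
  then show ?case
    using Suc.prems differentiable_on_cong_open[of f g] by simp
qed

lemma regular_imp_continuous_on: "regular \<alpha> U k f \<Longrightarrow> continuous_on U f"
  using \<alpha> by (cases k) (auto intro: locally_hoelder_imp_continuous_on differentiable_imp_continuous_on)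

text \<open>All the content sits at the lowest level, where a function with continuous first
  derivatives must be locally Hoelder; higher orders follow by applying the induction hypothesis to
  the derivatives.\<close>

lemma regular_SucD: "regular \<alpha> U (Suc k) f \<Longrightarrow> regular \<alpha> U k f"
proof (induction k arbitrary: f)
  case 0
  have "continuous_on U (pd l f)" for l
    using 0 \<alpha>(1) by (auto intro: locally_hoelder_imp_continuous_on)
  then show ?case
    using C1_imp_locally_hoelder[OF U _ _ \<alpha>, of f] 0 by simp
next
  case (Suc k)
  have "f differentiable_on U" "regular \<alpha> U (Suc k) (pd l f)" for l
    using Suc.prems by simp_all
  then show ?case using Suc.IH by simp
qed

lemma regular_mono:
  assumes "regular \<alpha> U m f" "k \<le> m"
  shows "regular \<alpha> U k f"
  using assms(2,1) by (induction rule: inc_induct) (simp_all add: regular_SucD del: regular.simps)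

lemma regular_differentiable: "\<lbrakk>regular \<alpha> U k f; 0 < k; x \<in> U\<rbrakk> \<Longrightarrow> f differentiable (at x)"
  using differentiable_on_open_at[OF U, of f x] by (cases k) auto

lemma regular_add:
  assumes "regular \<alpha> U k f" "regular \<alpha> U k g"
  shows "regular \<alpha> U k (\<lambda>x. f x + g x)"
  using assms
proof (induction k arbitrary: f g)
  case 0
  then show ?case by (auto intro: locally_hoelder_combine hoelder_on_add)
next
  case (Suc k)
  have "regular \<alpha> U k (pd l (\<lambda>x. f x + g x))" for l
  proof (rule regular_cong)
    show "regular \<alpha> U k (\<lambda>x. pd l f x + pd l g x)" using Suc by simp
    show "pd l f x + pd l g x = pd l (\<lambda>x. f x + g x) x" if "x \<in> U" for x
      using Suc.prems that by (intro pd_add[symmetric] regular_differentiable[of "Suc k"]) auto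
  qed
  then show ?case using Suc.prems by (auto intro: differentiable_on_add)
qed

lemma regular_mult:
  assumes "regular \<alpha> U k f" "regular \<alpha> U k g"
  shows "regular \<alpha> U k (\<lambda>x. f x * g x)"
  using assms
proof (induction k arbitrary: f g)
  case 0
  then show ?case using \<alpha> by (auto intro: locally_hoelder_combine hoelder_on_mult_ball)
next
  case (Suc k)
  have "regular \<alpha> U k (pd l (\<lambda>x. f x * g x))" for l
  proof (rule regular_cong)
    show "regular \<alpha> U k (\<lambda>x. f x * pd l g x + pd l f x * g x)"
      using Suc regular_SucD[OF Suc.prems(1)] regular_SucD[OF Suc.prems(2)]
      by (intro regular_add) auto
    show "f x * pd l g x + pd l f x * g x = pd l (\<lambda>x. f x * g x) x" if "x \<in> U" for x
      using Suc.prems that by (intro pd_mult[symmetric] regular_differentiable[of "Suc k"]) auto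
  qed
  then show ?case using Suc.prems by (auto intro: differentiable_on_mult)
qed

lemma locally_hoelder_const: "locally_hoelder \<alpha> U (\<lambda>x. c)"
  by (rule hoelder_on_imp_locally_hoelder[OF U]) (auto simp: hoelder_on_def intro: exI[of _ 0])

lemma regular_const: "regular \<alpha> U k (\<lambda>x. c)"
  by (induction k arbitrary: c) (simp_all add: locally_hoelder_const pd_const)

lemma regular_sum:
  assumes "finite I" "\<And>i. i \<in> I \<Longrightarrow> regular \<alpha> U k (f i)"
  shows "regular \<alpha> U k (\<lambda>x. \<Sum>i\<in>I. f i x)"
  using assms by (induction I rule: finite_induct) (auto intro: regular_add regular_const)

lemma pd_commute_regular:
  assumes "regular \<alpha> U (Suc (Suc k)) f" "x \<in> U"
  shows "pd i (pd j f) x = pd j (pd i f) x"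
  by (rule pd_commute[OF U assms(2)]) (use assms(1) regular_imp_continuous_on[of k] in auto)

end

section \<open>Equality of jets at a point\<close>

fun same_jet :: "nat \<Rightarrow> (real^'p::finite \<Rightarrow> real) \<Rightarrow> (real^'p \<Rightarrow> real) \<Rightarrow> real^'p \<Rightarrow> bool" where
  "same_jet 0 f g y = (f y = g y)"
| "same_jet (Suc k) f g y = (f y = g y \<and> (\<forall>l. same_jet k (pd l f) (pd l g) y))"

lemma same_jet_value: "same_jet k f g y \<Longrightarrow> f y = g y"
  by (cases k) auto

lemma same_jet_SucD: "same_jet (Suc k) f g y \<Longrightarrow> same_jet k f g y"
  by (induction k arbitrary: f g) auto

lemma same_jet_mono:
  assumes "same_jet m f g y" "k \<le> m"
  shows "same_jet k f g y"
  using assms(2,1) by (induction rule: inc_induct) (simp_all add: same_jet_SucD del: same_jet.simps)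

lemma same_jet_cong:
  assumes "open U" "y \<in> U" "same_jet k f g y"
    and "\<And>x. x \<in> U \<Longrightarrow> f x = f' x" "\<And>x. x \<in> U \<Longrightarrow> g x = g' x"
  shows "same_jet k f' g' y"
  using assms(3-5)
proof (induction k arbitrary: f g f' g')
  case 0
  then show ?case using assms(2) by simp
next
  case (Suc k)
  have "same_jet k (pd l f') (pd l g') y" for l
  proof (rule Suc.IH)
    show "same_jet k (pd l f) (pd l g) y" using Suc.prems(1) by simp
    show "pd l f x = pd l f' x" if "x \<in> U" for x
      by (rule pd_cong[OF assms(1) that]) (rule Suc.prems(2))
    show "pd l g x = pd l g' x" if "x \<in> U" for x
      by (rule pd_cong[OF assms(1) that]) (rule Suc.prems(3))
  qed
  then show ?case using Suc.prems assms(2) by simp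
qed

lemma same_jet_add:
  assumes "open U" "y \<in> U" "0 < \<alpha>" "\<alpha> \<le> 1"
    and "regular \<alpha> U k f" "regular \<alpha> U k g" "regular \<alpha> U k f'" "regular \<alpha> U k g'"
    and "same_jet k f f' y" "same_jet k g g' y"
  shows "same_jet k (\<lambda>x. f x + g x) (\<lambda>x. f' x + g' x) y"
  using assms(5-)
proof (induction k arbitrary: f g f' g')
  case (Suc k)
  note diff = regular_differentiable[OF assms(3,4,1), of "Suc k", OF _ zero_less_Suc]
  have "same_jet k (pd l (\<lambda>x. f x + g x)) (pd l (\<lambda>x. f' x + g' x)) y" for l
  proof (rule same_jet_cong[OF assms(1,2)])
    show "same_jet k (\<lambda>x. pd l f x + pd l g x) (\<lambda>x. pd l f' x + pd l g' x) y"
      using Suc.prems by (intro Suc.IH) auto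
  qed (use Suc.prems in \<open>simp_all add: pd_add diff del: regular.simps\<close>)
  then show ?case using Suc.prems by simp
qed simp

text \<open>By the Leibniz rule the k-jet of a product is a function of the k-jets of the factors.
  Regularity is assumed because the rule must hold in a neighborhood of y before it can be
  differentiated further.\<close>

lemma same_jet_mult:
  assumes "open U" "y \<in> U" "0 < \<alpha>" "\<alpha> \<le> 1"
    and "regular \<alpha> U k f" "regular \<alpha> U k g" "regular \<alpha> U k f'" "regular \<alpha> U k g'"
    and "same_jet k f f' y" "same_jet k g g' y"
  shows "same_jet k (\<lambda>x. f x * g x) (\<lambda>x. f' x * g' x) y"
  using assms(5-)
proof (induction k arbitrary: f g f' g')
  case (Suc k)
  note diff = regular_differentiable[OF assms(3,4,1), of "Suc k", OF _ zero_less_Suc]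
  have reg: "regular \<alpha> U k f" "regular \<alpha> U k g" "regular \<alpha> U k f'" "regular \<alpha> U k g'"
    using Suc.prems regular_SucD[OF assms(3,4,1)] by blast+
  have jet: "same_jet k f f' y" "same_jet k g g' y"
    using Suc.prems same_jet_SucD by blast+
  have "same_jet k (pd l (\<lambda>x. f x * g x)) (pd l (\<lambda>x. f' x * g' x)) y" for l
  proof (rule same_jet_cong[OF assms(1,2)])
    show "same_jet k (\<lambda>x. f x * pd l g x + pd l f x * g x) (\<lambda>x. f' x * pd l g' x + pd l f' x * g' x) y"
      using Suc.prems reg jet
      by (intro same_jet_add[OF assms(1-4)] regular_mult[OF assms(3,4,1)] Suc.IH) auto
  qed (use Suc.prems in \<open>simp_all add: pd_mult diff del: regular.simps\<close>)
  then show ?case using Suc.prems by simp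
qed simp

lemma same_jet_refl: "same_jet k f f y"
  by (induction k arbitrary: f) auto

lemma same_jet_sum:
  assumes U: "open U" "y \<in> U" "0 < \<alpha>" "\<alpha> \<le> 1"
    and "finite I" "\<And>i. i \<in> I \<Longrightarrow> regular \<alpha> U k (f i)" "\<And>i. i \<in> I \<Longrightarrow> regular \<alpha> U k (g i)"
    and "\<And>i. i \<in> I \<Longrightarrow> same_jet k (f i) (g i) y"
  shows "same_jet k (\<lambda>x. \<Sum>i\<in>I. f i x) (\<lambda>x. \<Sum>i\<in>I. g i x) y"
  using assms(5-)
proof (induction I rule: finite_induct)
  case empty
  then show ?case by (simp add: same_jet_refl)
next
  case (insert i I)
  then show ?case
    by (simp, intro same_jet_add[OF U] regular_sum[OF U(3,4,1)]) auto
qed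

section \<open>Taylor polynomials by homogeneous degree\<close>

definition taylor_term :: "nat \<Rightarrow> (real^'p::finite \<Rightarrow> real) \<Rightarrow> real^'p \<Rightarrow> real^'p \<Rightarrow> real" where
  "taylor_term m f y x = (\<Sum>js | length js = m. partials js f y * (\<Prod>j\<leftarrow>js. (x - y) $ j))"

lemma finite_length_eq: "finite {js :: 'p::finite list. length js = m}"
  using finite_lists_length_eq[of "UNIV :: 'p set" m] by simp

lemma taylor_poly_eq_sum: "taylor_poly k f y x = (\<Sum>m\<le>k. taylor_term m f y x / fact m)"
proof -
  have *: "{js :: 'a list. length js \<le> k} = (\<Union>m\<le>k. {js. length js = m})" by auto
  have "taylor_poly k f y x = (\<Sum>js\<in>(\<Union>m\<le>k. {js. length js = m}).
      partials js f y / fact (length js) * (\<Prod>j\<leftarrow>js. (x - y) $ j))"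
    unfolding taylor_poly_def * ..
  also have "\<dots> = (\<Sum>m\<le>k. \<Sum>js | length js = m.
      partials js f y / fact (length js) * (\<Prod>j\<leftarrow>js. (x - y) $ j))"
    by (rule sum.UNION_disjoint) (simp_all add: finite_length_eq disjoint_iff)
  also have "\<dots> = (\<Sum>m\<le>k. taylor_term m f y x / fact m)"
    unfolding taylor_term_def sum_divide_distrib
    by (intro sum.cong) (auto simp del: vector_minus_component)
  finally show ?thesis .
qed

lemma taylor_term_0: "taylor_term 0 f y x = f y"
  by (simp add: taylor_term_def)

text \<open>A list of length m + 1 is split into its first m entries and its last one. Taking the
  last entry puts the extra derivative next to f, so what remains is a Taylor term of
  \<open>pd j f\<close>; since \<open>taylor_term\<close> carries no factorial, the recursion has no
  numerical coefficients.\<close>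

lemma taylor_term_Suc:
  "taylor_term (Suc m) f y x = (\<Sum>j\<in>UNIV. (x - y) $ j * taylor_term m (pd j f) y x)"
proof -
  have "taylor_term (Suc m) f y x = (\<Sum>(js, j)\<in>{js. length js = m} \<times> UNIV.
      partials (js @ [j]) f y * (\<Prod>i\<leftarrow>js @ [j]. (x - y) $ i))"
    unfolding taylor_term_def
  proof (rule sum.reindex_bij_witness[where i = "\<lambda>(js, j). js @ [j]" and j = "\<lambda>js. (butlast js, last js)"])
    show "(\<lambda>(js, j). js @ [j]) (butlast js, last js) = js" if "js \<in> {js :: 'a list. length js = Suc m}" for js
      using that by (cases js rule: rev_cases) auto
  qed (auto simp: length_Suc_conv_rev simp del: vector_minus_component)
  also have "\<dots> = (\<Sum>js | length js = m. \<Sum>j\<in>UNIV. partials js (pd j f) y * ((x - y) $ j * (\<Prod>i\<leftarrow>js. (x - y) $ i)))"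
    by (simp add: sum.cartesian_product partials_snoc mult.commute)
  also have "\<dots> = (\<Sum>j\<in>UNIV. \<Sum>js | length js = m. partials js (pd j f) y * ((x - y) $ j * (\<Prod>i\<leftarrow>js. (x - y) $ i)))"
    by (rule sum.swap)
  also have "\<dots> = (\<Sum>j\<in>UNIV. (x - y) $ j * taylor_term m (pd j f) y x)"
    unfolding taylor_term_def sum_distrib_left
    by (simp add: mult.left_commute del: vector_minus_component)
  finally show ?thesis .
qed

lemma partials_cong:
  assumes "open U" "y \<in> U" "\<And>x. x \<in> U \<Longrightarrow> f x = g x"
  shows "partials js f y = partials js g y"
  using assms(2)
proof (induction js arbitrary: y)
  case (Cons j js)
  then show ?case
    unfolding partials_Cons_pd using pd_cong[OF assms(1)] by blast
qed (use assms in simp)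

lemma taylor_term_cong:
  assumes "open U" "y \<in> U" "\<And>x. x \<in> U \<Longrightarrow> f x = g x"
  shows "taylor_term m f y = taylor_term m g y"
  unfolding taylor_term_def using partials_cong[OF assms] by (intro ext sum.cong) auto

text \<open>
  The homogeneous parts satisfy \<open>\<partial>\<^sub>l T\<^bsub>m+1\<^esub>[f] = (m + 1) T\<^sub>m[\<partial>\<^sub>l f]\<close>. Through the recursion
  \<open>T\<^bsub>m+1\<^esub>[f] = \<Sum>\<^sub>j (x - y)\<^sub>j T\<^sub>m[\<partial>\<^sub>j f]\<close> only the symmetry of second derivatives enters.
\<close>

lemma taylor_term_has_derivative:
  assumes U: "open U" "y \<in> U" "0 < \<alpha>" "\<alpha> \<le> 1" and f: "regular \<alpha> U (Suc m) f"
  shows "(taylor_term (Suc m) f y has_derivative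
    (\<lambda>h. \<Sum>l\<in>UNIV. h $ l * (real (Suc m) * taylor_term m (pd l f) y x))) (at x)"
  using f
proof (induction m arbitrary: f)
  case 0
  have "taylor_term (Suc 0) f y = (\<lambda>x. \<Sum>j\<in>UNIV. (x - y) $ j * pd j f y)"
    by (simp add: taylor_term_Suc taylor_term_0 fun_eq_iff)
  moreover have "((\<lambda>x. \<Sum>j\<in>UNIV. (x - y) $ j * pd j f y) has_derivative
      (\<lambda>h. \<Sum>j\<in>UNIV. h $ j * pd j f y)) (at x)"
    by (intro has_derivative_sum has_derivative_mult_left
      bounded_linear.has_derivative[OF bounded_linear_vec_nth])
      (auto intro!: derivative_eq_intros)
  ultimately show ?case by (simp add: taylor_term_0)
next
  case (Suc m)
  have swap: "taylor_term m (pd l (pd j f)) y = taylor_term m (pd j (pd l f)) y" for j l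
    using pd_commute_regular[OF U(3,4,1) Suc.prems] by (intro taylor_term_cong[OF U(1,2)])
  have IH: "(taylor_term (Suc m) (pd j f) y has_derivative
      (\<lambda>h. \<Sum>l\<in>UNIV. h $ l * (real (Suc m) * taylor_term m (pd l (pd j f)) y x))) (at x)" for j
    using Suc.prems by (intro Suc.IH) simp
  have coord: "((\<lambda>x. (x - y) $ j) has_derivative (\<lambda>h. h $ j)) (at x)" for j
    by (rule bounded_linear.has_derivative[OF bounded_linear_vec_nth])
      (auto intro!: derivative_eq_intros)
  have "(taylor_term (Suc (Suc m)) f y has_derivative
      (\<lambda>h. \<Sum>j\<in>UNIV. (x - y) $ j * (\<Sum>l\<in>UNIV. h $ l * (real (Suc m) * taylor_term m (pd l (pd j f)) y x))
        + h $ j * taylor_term (Suc m) (pd j f) y x)) (at x)"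
    unfolding taylor_term_Suc[of "Suc m" f y, abs_def]
    by (intro has_derivative_sum has_derivative_mult coord IH)
  moreover have "(\<Sum>j\<in>UNIV. (x - y) $ j * (\<Sum>l\<in>UNIV. h $ l * (real (Suc m) * taylor_term m (pd l (pd j f)) y x))
        + h $ j * taylor_term (Suc m) (pd j f) y x)
      = (\<Sum>l\<in>UNIV. h $ l * (real (Suc (Suc m)) * taylor_term (Suc m) (pd l f) y x))" for h
  proof -
    have "(\<Sum>j\<in>UNIV. (x - y) $ j * (\<Sum>l\<in>UNIV. h $ l * (real (Suc m) * taylor_term m (pd l (pd j f)) y x)))
        = (\<Sum>j\<in>UNIV. \<Sum>l\<in>UNIV. h $ l * (real (Suc m) * ((x - y) $ j * taylor_term m (pd j (pd l f)) y x)))"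
      by (simp add: sum_distrib_left swap mult_ac)
    also have "\<dots> = (\<Sum>l\<in>UNIV. \<Sum>j\<in>UNIV. h $ l * (real (Suc m) * ((x - y) $ j * taylor_term m (pd j (pd l f)) y x)))"
      by (rule sum.swap)
    also have "\<dots> = (\<Sum>l\<in>UNIV. h $ l * (real (Suc m) * taylor_term (Suc m) (pd l f) y x))"
      unfolding taylor_term_Suc by (simp add: sum_distrib_left)
    finally show ?thesis
      unfolding sum.distrib by (simp add: sum.distrib[symmetric] algebra_simps)
  qed
  ultimately show ?case by simp
qed

text \<open>The factor m + 1 from \<open>taylor_term_has_derivative\<close> turns 1/(m+1)! into
  1/m!, and the constant term disappears. The identity holds at every x, although f is regular only
  on U, because only derivatives of f at y enter.\<close>

lemma pd_taylor_poly:
  assumes U: "open U" "y \<in> U" "0 < \<alpha>" "\<alpha> \<le> 1" and f: "regular \<alpha> U (Suc k) f"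
  shows "pd l (taylor_poly (Suc k) f y) = taylor_poly k (pd l f) y"
proof
  fix x
  define D where "D m h = (\<Sum>l\<in>UNIV. h $ l * (real (Suc m) * taylor_term m (pd l f) y x))" for m and h :: "real^'a"
  have "((\<lambda>x. f y + (\<Sum>m\<le>k. taylor_term (Suc m) f y x / fact (Suc m))) has_derivative
      (\<lambda>h. 0 + (\<Sum>m\<le>k. D m h / fact (Suc m)))) (at x)"
  proof (intro has_derivative_add has_derivative_sum has_derivative_const)
    fix m assume "m \<in> {..k}"
    then have "regular \<alpha> U (Suc m) f" using regular_mono[OF U(3,4,1) f, of "Suc m"] by simp
    from taylor_term_has_derivative[OF U this]
    show "((\<lambda>x. taylor_term (Suc m) f y x / fact (Suc m)) has_derivative (\<lambda>h. D m h / fact (Suc m))) (at x)"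
      unfolding D_def by (rule bounded_linear.has_derivative[OF bounded_linear_divide])
  qed
  moreover have "(\<lambda>x. f y + (\<Sum>m\<le>k. taylor_term (Suc m) f y x / fact (Suc m))) = taylor_poly (Suc k) f y"
    by (simp add: fun_eq_iff taylor_poly_eq_sum sum.atMost_Suc_shift taylor_term_0 del: fact_Suc sum.atMost_Suc)
  ultimately have "(taylor_poly (Suc k) f y has_derivative (\<lambda>h. 0 + (\<Sum>m\<le>k. D m h / fact (Suc m)))) (at x)"
    by (simp only:)
  then have "pd l (taylor_poly (Suc k) f y) x = (\<Sum>m\<le>k. D m (axis l 1) / fact (Suc m))"
    by (rule pd_eqI[THEN trans]) simp
  moreover have "D m (axis l 1) = real (Suc m) * taylor_term m (pd l f) y x" for m
    unfolding D_def by (simp add: axis_def if_distrib[of "\<lambda>a. a * _"] cong: if_cong)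
  ultimately show "pd l (taylor_poly (Suc k) f y) x = taylor_poly k (pd l f) y x"
    by (simp add: taylor_poly_eq_sum del: of_nat_Suc)
qed

lemma taylor_poly_center: "taylor_poly k f y y = f y"
proof -
  have "taylor_poly k f y y = (\<Sum>m\<le>k. if m = 0 then f y else 0)"
    unfolding taylor_poly_eq_sum
  proof (rule sum.cong)
    show "taylor_term m f y y / fact m = (if m = 0 then f y else 0)" for m
      by (cases m) (simp_all add: taylor_term_0 taylor_term_Suc)
  qed simp
  then show ?thesis by simp
qed

text \<open>Values at the center agree, and by \<open>pd_taylor_poly\<close> each derivative of the
  polynomial is the Taylor polynomial of the corresponding derivative, one order lower.\<close>

lemma same_jet_taylor_poly:
  assumes U: "open U" "y \<in> U" "0 < \<alpha>" "\<alpha> \<le> 1" and f: "regular \<alpha> U k f"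
  shows "same_jet k f (taylor_poly k f y) y"
  using f
proof (induction k arbitrary: f)
  case (Suc k)
  then show ?case
    unfolding same_jet.simps taylor_poly_center
    by (simp add: pd_taylor_poly[OF U Suc.prems])
qed (simp add: taylor_poly_center)

section \<open>Polynomial families and iterated brackets\<close>

text \<open>Polynomials in x whose coefficients are continuous functions of y on S, described by
  closure rules instead of coefficient arrays: degrees never matter, only stability under
  derivatives and brackets and joint continuity in (y, x).\<close>

inductive poly_family :: "'y::topological_space set \<Rightarrow> ('y \<Rightarrow> real^'p::finite \<Rightarrow> real) \<Rightarrow> bool"
  for S where
  poly_family_coeff: "continuous_on S a \<Longrightarrow> poly_family S (\<lambda>y x. a y)"
| poly_family_coord: "poly_family S (\<lambda>y x. x $ j)"
| poly_family_add: "\<lbrakk>poly_family S F; poly_family S G\<rbrakk> \<Longrightarrow> poly_family S (\<lambda>y x. F y x + G y x)"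
| poly_family_mult: "\<lbrakk>poly_family S F; poly_family S G\<rbrakk> \<Longrightarrow> poly_family S (\<lambda>y x. F y x * G y x)"

lemma poly_family_const: "poly_family S (\<lambda>y x. c)"
  by (rule poly_family_coeff) (rule continuous_on_const)

lemma poly_family_sum:
  assumes "finite I" "\<And>i. i \<in> I \<Longrightarrow> poly_family S (F i)"
  shows "poly_family S (\<lambda>y x. \<Sum>i\<in>I. F i y x)"
  using assms by (induction I rule: finite_induct) (simp_all add: poly_family_const poly_family_add)

lemma poly_family_prod_list:
  assumes "\<And>j. j \<in> set js \<Longrightarrow> poly_family S (F j)"
  shows "poly_family S (\<lambda>y x. \<Prod>j\<leftarrow>js. F j y x)"
  using assms by (induction js) (simp_all add: poly_family_const poly_family_mult)

text \<open>The statement produces the total derivative and the partial families together, since the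
  product rule in the induction needs both. It holds for every y, also outside S, so brackets can be
  rewritten as functions of y without a side condition.\<close>

lemma poly_family_derivative:
  assumes "poly_family S F"
  shows "\<exists>F'. (\<forall>l. poly_family S (F' l)) \<and>
    (\<forall>y x. (F y has_derivative (\<lambda>h. \<Sum>l\<in>UNIV. h $ l * F' l y x)) (at x))"
  using assms
proof induction
  case (poly_family_coeff a)
  show ?case
    by (rule exI[of _ "\<lambda>l y x. 0"]) (simp add: poly_family_const)
next
  case (poly_family_coord j)
  have "((\<lambda>x. x $ j) has_derivative (\<lambda>h. h $ j)) (at x)" for x :: "real^'b"
    by (rule bounded_linear_imp_has_derivative[OF bounded_linear_vec_nth])
  moreover have "(\<Sum>l\<in>UNIV. h $ l * (if l = j then 1 else 0)) = h $ j" for h :: "real^'b"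
    by (simp add: if_distrib cong: if_cong)
  ultimately show ?case
    by (intro exI[of _ "\<lambda>l y x. if l = j then 1 else 0"]) (simp add: poly_family_const)
next
  case (poly_family_add F G)
  then obtain F' G' where F': "\<And>l. poly_family S (F' l)"
      "\<And>y x. (F y has_derivative (\<lambda>h. \<Sum>l\<in>UNIV. h $ l * F' l y x)) (at x)"
    and G': "\<And>l. poly_family S (G' l)"
      "\<And>y x. (G y has_derivative (\<lambda>h. \<Sum>l\<in>UNIV. h $ l * G' l y x)) (at x)"
    by blast
  have "((\<lambda>x. F y x + G y x) has_derivative (\<lambda>h. \<Sum>l\<in>UNIV. h $ l * (F' l y x + G' l y x))) (at x)" for y x
    using has_derivative_add[OF F'(2) G'(2)] by (simp add: distrib_left sum.distrib)
  then show ?case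
    using F' G' by (intro exI[of _ "\<lambda>l y x. F' l y x + G' l y x"]) (simp add: poly_family.poly_family_add)
next
  case (poly_family_mult F G)
  then obtain F' G' where F': "\<And>l. poly_family S (F' l)"
      "\<And>y x. (F y has_derivative (\<lambda>h. \<Sum>l\<in>UNIV. h $ l * F' l y x)) (at x)"
    and G': "\<And>l. poly_family S (G' l)"
      "\<And>y x. (G y has_derivative (\<lambda>h. \<Sum>l\<in>UNIV. h $ l * G' l y x)) (at x)"
    by blast
  have "((\<lambda>x. F y x * G y x) has_derivative
      (\<lambda>h. \<Sum>l\<in>UNIV. h $ l * (F y x * G' l y x + F' l y x * G y x))) (at x)" for y x
    using has_derivative_mult[OF F'(2) G'(2)]
    by (simp add: distrib_left sum.distrib sum_distrib_left sum_distrib_right mult_ac)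
  moreover have "poly_family S (\<lambda>y x. F y x * G' l y x + F' l y x * G y x)" for l
    using F'(1) G'(1) poly_family_mult.hyps
    by (intro poly_family.poly_family_add poly_family.poly_family_mult)
  ultimately show ?case
    by (intro exI[of _ "\<lambda>l y x. F y x * G' l y x + F' l y x * G y x"]) simp
qed

lemma poly_family_differentiable: "poly_family S F \<Longrightarrow> F y differentiable (at x)"
  using poly_family_derivative unfolding differentiable_def by blast

lemma poly_family_pd:
  assumes "poly_family S F"
  shows "poly_family S (\<lambda>y. pd l (F y))"
proof -
  obtain F' where F': "\<And>l. poly_family S (F' l)"
      "\<And>y x. (F y has_derivative (\<lambda>h. \<Sum>l\<in>UNIV. h $ l * F' l y x)) (at x)"
    using poly_family_derivative[OF assms] by blast
  have "pd l (F y) x = F' l y x" for y x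
    by (rule pd_eqI[OF F'(2), THEN trans])
      (simp add: axis_def if_distrib[of "\<lambda>a. a * _"] cong: if_cong)
  then have "(\<lambda>y. pd l (F y)) = F' l" by (intro ext)
  then show ?thesis using F'(1) by simp
qed

lemma poly_family_continuous:
  "poly_family S F \<Longrightarrow> continuous_on (S \<times> UNIV) (\<lambda>z. F (fst z) (snd z))"
proof (induction rule: poly_family.induct)
  case (poly_family_coeff a)
  then show ?case by (intro continuous_on_compose2[OF poly_family_coeff continuous_on_fst]) auto
qed (auto intro!: continuous_intros)

lemma poly_family_regular:
  assumes "poly_family S F" "open U" "0 < \<alpha>" "\<alpha> \<le> 1"
  shows "regular \<alpha> U k (F y)"
  using assms(1)
proof (induction k arbitrary: F)
  case 0
  have diff: "F y differentiable_on U" if "poly_family S F" for F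
    using poly_family_differentiable[OF that] by (simp add: differentiable_at_imp_differentiable_on)
  show ?case
    unfolding regular.simps
    using assms 0 by (intro C1_imp_locally_hoelder diff differentiable_imp_continuous_on
      diff[OF poly_family_pd])
next
  case (Suc k)
  then show ?case
    using poly_family_differentiable[OF Suc.prems] Suc.IH[OF poly_family_pd[OF Suc.prems]]
    by (simp add: differentiable_at_imp_differentiable_on)
qed

lemma poly_family_bounded:
  fixes F :: "'i::finite \<Rightarrow> real^'p::finite \<Rightarrow> real^'p \<Rightarrow> real"
  assumes F: "\<And>i. poly_family S (F i)" and K: "compact K" "K \<subseteq> S"
  shows "\<exists>N. \<forall>i. \<forall>y\<in>K. \<forall>x\<in>cball y 1. \<bar>F i y x\<bar> \<le> N"
proof -
  \<comment> \<open>The pairs (y, x) with y in K and x in the moving ball about y form a compact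
    set, being the image of a product under translation; one bound thus serves all centers.\<close>
  define D where "D = (\<lambda>(y, v). (y, y + v)) ` (K \<times> cball (0::real^'p) 1)"
  have D: "compact D"
    unfolding D_def case_prod_unfold
    by (intro compact_continuous_image compact_Times K compact_cball continuous_intros)
  have DS: "D \<subseteq> S \<times> UNIV" unfolding D_def using K by auto
  have "\<exists>N. \<forall>z\<in>D. \<bar>F i (fst z) (snd z)\<bar> \<le> N" for i
  proof -
    have "bounded ((\<lambda>z. F i (fst z) (snd z)) ` D)"
      by (rule compact_imp_bounded[OF compact_continuous_image[OF
          continuous_on_subset[OF poly_family_continuous[OF F] DS] D]])
    then show ?thesis unfolding bounded_iff by simp
  qed
  then obtain N where N: "\<And>i z. z \<in> D \<Longrightarrow> \<bar>F i (fst z) (snd z)\<bar> \<le> N i" by metis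
  have "\<bar>F i y x\<bar> \<le> Max (range N)" if "y \<in> K" "x \<in> cball y 1" for i y x
  proof -
    have "(y, x) \<in> D"
      unfolding D_def using that
      by (intro image_eqI[of _ _ "(y, x - y)"]) (auto simp: dist_norm norm_minus_commute)
    from N[OF this, of i] have "\<bar>F i y x\<bar> \<le> N i" by simp
    also have "\<dots> \<le> Max (range N)" by simp
    finally show ?thesis .
  qed
  then show ?thesis by blast
qed

section \<open>Lie brackets in coordinates\<close>

lemma vector_has_derivative_pd:
  fixes Y :: "real^'p::finite \<Rightarrow> real^'q::finite"
  assumes "\<And>j. (\<lambda>z. Y z $ j) differentiable (at x)"
  shows "(Y has_derivative (\<lambda>h. \<chi> j. \<Sum>l\<in>UNIV. h $ l * pd l (\<lambda>z. Y z $ j) x)) (at x)"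
  unfolding has_derivative_componentwise_within[of Y]
  using has_derivative_pd[OF assms] by (auto simp: Basis_vec_def inner_axis)

text \<open>The difference is written as a sum with a factor -1, so that the closure rules for sums,
  products and constants apply to it as it stands.\<close>

lemma lie_bracket_component:
  assumes "\<And>j. (\<lambda>z. X z $ j) differentiable (at x)" "\<And>j. (\<lambda>z. Y z $ j) differentiable (at x)"
  shows "lie_bracket X Y x $ j =
    (\<Sum>l\<in>UNIV. X x $ l * pd l (\<lambda>z. Y z $ j) x + (-1) * (Y x $ l * pd l (\<lambda>z. X z $ j) x))"
  unfolding lie_bracket_def
    frechet_derivative_at[OF vector_has_derivative_pd[OF assms(1)], symmetric]
    frechet_derivative_at[OF vector_has_derivative_pd[OF assms(2)], symmetric]
  by (simp add: sum_subtractf)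

lemma regular_lie_bracket:
  assumes U: "0 < \<alpha>" "\<alpha> \<le> 1" "open U"
    and X: "\<And>j. regular \<alpha> U (Suc k) (\<lambda>x. X x $ j)" and Y: "\<And>j. regular \<alpha> U (Suc k) (\<lambda>x. Y x $ j)"
  shows "regular \<alpha> U k (\<lambda>x. lie_bracket X Y x $ j)"
proof (rule regular_cong[OF U])
  show "regular \<alpha> U k (\<lambda>x. \<Sum>l\<in>UNIV. X x $ l * pd l (\<lambda>z. Y z $ j) x + (-1) * (Y x $ l * pd l (\<lambda>z. X z $ j) x))"
    using regular_SucD[OF U X] regular_SucD[OF U Y] X Y
    by (intro regular_sum[OF U] regular_add[OF U] regular_mult[OF U] regular_const[OF U]) auto
  fix x assume "x \<in> U"
  then have diff: "(\<lambda>z. X z $ j) differentiable (at x)" "(\<lambda>z. Y z $ j) differentiable (at x)" for j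
    using regular_differentiable[OF U X] regular_differentiable[OF U Y] by auto
  show "(\<Sum>l\<in>UNIV. X x $ l * pd l (\<lambda>z. Y z $ j) x + (-1) * (Y x $ l * pd l (\<lambda>z. X z $ j) x)) = lie_bracket X Y x $ j"
    by (rule lie_bracket_component[OF diff, symmetric])
qed

text \<open>A bracket is a fixed bilinear expression in the fields and their first derivatives, so
  its k-jet is determined by the (k+1)-jets of the two fields.\<close>

lemma same_jet_lie_bracket:
  assumes U: "open U" "y \<in> U" "0 < \<alpha>" "\<alpha> \<le> 1"
    and X: "\<And>j. regular \<alpha> U (Suc k) (\<lambda>x. X x $ j)" and Y: "\<And>j. regular \<alpha> U (Suc k) (\<lambda>x. Y x $ j)"
    and X': "\<And>j. regular \<alpha> U (Suc k) (\<lambda>x. X' x $ j)" and Y': "\<And>j. regular \<alpha> U (Suc k) (\<lambda>x. Y' x $ j)"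
    and XX': "\<And>j. same_jet (Suc k) (\<lambda>x. X x $ j) (\<lambda>x. X' x $ j) y"
    and YY': "\<And>j. same_jet (Suc k) (\<lambda>x. Y x $ j) (\<lambda>x. Y' x $ j) y"
  shows "same_jet k (\<lambda>x. lie_bracket X Y x $ j) (\<lambda>x. lie_bracket X' Y' x $ j) y"
proof (rule same_jet_cong[OF U(1,2)])
  note U' = U(3,4,1)
  note low = regular_SucD[OF U' X] regular_SucD[OF U' Y] regular_SucD[OF U' X'] regular_SucD[OF U' Y']
    same_jet_SucD[OF XX'] same_jet_SucD[OF YY']
  have pds: "regular \<alpha> U k (pd l (\<lambda>x. X x $ j))" "regular \<alpha> U k (pd l (\<lambda>x. Y x $ j))"
    "regular \<alpha> U k (pd l (\<lambda>x. X' x $ j))" "regular \<alpha> U k (pd l (\<lambda>x. Y' x $ j))"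
    "same_jet k (pd l (\<lambda>x. X x $ j)) (pd l (\<lambda>x. X' x $ j)) y"
    "same_jet k (pd l (\<lambda>x. Y x $ j)) (pd l (\<lambda>x. Y' x $ j)) y" for l j
    using X Y X' Y' XX' YY' by simp_all
  show "same_jet k
    (\<lambda>x. \<Sum>l\<in>UNIV. X x $ l * pd l (\<lambda>z. Y z $ j) x + (-1) * (Y x $ l * pd l (\<lambda>z. X z $ j) x))
    (\<lambda>x. \<Sum>l\<in>UNIV. X' x $ l * pd l (\<lambda>z. Y' z $ j) x + (-1) * (Y' x $ l * pd l (\<lambda>z. X' z $ j) x)) y"
    by (intro same_jet_sum[OF U] same_jet_add[OF U] same_jet_mult[OF U] same_jet_refl
      regular_add[OF U'] regular_mult[OF U'] regular_const[OF U'] low pds finite_UNIV finite)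
  fix x assume x: "x \<in> U"
  have diff: "(\<lambda>z. X z $ j) differentiable (at x)" "(\<lambda>z. Y z $ j) differentiable (at x)"
    "(\<lambda>z. X' z $ j) differentiable (at x)" "(\<lambda>z. Y' z $ j) differentiable (at x)" for j
    using x regular_differentiable[OF U' X] regular_differentiable[OF U' Y]
      regular_differentiable[OF U' X'] regular_differentiable[OF U' Y'] by auto
  show "(\<Sum>l\<in>UNIV. X x $ l * pd l (\<lambda>z. Y z $ j) x + (-1) * (Y x $ l * pd l (\<lambda>z. X z $ j) x)) = lie_bracket X Y x $ j"
    by (rule lie_bracket_component[OF diff(1,2), symmetric])
  show "(\<Sum>l\<in>UNIV. X' x $ l * pd l (\<lambda>z. Y' z $ j) x + (-1) * (Y' x $ l * pd l (\<lambda>z. X' z $ j) x)) = lie_bracket X' Y' x $ j"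
    by (rule lie_bracket_component[OF diff(3,4), symmetric])
qed

lemma poly_family_lie_bracket:
  assumes X: "\<And>j. poly_family S (\<lambda>y x. X y x $ j)" and Y: "\<And>j. poly_family S (\<lambda>y x. Y y x $ j)"
  shows "poly_family S (\<lambda>y x. lie_bracket (X y) (Y y) x $ j)"
proof -
  note diff = poly_family_differentiable[OF X] poly_family_differentiable[OF Y]
  note pds = poly_family_pd[OF X] poly_family_pd[OF Y]
  show ?thesis
    unfolding lie_bracket_component[OF diff]
    by (intro poly_family_sum poly_family_add poly_family_mult poly_family_const X Y pds finite)
qed

text \<open>The dependence on y runs through derivatives of order at most k, which are continuous on
  S, and through the factors x - y; no smoothness in y is claimed.\<close>

lemma poly_family_taylor_poly:
  assumes "C_k_on k S f"
  shows "poly_family S (\<lambda>y. taylor_poly k f y)"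
  unfolding taylor_poly_def
proof (intro poly_family_sum poly_family_mult poly_family_prod_list)
  show "finite {js :: 'a list. length js \<le> k}"
    using finite_lists_length_le[of "UNIV :: 'a set" k] by simp
  fix js :: "'a list" assume "js \<in> {js. length js \<le> k}"
  then have "continuous_on S (partials js f)"
    using assms unfolding C_k_on_def
    by (cases "length js = k") (auto intro: differentiable_imp_continuous_on)
  then show "poly_family S (\<lambda>y x. partials js f y / fact (length js))"
    by (intro poly_family_coeff continuous_intros) auto
  show "poly_family S (\<lambda>y x. (x - y) $ j)" for j
  proof -
    have "poly_family S (\<lambda>y x. x $ j + (- y $ j))"
      by (intro poly_family_add poly_family_coord poly_family_coeff continuous_intros)
    then show ?thesis by simp
  qed
qed

section \<open>Weight count for iterated commutators\<close>

lemma weight_Cons: "weight (i # I) = wt i + weight I"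
  by (simp add: weight_def)

lemma wt_pos: "0 < wt i"
  by (simp add: wt_def)

lemma weight_pos: "I \<noteq> [] \<Longrightarrow> 0 < weight I"
  using wt_pos by (cases I) (auto simp: weight_Cons)

text \<open>Regularity, polynomial form and equality of jets are proved in one induction, as the jet
  of a bracket is computed through the regularity of its arguments. The order r - |I| is what
  survives after the differentiations in the brackets; for |I| = r it is 0, so the fields are still
  locally Hoelder and still agree with their approximations at the center.\<close>

lemma field_comm_approx:
  assumes U: "0 < \<alpha>" "\<alpha> \<le> 1" "open U"
    and X: "\<And>i j. i \<in> {0..n} \<Longrightarrow> C_k_hoelder_on (r - wt i) \<alpha> U (\<lambda>x. X i x $ j)"
    and I: "I \<in> multiindices n r"
  shows "regular \<alpha> U (r - weight I) (\<lambda>x. field_comm X I x $ j)"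
    and "poly_family U (\<lambda>y x. field_comm (approx_field r X y) I x $ j)"
    and "y \<in> U \<Longrightarrow> same_jet (r - weight I) (\<lambda>x. field_comm X I x $ j)
      (\<lambda>x. field_comm (approx_field r X y) I x $ j) y"
proof -
  let ?S = "approx_field r X"
  define P where "P I \<longleftrightarrow> (\<forall>j. regular \<alpha> U (r - weight I) (\<lambda>x. field_comm X I x $ j) \<and>
      poly_family U (\<lambda>y x. field_comm (?S y) I x $ j) \<and>
      (\<forall>y\<in>U. same_jet (r - weight I) (\<lambda>x. field_comm X I x $ j) (\<lambda>x. field_comm (?S y) I x $ j) y))"
    for I
  have single: "P [i]" if "i \<in> {0..n}" for i
  proof -
    have "C_k_on (r - wt i) U (\<lambda>x. X i x $ j)" for j
      using X[OF that] by (simp add: C_k_hoelder_on_def)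
    then show ?thesis
      using C_k_hoelder_on_imp_regular[OF U(3) X[OF that]]
      unfolding P_def by (simp add: weight_def approx_field_def poly_family_taylor_poly
        same_jet_taylor_poly[OF U(3) _ U(1,2)])
  qed
  have "P I" using I
  proof (induction I rule: induct_list012)
    case 1
    then show ?case by (simp add: multiindices_def)
  next
    case (2 i)
    then show ?case by (intro single) (simp add: multiindices_def)
  next
    case (3 i i' I)
    let ?J = "i' # I" and ?k = "r - weight (i # i' # I)"
    have mem: "i \<in> {0..n}" "?J \<in> multiindices n r" and w: "weight (i # ?J) \<le> r"
      using 3(3) by (auto simp: multiindices_def weight_Cons)
    \<comment> \<open>Each of the two arguments has weight at least 1, so passing to the bracket
      lowers the available order by at least one on either side, which pays for the one derivative
      taken. The bound \<open>w\<close> keeps the natural number subtraction from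
      truncating.\<close>
    have le: "Suc ?k \<le> r - wt i" "Suc ?k \<le> r - weight ?J"
      using w weight_pos[of ?J] wt_pos[of i] by (auto simp: weight_Cons)
    have Pi: "P [i]" and PJ: "P ?J" using single 3(2) mem by auto
    have regs: "regular \<alpha> U (Suc ?k) (\<lambda>x. X i x $ j)" "regular \<alpha> U (Suc ?k) (\<lambda>x. field_comm X ?J x $ j)" for j
      by (rule regular_mono[OF U _ le(1)], use Pi in \<open>simp add: P_def weight_def\<close>)
        (rule regular_mono[OF U _ le(2)], use PJ in \<open>simp add: P_def\<close>)
    have polys: "poly_family U (\<lambda>y x. ?S y i x $ j)" "poly_family U (\<lambda>y x. field_comm (?S y) ?J x $ j)" for j
      using Pi PJ unfolding P_def by auto
    have jets: "same_jet (Suc ?k) (\<lambda>x. X i x $ j) (\<lambda>x. ?S y i x $ j) y"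
      "same_jet (Suc ?k) (\<lambda>x. field_comm X ?J x $ j) (\<lambda>x. field_comm (?S y) ?J x $ j) y"
      if "y \<in> U" for y j
      by (rule same_jet_mono[OF _ le(1)], use Pi that in \<open>simp add: P_def weight_def\<close>)
        (rule same_jet_mono[OF _ le(2)], use PJ that in \<open>simp add: P_def\<close>)
    show ?case
      unfolding P_def field_comm.simps
    proof (intro allI conjI ballI)
      fix j
      show "regular \<alpha> U ?k (\<lambda>x. lie_bracket (X i) (field_comm X ?J) x $ j)"
        by (rule regular_lie_bracket[OF U regs])
      show "poly_family U (\<lambda>y x. lie_bracket (?S y i) (field_comm (?S y) ?J) x $ j)"
        by (rule poly_family_lie_bracket[OF polys])
      fix y assume y: "y \<in> U"
      show "same_jet ?k (\<lambda>x. lie_bracket (X i) (field_comm X ?J) x $ j)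
          (\<lambda>x. lie_bracket (?S y i) (field_comm (?S y) ?J) x $ j) y"
        by (rule same_jet_lie_bracket[OF U(3) y U(1,2) regs poly_family_regular[OF polys(1) U(3,1,2)]
            poly_family_regular[OF polys(2) U(3,1,2)] jets[OF y]])
    qed
  qed
  then show "regular \<alpha> U (r - weight I) (\<lambda>x. field_comm X I x $ j)"
    and "poly_family U (\<lambda>y x. field_comm (?S y) I x $ j)"
    and "y \<in> U \<Longrightarrow> same_jet (r - weight I) (\<lambda>x. field_comm X I x $ j) (\<lambda>x. field_comm (?S y) I x $ j) y"
    unfolding P_def by auto
qed

section \<open>Uniform estimates on compact sets\<close>

text \<open>K is an arbitrary compact set, so chaining balls along a segment is not possible.
  Instead, pairs violating the estimate with constants tending to infinity accumulate at some (a,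
  b): if a = b, the local estimate near a bounds their quotients, and if not, boundedness of f and a
  positive distance do.\<close>

lemma locally_hoelder_imp_hoelder_on:
  assumes f: "locally_hoelder \<alpha> U f" and \<alpha>: "0 < \<alpha>" and K: "compact K" "K \<subseteq> U"
  shows "hoelder_on \<alpha> K f"
proof (rule ccontr)
  assume "\<not> hoelder_on \<alpha> K f"
  then have "\<forall>n. \<exists>x y. x \<in> K \<and> y \<in> K \<and> real n * dist x y powr \<alpha> < \<bar>f x - f y\<bar>"
    unfolding hoelder_on_def by (meson linorder_not_le)
  then obtain x y where xy: "\<And>n. x n \<in> K" "\<And>n. y n \<in> K"
    "\<And>n. real n * dist (x n) (y n) powr \<alpha> < \<bar>f (x n) - f (y n)\<bar>"
    by metis
  have "seq_compact (K \<times> K)" using compact_imp_seq_compact[OF compact_Times[OF K(1) K(1)]] .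
  moreover have "\<forall>n. (x n, y n) \<in> K \<times> K" using xy by simp
  ultimately obtain l s where l: "l \<in> K \<times> K" and s: "strict_mono s"
    and lim: "((\<lambda>n. (x n, y n)) \<circ> s) \<longlonglongrightarrow> l"
    by (rule seq_compactE)
  obtain a b where ab: "l = (a, b)" "a \<in> K" "b \<in> K" using l by auto
  have limx: "(\<lambda>n. x (s n)) \<longlonglongrightarrow> a" and limy: "(\<lambda>n. y (s n)) \<longlonglongrightarrow> b"
    using tendsto_fst[OF lim] tendsto_snd[OF lim] by (simp_all add: ab o_def)
  have large: "\<forall>\<^sub>F n in sequentially. c \<le> real (s n)" for c
  proof (rule eventually_sequentiallyI)
    fix n assume "nat \<lceil>c\<rceil> \<le> n"
    also have "n \<le> s n" using s by (rule seq_suble)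
    finally show "c \<le> real (s n)" by linarith
  qed
  have "\<exists>C. \<forall>\<^sub>F n in sequentially.
      \<bar>f (x (s n)) - f (y (s n))\<bar> \<le> C * dist (x (s n)) (y (s n)) powr \<alpha>"
  proof (cases "a = b")
    case True
    obtain e where e: "e > 0" "hoelder_on \<alpha> (ball a e) f"
      using f ab K unfolding locally_hoelder_def by blast
    obtain C where C: "\<And>z w. \<lbrakk>z \<in> ball a e; w \<in> ball a e\<rbrakk> \<Longrightarrow> \<bar>f z - f w\<bar> \<le> C * dist z w powr \<alpha>"
      using e(2) by (rule hoelder_onE) (rule that)
    have "\<forall>\<^sub>F n in sequentially. x (s n) \<in> ball a e" "\<forall>\<^sub>F n in sequentially. y (s n) \<in> ball a e"
      using tendstoD[OF limx e(1)] tendstoD[OF limy e(1)] True by (simp_all add: dist_commute)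
    then have "\<forall>\<^sub>F n in sequentially. \<bar>f (x (s n)) - f (y (s n))\<bar> \<le> C * dist (x (s n)) (y (s n)) powr \<alpha>"
      by eventually_elim (rule C)
    then show ?thesis by blast
  next
    case False
    have "bounded (f ` K)"
      by (rule compact_imp_bounded[OF compact_continuous_image[OF continuous_on_subset[OF
          locally_hoelder_imp_continuous_on[OF f \<alpha>] K(2)] K(1)]])
    then obtain N where N: "\<And>z. z \<in> K \<Longrightarrow> \<bar>f z\<bar> \<le> N" unfolding bounded_iff by auto
    define d where "d = dist a b / 2"
    have d: "0 < d" using False by (simp add: d_def)
    have "(\<lambda>n. dist (x (s n)) (y (s n))) \<longlonglongrightarrow> dist a b"
      by (intro tendsto_dist limx limy)
    then have "\<forall>\<^sub>F n in sequentially. d < dist (x (s n)) (y (s n))"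
      by (rule order_tendstoD(1)) (use False in \<open>simp add: d_def\<close>)
    then have "\<forall>\<^sub>F n in sequentially.
      \<bar>f (x (s n)) - f (y (s n))\<bar> \<le> (2 * N / d powr \<alpha>) * dist (x (s n)) (y (s n)) powr \<alpha>"
    proof eventually_elim
      case (elim n)
      have "0 \<le> N" using N[OF ab(2)] by linarith
      then have "2 * N \<le> (2 * N / d powr \<alpha>) * d powr \<alpha>" using d by simp
      also have "\<dots> \<le> (2 * N / d powr \<alpha>) * dist (x (s n)) (y (s n)) powr \<alpha>"
        using elim d \<alpha> \<open>0 \<le> N\<close> by (intro mult_left_mono powr_mono2) auto
      finally show ?case using N[OF xy(1), of "s n"] N[OF xy(2), of "s n"] by linarith
    qed
    then show ?thesis by blast
  qed
  then obtain C where "\<forall>\<^sub>F n in sequentially.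
      \<bar>f (x (s n)) - f (y (s n))\<bar> \<le> C * dist (x (s n)) (y (s n)) powr \<alpha>" by blast
  with large[of C] have "\<forall>\<^sub>F n in sequentially. False"
  proof eventually_elim
    case (elim n)
    have "C * dist (x (s n)) (y (s n)) powr \<alpha> \<le> real (s n) * dist (x (s n)) (y (s n)) powr \<alpha>"
      using elim(1) by (intro mult_right_mono) auto
    with elim(2) xy(3)[of "s n"] show ?case by linarith
  qed
  then show False by simp
qed

lemma norm_le_card_mult:
  fixes v :: "real^'n::finite"
  assumes "\<And>j. \<bar>v $ j\<bar> \<le> b"
  shows "norm v \<le> real CARD('n) * b"
proof -
  have "norm v \<le> (\<Sum>j\<in>UNIV. \<bar>v $ j\<bar>)" by (rule norm_le_l1_cart)
  also have "\<dots> \<le> (\<Sum>j\<in>(UNIV :: 'n set). b)" by (rule sum_mono) (rule assms)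
  finally show ?thesis by simp
qed

lemma abs_linear_combination_le:
  fixes u :: "real^'n::finite"
  assumes "\<And>k. \<bar>a k\<bar> \<le> b"
  shows "\<bar>\<Sum>k\<in>UNIV. u $ k * a k\<bar> \<le> real CARD('n) * (norm u * b)"
proof -
  have "\<bar>\<Sum>k\<in>UNIV. u $ k * a k\<bar> \<le> (\<Sum>k\<in>(UNIV :: 'n set). norm u * b)"
  proof (rule order_trans[OF sum_abs sum_mono])
    show "\<bar>u $ k * a k\<bar> \<le> norm u * b" for k
      unfolding abs_mult using assms by (intro mult_mono component_le_norm_cart) auto
  qed
  then show ?thesis by simp
qed

text \<open>Here L may depend on y and R: the estimate feeds only the uniqueness of integral curves,
  where size is irrelevant, and not the uniform bounds.\<close>

lemma poly_family_lipschitz_cball: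
  fixes F :: "'y::topological_space \<Rightarrow> real^'p::finite \<Rightarrow> real"
  assumes F: "poly_family S F"
  shows "\<exists>L. \<forall>x\<in>cball 0 R. \<forall>z\<in>cball 0 R. \<bar>F y x - F y z\<bar> \<le> L * norm (x - z)"
proof -
  have "\<exists>N. \<forall>x\<in>cball 0 R. \<bar>pd l (F y) x\<bar> \<le> N" for l
  proof -
    have "continuous_on (cball 0 R) (pd l (F y))"
      using poly_family_differentiable[OF poly_family_pd[OF F]]
      by (intro differentiable_imp_continuous_on differentiable_at_imp_differentiable_on) auto
    then have "bounded (pd l (F y) ` cball 0 R)"
      by (intro compact_imp_bounded compact_continuous_image compact_cball)
    then show ?thesis unfolding bounded_iff by simp
  qed
  then obtain N where N: "\<And>l x. x \<in> cball 0 R \<Longrightarrow> \<bar>pd l (F y) x\<bar> \<le> N l" by metis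
  have N': "\<bar>pd l (F y) x\<bar> \<le> Max (range N)" if "x \<in> cball 0 R" for l x
    using N[OF that, of l] by (rule order_trans) simp
  have "\<bar>F y x - F y z\<bar> \<le> (real CARD('p) * Max (range N)) * norm (x - z)"
    if "x \<in> cball 0 R" "z \<in> cball 0 R" for x z
    by (rule lipschitz_pd_bound[OF convex_cball poly_family_differentiable[OF F] N' that])
  then show ?thesis by blast
qed

text \<open>The parameter u comes last, so that a partial application to a point is the linear map
  \<open>A x\<close> of the locale \<open>controlled_field\<close>.\<close>

definition field_combination ::
    "('p \<Rightarrow> real^'p \<Rightarrow> real^'p) \<Rightarrow> real^'p::finite \<Rightarrow> real^'p \<Rightarrow> real^'p" where
  "field_combination W x u = (\<Sum>k\<in>UNIV. (u $ k) *\<^sub>R W k x)"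

lemma field_combination_component: "field_combination W x u $ j = (\<Sum>k\<in>UNIV. u $ k * W k x $ j)"
  by (simp add: field_combination_def)

lemma linear_field_combination: "linear (field_combination W x)"
  unfolding field_combination_def
  by (rule linearI) (simp_all add: scaleR_add_left sum.distrib scaleR_sum_right)

lemma field_combination_axis: "field_combination W x (axis k 1) = W k x"
  unfolding field_combination_def by (simp add: axis_def if_distrib[of "\<lambda>a. a *\<^sub>R _"] cong: if_cong)

lemma poly_family_field_combination:
  assumes "\<And>k j. poly_family S (\<lambda>y x. W k y x $ j)"
  shows "poly_family S (\<lambda>y x. field_combination (\<lambda>k. W k y) x u $ j)"
  unfolding field_combination_component
  by (intro poly_family_sum poly_family_mult poly_family_const assms finite)

lemma field_combination_lipschitz_cball:
  assumes W: "\<And>k j. poly_family S (\<lambda>y x. W k y x $ j)"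
  shows "\<exists>L. \<forall>x\<in>cball 0 R. \<forall>z\<in>cball 0 R.
    norm (field_combination (\<lambda>k. W k y) x u - field_combination (\<lambda>k. W k y) z u) \<le> L * norm (x - z)"
proof -
  let ?F = "\<lambda>x. field_combination (\<lambda>k. W k y) x u"
  have "\<exists>L. \<forall>x\<in>cball 0 R. \<forall>z\<in>cball 0 R. \<bar>?F x $ j - ?F z $ j\<bar> \<le> L * norm (x - z)" for j
    by (rule poly_family_lipschitz_cball[OF poly_family_field_combination[OF W]])
  then obtain L where L: "\<And>j x z. \<lbrakk>x \<in> cball 0 R; z \<in> cball 0 R\<rbrakk> \<Longrightarrow>
      \<bar>?F x $ j - ?F z $ j\<bar> \<le> L j * norm (x - z)"
    by metis
  have "norm (?F x - ?F z) \<le> (\<Sum>j\<in>UNIV. L j) * norm (x - z)"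
    if "x \<in> cball 0 R" "z \<in> cball 0 R" for x z
  proof -
    have "norm (?F x - ?F z) \<le> (\<Sum>j\<in>UNIV. \<bar>(?F x - ?F z) $ j\<bar>)" by (rule norm_le_l1_cart)
    also have "\<dots> \<le> (\<Sum>j\<in>UNIV. L j * norm (x - z))"
      using L[OF that] by (intro sum_mono) simp
    finally show ?thesis by (simp add: sum_distrib_right)
  qed
  then show ?thesis by blast
qed

text \<open>Components of the fields and their first and second derivatives are polynomial families,
  hence bounded uniformly for y in K and x in the unit ball about y. The rest passes from components
  to norms.\<close>

lemma uniformly_controlled_field:
  fixes W :: "'p::finite \<Rightarrow> real^'p \<Rightarrow> real^'p \<Rightarrow> real^'p"
  assumes W: "\<And>k j. poly_family S (\<lambda>y x. W k y x $ j)" and K: "compact K" "K \<subseteq> S"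
  shows "\<exists>M. \<forall>y\<in>K. (\<forall>k j. \<bar>W k y y $ j\<bar> \<le> M) \<and>
    (\<exists>A'. controlled_field y (field_combination (\<lambda>k. W k y)) A' M)"
proof -
  define G where "G k l j y = pd l (\<lambda>x. W k y x $ j)" for k l j y
  have G: "poly_family S (G k l j)" for k l j
    unfolding G_def by (rule poly_family_pd[OF W])
  obtain N0 where N0: "\<And>k j y x. \<lbrakk>y \<in> K; x \<in> cball y 1\<rbrakk> \<Longrightarrow> \<bar>W k y x $ j\<bar> \<le> N0"
  proof -
    \<comment> \<open>All indices are packed into one tuple, because
      \<open>poly_family_bounded\<close> takes its maximum over a single finite index type.\<close>
    have "\<exists>N. \<forall>i. \<forall>y\<in>K. \<forall>x\<in>cball y 1. \<bar>W (fst i) y x $ snd i\<bar> \<le> N"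
      by (rule poly_family_bounded[of S "\<lambda>i y x. W (fst i) y x $ snd i", OF W K])
    then show thesis using that by (metis fst_conv snd_conv)
  qed
  obtain N1 where N1: "\<And>k l j y x. \<lbrakk>y \<in> K; x \<in> cball y 1\<rbrakk> \<Longrightarrow> \<bar>G k l j y x\<bar> \<le> N1"
  proof -
    have "\<exists>N. \<forall>i. \<forall>y\<in>K. \<forall>x\<in>cball y 1. \<bar>G (fst i) (fst (snd i)) (snd (snd i)) y x\<bar> \<le> N"
      by (rule poly_family_bounded[of S "\<lambda>i. G (fst i) (fst (snd i)) (snd (snd i))", OF G K])
    then show thesis using that by (metis fst_conv snd_conv)
  qed
  obtain N2 where N2: "\<And>k l j m y x. \<lbrakk>y \<in> K; x \<in> cball y 1\<rbrakk> \<Longrightarrow> \<bar>pd m (G k l j y) x\<bar> \<le> N2"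
  proof -
    have "\<exists>N. \<forall>i. \<forall>y\<in>K. \<forall>x\<in>cball y 1.
        \<bar>pd (fst i) (G (fst (snd i)) (fst (snd (snd i))) (snd (snd (snd i))) y) x\<bar> \<le> N"
      by (rule poly_family_bounded[of S "\<lambda>i y. pd (fst i) (G (fst (snd i)) (fst (snd (snd i))) (snd (snd (snd i))) y)",
        OF poly_family_pd[OF G] K])
    then show thesis using that by (metis fst_conv snd_conv)
  qed
  define N where "N = max 1 (max N0 (max N1 N2))"
  have N: "1 \<le> N" "N0 \<le> N" "N1 \<le> N" "N2 \<le> N" by (auto simp: N_def)
  let ?n = "real CARD('p)"
  have n: "1 \<le> ?n" using zero_less_card_finite[where 'a = 'p] by linarith
  \<comment> \<open>Each passage from components to a norm or a sum costs a factor
    \<open>?n\<close>: the bounds for the field, for its derivative and for the Lipschitz constant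
    of the derivative need the powers 2, 3 and 4.\<close>
  define M where "M = ?n ^ 4 * N"
  have M: "0 < M" using n N unfolding M_def by (intro mult_pos_pos) auto
  have pow: "?n ^ i * N \<le> M" if "i \<le> 4" for i
    unfolding M_def using n N that by (intro mult_right_mono power_increasing) auto
  have "(\<forall>k j. \<bar>W k y y $ j\<bar> \<le> M) \<and> (\<exists>A'. controlled_field y (field_combination (\<lambda>k. W k y)) A' M)"
    if y: "y \<in> K" for y
  proof -
    have W_le: "\<bar>W k y y $ j\<bar> \<le> M" for k j
      using N0[OF y, of y k j] N pow[of 0] by simp
    define A' where "A' x h u = (\<chi> j. \<Sum>k\<in>UNIV. u $ k * (\<Sum>l\<in>UNIV. h $ l * G k l j y x))" for x h u :: "real^'p"
    have "controlled_field y (field_combination (\<lambda>k. W k y)) A' M"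
    proof (rule controlled_field.intro)
      show "0 < M" by (rule M)
      fix x h u :: "real^'p"
      show "linear (field_combination (\<lambda>k. W k y) x)" by (rule linear_field_combination)
      show "linear (A' x h)"
        unfolding A'_def
        by (rule linearI) (simp_all add: vec_eq_iff distrib_right sum.distrib sum_distrib_left mult.assoc)
      have "((\<lambda>x. field_combination (\<lambda>k. W k y) x u $ j) has_derivative (\<lambda>h. A' x h u $ j)) (at x)" for j
        unfolding field_combination_component A'_def vec_lambda_beta G_def
        by (intro has_derivative_sum has_derivative_mult_right
          has_derivative_pd poly_family_differentiable[OF W])
      then show "((\<lambda>x. field_combination (\<lambda>k. W k y) x u) has_derivative (\<lambda>h. A' x h u)) (at x)"
        unfolding has_derivative_componentwise_within[of "\<lambda>x. field_combination (\<lambda>k. W k y) x u"]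
        by (auto simp: Basis_vec_def inner_axis)
      show "norm (field_combination (\<lambda>k. W k y) x u) \<le> M * norm u" if x: "x \<in> cball y 1"
      proof -
        have "\<bar>W k y x $ j\<bar> \<le> N" for k j using N0[OF y x, of k j] N by linarith
        then have "norm (field_combination (\<lambda>k. W k y) x u) \<le> ?n * (?n * (norm u * N))"
          by (intro norm_le_card_mult) (simp only: field_combination_component abs_linear_combination_le)
        also have "\<dots> = ?n ^ 2 * N * norm u" by (simp add: power2_eq_square)
        also have "\<dots> \<le> M * norm u" using pow[of 2] by (intro mult_right_mono) auto
        finally show ?thesis .
      qed
      \<comment> \<open>The coefficients \<open>a\<close> are left arbitrary, so that the bound
        applies both to the derivative itself and to its increment between two points.\<close>
      have A'_le: "norm (\<chi> j. \<Sum>k\<in>UNIV. u $ k * (\<Sum>l\<in>UNIV. h $ l * a k l j)) \<le> ?n ^ 3 * b * norm h * norm u"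
        if "\<And>k l j. \<bar>a k l j\<bar> \<le> b"
        for a :: "'p \<Rightarrow> 'p \<Rightarrow> 'p \<Rightarrow> real" and b
      proof -
        have "norm (\<chi> j. \<Sum>k\<in>UNIV. u $ k * (\<Sum>l\<in>UNIV. h $ l * a k l j))
            \<le> ?n * (?n * (norm u * (?n * (norm h * b))))"
          by (intro norm_le_card_mult) (simp only: vec_lambda_beta abs_linear_combination_le that)
        then show ?thesis by (simp add: power3_eq_cube mult_ac)
      qed
      show "norm (A' x h u) \<le> M * norm h * norm u" if x: "x \<in> cball y 1"
      proof -
        have "\<bar>G k l j y x\<bar> \<le> N" for k l j using N1[OF y x, of k l j] N by linarith
        then have "norm (A' x h u) \<le> ?n ^ 3 * N * norm h * norm u"
          unfolding A'_def by (rule A'_le)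
        also have "\<dots> \<le> M * norm h * norm u" using pow[of 3] by (intro mult_right_mono) auto
        finally show ?thesis .
      qed
      show "norm (A' x h u - A' z h u) \<le> M * norm (x - z) * norm h * norm u"
        if x: "x \<in> cball y 1" and z: "z \<in> cball y 1" for z
      proof -
        have pdG: "\<bar>pd m (G k l j y) w\<bar> \<le> N" if "w \<in> cball y 1" for k l j m w
          using N2[OF y that, of m k l j] N by linarith
        have "\<bar>G k l j y x - G k l j y z\<bar> \<le> ?n * N * norm (x - z)" for k l j
          by (rule lipschitz_pd_bound[OF convex_cball poly_family_differentiable[OF G] pdG x z])
        then have "norm (\<chi> j. \<Sum>k\<in>UNIV. u $ k * (\<Sum>l\<in>UNIV. h $ l * (G k l j y x - G k l j y z)))
            \<le> ?n ^ 3 * (?n * N * norm (x - z)) * norm h * norm u"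
          by (rule A'_le)
        moreover have "A' x h u - A' z h u
            = (\<chi> j. \<Sum>k\<in>UNIV. u $ k * (\<Sum>l\<in>UNIV. h $ l * (G k l j y x - G k l j y z)))"
          by (simp add: A'_def vec_eq_iff right_diff_distrib sum_subtractf)
        ultimately show ?thesis by (simp add: M_def power3_eq_cube power4_eq_xxxx mult_ac)
      qed
    qed
    with W_le show ?thesis by blast
  qed
  then show ?thesis by blast
qed

section \<open>Homogeneous norm, determinant and nondegeneracy\<close>

lemma norm_le_hom_norm:
  fixes u :: "real^'p::finite"
  assumes B: "\<And>k. B k \<noteq> []" and u: "norm u \<le> 1"
  shows "norm u \<le> hom_norm B u"
proof -
  have "norm u \<le> (\<Sum>k\<in>UNIV. \<bar>u $ k\<bar>)" by (rule norm_le_l1_cart)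
  also have "\<dots> \<le> hom_norm B u"
    unfolding hom_norm_def
  proof (rule sum_mono)
    fix k
    have "\<bar>u $ k\<bar> \<le> 1" using component_le_norm_cart[of u k] u by linarith
    moreover have "1 / real (weight (B k)) \<le> 1" using weight_pos[OF B, of k] by simp
    ultimately have "\<bar>u $ k\<bar> powr 1 \<le> \<bar>u $ k\<bar> powr (1 / real (weight (B k)))"
      by (intro powr_mono') auto
    then show "\<bar>u $ k\<bar> \<le> \<bar>u $ k\<bar> powr (1 / real (weight (B k)))" by simp
  qed
  finally show ?thesis .
qed

lemma locally_hoelder_det:
  fixes V :: "real^'p::finite \<Rightarrow> real^'n^'n"
  assumes U: "0 < \<alpha>" "\<alpha> \<le> 1" "open U" and V: "\<And>i j. locally_hoelder \<alpha> U (\<lambda>y. V y $ i $ j)"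
  shows "locally_hoelder \<alpha> U (\<lambda>y. det (V y))"
proof -
  have prod: "regular \<alpha> U 0 (\<lambda>y. \<Prod>i\<in>I. V y $ i $ p i)" if "finite I" for I p
    using that
  proof (induction I rule: finite_induct)
    case empty
    then show ?case using regular_const[OF U, of 0 1] by simp
  next
    case (insert i I)
    then show ?case
      using regular_mult[OF U, of 0 "\<lambda>y. V y $ i $ p i"] V by simp
  qed
  have "regular \<alpha> U 0 (\<lambda>y. \<Sum>p | p permutes UNIV. of_int (sign p) * (\<Prod>i\<in>UNIV. V y $ i $ p i))"
    by (intro regular_sum[OF U] regular_mult[OF U] regular_const[OF U] prod finite_permutations finite)
  then show ?thesis unfolding det_def by simp
qed

text \<open>Independence is a property of the set \<open>range W\<close>; injectivity makes the
  coefficients of the family into coefficients on that set through \<open>inv W\<close>.\<close>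

lemma field_combination_eq_0:
  assumes "inj W" "independent (range W)" "(\<Sum>k\<in>UNIV. (u $ k) *\<^sub>R W k) = 0"
  shows "u = (0 :: real^'p::finite)"
proof -
  have "(\<Sum>v\<in>range W. (u $ inv W v) *\<^sub>R v) = 0"
    using assms by (simp add: sum.reindex)
  then have "u $ inv W (W k) = 0" for k
    using independentD[OF assms(2), of "range W" "\<lambda>v. u $ inv W v" "W k"] by simp
  then show ?thesis using assms(1) by (simp add: vec_eq_iff)
qed

text \<open>A continuous positive function on the compact product of K and the unit sphere has a
  positive minimum, and homogeneity extends the bound to all u. This turns pointwise independence
  into the quantitative constant m of the inversion lemma.\<close>

lemma uniform_lower_bound:
  fixes V :: "'p::finite \<Rightarrow> real^'p \<Rightarrow> real^'p"
  assumes K: "compact K" and V: "\<And>k. continuous_on K (V k)"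
    and inj: "\<And>y u. \<lbrakk>y \<in> K; (\<Sum>k\<in>UNIV. (u $ k) *\<^sub>R V k y) = 0\<rbrakk> \<Longrightarrow> u = (0 :: real^'p)"
  obtains m where "0 < m" "\<And>y u. y \<in> K \<Longrightarrow> m * norm u \<le> norm (\<Sum>k\<in>UNIV. (u $ k) *\<^sub>R V k y)"
proof (cases "K = {}")
  case False
  let ?f = "\<lambda>z. norm (\<Sum>k\<in>UNIV. (snd z $ k) *\<^sub>R V k (fst z))"
  have cont: "continuous_on (K \<times> sphere (0::real^'p) 1) ?f"
    by (intro continuous_intros continuous_on_compose2[OF V continuous_on_fst]) auto
  have "K \<times> sphere (0::real^'p) 1 \<noteq> {}" using False by auto
  from continuous_attains_inf[OF compact_Times[OF K compact_sphere] this cont]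
  obtain z where z: "z \<in> K \<times> sphere (0::real^'p) 1"
    "\<And>w. w \<in> K \<times> sphere (0::real^'p) 1 \<Longrightarrow> ?f z \<le> ?f w" by blast
  show thesis
  proof (rule that)
    show "0 < ?f z" using z(1) inj[of "fst z" "snd z"] by auto
    fix y :: "real^'p" and u :: "real^'p" assume y: "y \<in> K"
    show "?f z * norm u \<le> norm (\<Sum>k\<in>UNIV. (u $ k) *\<^sub>R V k y)"
    proof (cases "u = 0")
      case False
      have "?f z \<le> ?f (y, (1 / norm u) *\<^sub>R u)"
        using y False by (intro z(2)) auto
      also have "(\<Sum>k\<in>UNIV. (snd (y, (1 / norm u) *\<^sub>R u) $ k) *\<^sub>R V k (fst (y, (1 / norm u) *\<^sub>R u)))
          = (1 / norm u) *\<^sub>R (\<Sum>k\<in>UNIV. (u $ k) *\<^sub>R V k y)"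
        by (simp add: scaleR_sum_right)
      also have "norm \<dots> = norm (\<Sum>k\<in>UNIV. (u $ k) *\<^sub>R V k y) / norm u" by simp
      finally show ?thesis using False by (simp add: pos_le_divide_eq)
    qed simp
  qed
qed (use that[of 1] in auto)

section \<open>Choice of constants and conclusion\<close>

theorem proposition35:
  fixes \<Omega> :: "(real^'p::finite) set"
    and X :: "nat \<Rightarrow> real^'p \<Rightarrow> real^'p"
    and n r :: nat and \<alpha> :: real
    and B :: "'p \<Rightarrow> nat list"
  assumes "open \<Omega>" and "connected \<Omega>" and "bounded \<Omega>"
    and "r \<ge> 2" and "0 < \<alpha>" and "\<alpha> \<le> 1"
    and "\<And>i j. i \<in> {1..n} \<Longrightarrow> C_k_hoelder_on (r - 1) \<alpha> \<Omega> (\<lambda>x. X i x $ j)"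
    and "\<And>j. C_k_hoelder_on (r - 2) \<alpha> \<Omega> (\<lambda>x. X 0 x $ j)"
    and "hoermander_condition n r \<Omega> X"
    and "free_up_to_weight n r \<Omega> X"
    and "commutator_basis n r \<Omega> X B"
  shows "\<exists>c :: real^'p \<Rightarrow> real. \<forall>\<Omega>'. compact (closure \<Omega>') \<and> closure \<Omega>' \<subseteq> \<Omega> \<longrightarrow>
    hoelder_on \<alpha> \<Omega>' c \<and> bounded (c ` \<Omega>') \<and> (\<exists>c0 > 0. \<forall>y\<in>\<Omega>'. c0 \<le> \<bar>c y\<bar>) \<and>
    (\<exists>U \<omega> C. open U \<and> 0 \<in> U \<and>
      (\<forall>y\<in>\<Omega>'.
        Theta_inv r X B y 0 = y \<and>
        C1_diffeomorphism U (Theta_inv r X B y ` U) (Theta_inv r X B y) (Theta r X B U y) \<and>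
        (\<forall>u\<in>U. det (jacobian (Theta_inv r X B y) (at u)) = c y + \<omega> y u \<and>
                \<bar>\<omega> y u\<bar> \<le> C * hom_norm B u)))"
proof -
  note reg = \<open>0 < \<alpha>\<close> \<open>\<alpha> \<le> 1\<close> \<open>open \<Omega>\<close>
  have X: "C_k_hoelder_on (r - wt i) \<alpha> \<Omega> (\<lambda>x. X i x $ j)" if "i \<in> {0..n}" for i j
    using that assms(7)[of i j] assms(8)[of j] by (cases "i = 0") (auto simp: wt_def)
  have B: "B k \<in> multiindices n r" for k
    using assms(11) by (auto simp: commutator_basis_def)
  have comm: "regular \<alpha> \<Omega> (r - weight (B k)) (\<lambda>x. field_comm X (B k) x $ j)"
    "poly_family \<Omega> (\<lambda>y x. field_comm (approx_field r X y) (B k) x $ j)"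
    "y \<in> \<Omega> \<Longrightarrow> same_jet (r - weight (B k)) (\<lambda>x. field_comm X (B k) x $ j)
      (\<lambda>x. field_comm (approx_field r X y) (B k) x $ j) y" for k j y
    by (rule field_comm_approx[OF reg X B]; assumption)+
  define W where "W k y = field_comm (approx_field r X y) (B k)" for k y
  have W: "poly_family \<Omega> (\<lambda>y x. W k y x $ j)" for k j
    unfolding W_def by (rule comm(2))
  \<comment> \<open>The fields are the columns, matching the convention of \<open>jacobian\<close>:
    entry (j, k) is the derivative of component j in the coordinate direction k at u = 0.\<close>
  define V where "V y = (\<chi> j k. field_comm X (B k) y $ j)" for y
  have W_center: "W k y y = field_comm X (B k) y" if "y \<in> \<Omega>" for k y
    using same_jet_value[OF comm(3)[OF that]] unfolding W_def by (simp add: vec_eq_iff)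
  have V_hoelder: "locally_hoelder \<alpha> \<Omega> (\<lambda>y. field_comm X (B k) y $ j)" for k j
    using regular_mono[OF reg comm(1), of 0] by simp
  \<comment> \<open>The signed determinant is taken on all of \<Omega>, before
    \<open>\<Omega>'\<close> is chosen, so the same c serves every \<open>\<Omega>'\<close>.\<close>
  define c where "c y = det (V y)" for y
  have c_hoelder: "locally_hoelder \<alpha> \<Omega> c"
    unfolding c_def by (rule locally_hoelder_det[OF reg]) (simp add: V_def V_hoelder)
  have basis: "inj (\<lambda>k. field_comm X (B k) y)" "independent (range (\<lambda>k. field_comm X (B k) y))"
    if "y \<in> \<Omega>" for y
    using that assms(11) unfolding commutator_basis_def by auto
  have ker: "u = 0" if "y \<in> \<Omega>" "(\<Sum>k\<in>UNIV. (u $ k) *\<^sub>R field_comm X (B k) y) = 0"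
    for y and u :: "real^'p"
    by (rule field_combination_eq_0[OF basis[OF that(1)] that(2)])
  have c_nonzero: "c y \<noteq> 0" if y: "y \<in> \<Omega>" for y
  proof -
    have "V y *v u = (\<Sum>k\<in>UNIV. (u $ k) *\<^sub>R field_comm X (B k) y)" for u
      by (simp add: vec_eq_iff V_def matrix_vector_mult_def mult.commute)
    then have "\<forall>u. V y *v u = 0 \<longrightarrow> u = 0" using ker[OF y] by simp
    then show ?thesis
      unfolding c_def invertible_det_nz[symmetric] invertible_left_inverse matrix_left_invertible_ker .
  qed
  show ?thesis
  proof (intro exI[of _ c] allI impI)
    fix \<Omega>' :: "(real^'p) set"
    assume "compact (closure \<Omega>') \<and> closure \<Omega>' \<subseteq> \<Omega>"
    then have K: "compact (closure \<Omega>')" "closure \<Omega>' \<subseteq> \<Omega>" by auto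
    let ?K = "closure \<Omega>'"
    have sub: "\<Omega>' \<subseteq> ?K" by (rule closure_subset)
    have c_cont: "continuous_on ?K c"
      by (rule continuous_on_subset[OF locally_hoelder_imp_continuous_on[OF c_hoelder reg(1)] K(2)])
    have goal1: "hoelder_on \<alpha> \<Omega>' c"
      using locally_hoelder_imp_hoelder_on[OF c_hoelder reg(1) K] sub by (rule hoelder_on_subset)
    have goal2: "bounded (c ` \<Omega>')"
      using compact_imp_bounded[OF compact_continuous_image[OF c_cont K(1)]] sub
      by (rule bounded_subset[OF _ image_mono])
    have goal3: "\<exists>c0 > 0. \<forall>y\<in>\<Omega>'. c0 \<le> \<bar>c y\<bar>"
    proof (cases "\<Omega>' = {}")
      case False
      then have "?K \<noteq> {}" by simp
      moreover have "continuous_on ?K (\<lambda>y. \<bar>c y\<bar>)" using c_cont by (intro continuous_intros)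
      ultimately obtain y0 where y0: "y0 \<in> ?K" "\<And>y. y \<in> ?K \<Longrightarrow> \<bar>c y0\<bar> \<le> \<bar>c y\<bar>"
        using continuous_attains_inf[OF K(1)] by blast
      then show ?thesis
        using sub c_nonzero[of y0] K(2) by (intro exI[of _ "\<bar>c y0\<bar>"]) auto
    qed (use zero_less_one in blast)
    obtain M where M: "\<And>y k j. y \<in> ?K \<Longrightarrow> \<bar>W k y y $ j\<bar> \<le> M"
      "\<And>y. y \<in> ?K \<Longrightarrow> \<exists>A'. controlled_field y (field_combination (\<lambda>k. W k y)) A' M"
      using uniformly_controlled_field[where W = W, OF W K] by blast
    have V_cont: "continuous_on ?K (field_comm X (B k))" for k
    proof -
      have "continuous_on ?K (\<lambda>y. \<chi> j. field_comm X (B k) y $ j)"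
        by (intro continuous_on_vec_lambda
          continuous_on_subset[OF locally_hoelder_imp_continuous_on[OF V_hoelder reg(1)] K(2)])
      then show ?thesis by simp
    qed
    have ker_K: "u = 0" if "y \<in> ?K" "(\<Sum>k\<in>UNIV. (u $ k) *\<^sub>R field_comm X (B k) y) = 0"
      for y and u :: "real^'p"
      using ker that K(2) by (auto simp: subset_iff)
    obtain m where m: "0 < m" "\<And>y u. y \<in> ?K \<Longrightarrow>
        m * norm u \<le> norm (\<Sum>k\<in>UNIV. (u $ k) *\<^sub>R field_comm X (B k) y)"
      by (rule uniform_lower_bound[where V = "\<lambda>k. field_comm X (B k)", OF K(1) V_cont])
        (rule ker_K, assumption, assumption, rule that)
    have "\<exists>U \<omega> C. open U \<and> 0 \<in> U \<and> (\<forall>y\<in>\<Omega>'. Theta_inv r X B y 0 = y \<and>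
        C1_diffeomorphism U (Theta_inv r X B y ` U) (Theta_inv r X B y) (Theta r X B U y) \<and>
        (\<forall>u\<in>U. det (jacobian (Theta_inv r X B y) (at u)) = c y + \<omega> y u \<and>
                \<bar>\<omega> y u\<bar> \<le> C * hom_norm B u))"
    \<comment> \<open>Positivity of M is read off from the locale at some center, so an empty
      \<open>\<Omega>'\<close> is treated apart.\<close>
    proof (cases "\<Omega>' = {}")
      case True
      then show ?thesis by (intro exI[of _ UNIV]) auto
    next
      case False
      then have M_pos: "0 < M"
        using M(2) sub controlled_field.M_pos by blast
      \<comment> \<open>The three bounds serve in turn the comparison of |u| with the homogeneous
        norm, the existence of the flow up to time 1, and the inversion condition.\<close>
      define \<rho> where "\<rho> = min 1 (min (1 / (2 * M)) (m / (24 * M\<^sup>2)))"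
      have \<rho>: "0 < \<rho>" "\<rho> \<le> 1" "\<rho> \<le> 1 / (2 * M)" and \<rho>': "\<rho> \<le> m / (24 * M\<^sup>2)"
        using M_pos m(1) by (auto simp: \<rho>_def)
      have \<rho>m: "24 * M\<^sup>2 * \<rho> \<le> m"
        using \<rho>' M_pos by (simp add: pos_le_divide_eq mult.commute)
      \<comment> \<open>Entries of \<open>V y\<close> are at most M and, as |u| \<le> 1, those of
        the Jacobian differ from them by at most 12 M^2; b therefore covers both arguments of
        \<open>det_lipschitz\<close>.\<close>
      define b where "b = M + 12 * M\<^sup>2"
      obtain L where L: "0 \<le> L" "\<forall>(P :: real^'p^'p) Q d. (\<forall>i j. \<bar>P $ i $ j\<bar> \<le> b \<and> \<bar>Q $ i $ j\<bar> \<le> b \<and>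
          \<bar>P $ i $ j - Q $ i $ j\<bar> \<le> d) \<longrightarrow> \<bar>det P - det Q\<bar> \<le> L * d"
        using det_lipschitz[where b = b] by blast
      let ?U = "ball (0::real^'p) \<rho>"
      let ?E = "\<lambda>y. Theta_inv r X B y"
      \<comment> \<open>Defined as the remainder, so the decomposition of the Jacobian is automatic
        and the whole content lies in the bound.\<close>
      define \<omega> where "\<omega> y u = det (jacobian (?E y) (at u)) - c y" for y u
      have "?E y 0 = y \<and> C1_diffeomorphism ?U (?E y ` ?U) (?E y) (Theta r X B ?U y) \<and>
        (\<forall>u\<in>?U. det (jacobian (?E y) (at u)) = c y + \<omega> y u \<and> \<bar>\<omega> y u\<bar> \<le> L * (12 * M\<^sup>2) * hom_norm B u)"
        if "y \<in> \<Omega>'" for y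
      proof -
        have y: "y \<in> ?K" "y \<in> \<Omega>" using that sub K(2) by auto
        obtain A' where A': "controlled_field y (field_combination (\<lambda>k. W k y)) A' M"
          using M(2)[OF y(1)] by blast
        have lower: "m * norm h \<le> norm (field_combination (\<lambda>k. W k y) y h)" for h
          using m(2)[OF y(1), of h] by (simp add: field_combination_def W_center[OF y(2)])
        have E: "?E y = (\<lambda>u. exp_field (\<lambda>x. field_combination (\<lambda>k. W k y) x u) y)"
          by (simp add: fun_eq_iff Theta_inv_def field_combination_def W_def)
        note ef = exp_field_controlled[OF A' field_combination_lipschitz_cball[where W = W, OF W] lower m(1)
            \<rho>(1,3) \<rho>m, folded E]
        have V_le: "\<bar>V y $ i $ k\<bar> \<le> M" for i k
          using M(1)[OF y(1), of k i] by (simp add: V_def W_center[OF y(2)])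
        have "\<bar>\<omega> y u\<bar> \<le> L * (12 * M\<^sup>2) * hom_norm B u" if u: "u \<in> ?U" for u
        proof -
          have u1: "norm u \<le> 1" using u \<rho>(2) by simp
          have diff: "\<bar>jacobian (?E y) (at u) $ i $ k - V y $ i $ k\<bar> \<le> 12 * M\<^sup>2 * norm u" for i k
            using ef(3)[OF u, of i k] by (simp add: field_combination_axis V_def W_center[OF y(2)])
          have "12 * M\<^sup>2 * norm u \<le> 12 * M\<^sup>2 * 1"
            using u1 by (intro mult_left_mono) auto
          then have jac: "\<bar>jacobian (?E y) (at u) $ i $ k\<bar> \<le> b" for i k
            using diff[of i k] V_le[of i k] unfolding b_def by linarith
          have "\<bar>V y $ i $ k\<bar> \<le> b" for i k
            using V_le[of i k] by (simp add: b_def add_increasing2)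
          then have "\<bar>\<omega> y u\<bar> \<le> L * (12 * M\<^sup>2 * norm u)"
            unfolding \<omega>_def c_def using jac diff by (intro L(2)[rule_format]) blast
          also have "\<dots> \<le> L * (12 * M\<^sup>2 * hom_norm B u)"
            using B L(1) by (intro mult_left_mono norm_le_hom_norm u1) (auto simp: multiindices_def)
          finally show ?thesis by (simp add: mult.assoc)
        qed
        moreover have "C1_diffeomorphism ?U (?E y ` ?U) (?E y) (Theta r X B ?U y)"
          using ef(2) by (simp add: Theta_def)
        ultimately show ?thesis
          using trans[OF fun_cong[OF E, of 0] ef(1)] by (simp add: \<omega>_def)
      qed
      then show ?thesis
        using \<rho>(1) by (intro exI[of _ ?U] exI[of _ \<omega>] exI[of _ "L * (12 * M\<^sup>2)"]) simp
    qed
    with goal1 goal2 goal3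
    show "hoelder_on \<alpha> \<Omega>' c \<and> bounded (c ` \<Omega>') \<and> (\<exists>c0 > 0. \<forall>y\<in>\<Omega>'. c0 \<le> \<bar>c y\<bar>) \<and>
      (\<exists>U \<omega> C. open U \<and> 0 \<in> U \<and> (\<forall>y\<in>\<Omega>'. Theta_inv r X B y 0 = y \<and>
        C1_diffeomorphism U (Theta_inv r X B y ` U) (Theta_inv r X B y) (Theta r X B U y) \<and>
        (\<forall>u\<in>U. det (jacobian (Theta_inv r X B y) (at u)) = c y + \<omega> y u \<and>
                \<bar>\<omega> y u\<bar> \<le> C * hom_norm B u)))"
      by blast
  qed
qed

end
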